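(* Let $\mathfrak{A}$ be a JB$^*$-algebra. Then for each $\phi\in\mathfrak{A}^*$ there exist $\varphi\in\mathfrak{A}^*$ and $a\in\mathfrak{A}$ such that $$\phi=\varphi U_a=2(\varphi\circ a)\circ a-\varphi\circ a^2.$$
   Context: A JB$^*$-algebra is a complex Banach space $\mathfrak{A}$ with a commutative bilinear product $\circ$ satisfying the Jordan identity $(x\circ y)\circ x^2 = x\circ(y\circ x^2)$, with $\|a\circ b\|\le\|a\|\,\|b\|$, and with a conjugate-linear algebra involution $^*$ such that $\|U_a(a^* )\|=\|a\|^3$ for all $a$, where $U_a(b)=2(a\circ b)\circ a-a^2\circ b$. $\mathfrak{A}^*$ is the Banach dual of $\mathfrak{A}$, with Jordan module product $(\phi\circ a)(b)=\phi(a\circ b)$ for $\phi\in\mathfrak{A}^*$, $a,b\in\mathfrak{A}$; $\varphi U_a$ denotes the composition $b\mapsto\varphi(U_a(b))$. *)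

theory Defs
  imports "HOL-Analysis.Analysis"
begin

text \<open>A complex Banach space is a type of class \<open>banach\<close> (a real Banach space) together with a
  complex scalar multiplication that extends the real one and is compatible with the norm.\<close>

locale complex_banach_space = vector_space scaleC
  for scaleC :: "complex \<Rightarrow> 'a::banach \<Rightarrow> 'a" +
  assumes scaleC_of_real: "scaleC (of_real r) x = r *\<^sub>R x"
    and norm_scaleC: "norm (scaleC c x) = cmod c * norm x"

definition jordan_U :: "('a \<Rightarrow> 'a \<Rightarrow> 'a) \<Rightarrow> 'a \<Rightarrow> 'a \<Rightarrow> 'a::real_vector"
  where "jordan_U jprod a b = 2 *\<^sub>R jprod (jprod a b) a - jprod (jprod a a) b"

text \<open>Linearity of \<open>jprod\<close> in its first argument follows from commutativity.  No unit is assumed.\<close>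

locale jb_star_algebra = complex_banach_space scaleC
  for scaleC :: "complex \<Rightarrow> 'a::banach \<Rightarrow> 'a" +
  fixes jprod :: "'a \<Rightarrow> 'a \<Rightarrow> 'a"
    and star :: "'a \<Rightarrow> 'a"
  assumes jprod_commute: "jprod x y = jprod y x"
    and jprod_add_right: "jprod x (y + z) = jprod x y + jprod x z"
    and jprod_scaleC_right: "jprod x (scaleC c y) = scaleC c (jprod x y)"
    and jordan_identity: "jprod (jprod x y) (jprod x x) = jprod x (jprod y (jprod x x))"
    and norm_jprod_le: "norm (jprod x y) \<le> norm x * norm y"
    and star_star: "star (star x) = x"
    and star_add: "star (x + y) = star x + star y"
    and star_scaleC: "star (scaleC c x) = scaleC (cnj c) (star x)"
    and star_jprod: "star (jprod x y) = jprod (star y) (star x)"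
    and norm_jordan_U_star: "norm (jordan_U jprod x (star x)) = norm x ^ 3"

text \<open>The library's \<open>bounded_linear\<close> is real linearity plus boundedness, so complex linearity is
  required separately.\<close>

definition complex_dual :: "(complex \<Rightarrow> 'a::real_normed_vector \<Rightarrow> 'a) \<Rightarrow> ('a \<Rightarrow> complex) set"
  where "complex_dual scaleC =
    {\<phi>. bounded_linear \<phi> \<and> (\<forall>c x. \<phi> (scaleC c x) = c * \<phi> x)}"

definition dual_jprod :: "('a \<Rightarrow> 'a \<Rightarrow> 'a) \<Rightarrow> ('a \<Rightarrow> complex) \<Rightarrow> 'a \<Rightarrow> ('a \<Rightarrow> complex)"
  where "dual_jprod jprod \<phi> a = (\<lambda>b. \<phi> (jprod a b))"

end

theory Submission
  imports Defs "HOL-Computational_Algebra.Fundamental_Theorem_Algebra"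
begin

text \<open>Let \<open>\<rho>\<close> be a real functional on the self-adjoint part, with norm \<open>N\<close> almost attained at
  \<open>x\<close> in the unit ball.  If \<open>0 \<le> e \<le> 1\<close> satisfies \<open>U e x \<approx> x\<close>, then \<open>- e\<^sup>2 \<le> U e x \<le> e\<^sup>2\<close>, so
  adding a small multiple of an element of the other Peirce parts of \<open>e\<close> does not increase the norm
  to first order, and hence \<open>\<rho> \<approx> \<rho> \<circ> U e\<close> in norm.  Taking for \<open>e\<close> functions of one positive
  \<open>h\<close> that dominates norming sequences of \<open>Re \<phi>\<close> and \<open>Im \<phi>\<close>, one finds functions \<open>u j\<close>
  of \<open>h\<close> with \<open>\<phi> \<circ> U (u j) \<rightarrow> \<phi>\<close>, and a Cohen-type argument inside the associative algebra
  generated by \<open>h\<close> gives the factorization.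

  The order theory needed for this takes place in \<open>A \<oplus> \<real>\<close>, which is given no JB* norm.
  Positivity of an element means that its multiplication operator on \<open>A\<close> is accretive, so that
  sums of positive elements are positive for free.  Squares are positive because \<open>\<i>\<close> times a
  self-adjoint multiplication is a derivation of the triple product, hence infinitesimally isometric,
  and \<open>U a\<close> preserves positivity by the fundamental formula.\<close>

section \<open>Jordan algebras\<close>

text \<open>Cohen's factorization theorem does not apply as it stands, because
  \<open>a \<mapsto> U a\<close> is quadratic and in general not multiplicative. On functions of one
  element it is multiplicative: \<open>U (f h)\<close> after \<open>U (g h)\<close> is
  \<open>U ((f * g) h)\<close>. This is why all local units must be functions of the same
  \<open>h\<close>. The quadratic dependence also sets the scale of the convergence: quotients of
  size \<open>2 ^ j\<close> give operators of size \<open>4 ^ j\<close>, which are played against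
  approximation errors \<open>(1/16) ^ j\<close>. The order theory is built without spectra or
  states. An interval determined by the norm stands in for the spectrum, and polynomials positive on
  it are shown to be squares. The delicate point is the positivity of squares. The hermitian
  estimate controls the square of the multiplication by \<open>y\<close>, whereas accretivity of
  \<open>y \<odot> y\<close> concerns the multiplication by the square, and in a Jordan algebra
  these operators differ. The gap is closed by a uniform bound on powers together with a convexity
  argument.\<close>

locale jordan_product = bounded_bilinear jp
  for jp :: "'b::real_normed_vector \<Rightarrow> 'b \<Rightarrow> 'b" (infixl "\<odot>" 70) +
  assumes commute: "x \<odot> y = y \<odot> x"
    and jordan: "(x \<odot> y) \<odot> (x \<odot> x) = x \<odot> (y \<odot> (x \<odot> x))"
begin

lemmas bilin = add_left add_right diff_left diff_right minus_left minus_right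
  scaleR_left scaleR_right zero_left zero_right

text \<open>The Jordan identity makes a form that is cubic in \<open>x\<close> vanish on the
  diagonal. Its full polarization is what allows several different elements to be inserted.\<close>

lemma linearized_jordan:
  "(b \<odot> c) \<odot> (d \<odot> e) + (c \<odot> d) \<odot> (b \<odot> e) + (d \<odot> b) \<odot> (c \<odot> e)
   = b \<odot> ((c \<odot> d) \<odot> e) + c \<odot> ((d \<odot> b) \<odot> e) + d \<odot> ((b \<odot> c) \<odot> e)"
proof -
  define T where "T x u v = (x \<odot> e) \<odot> (u \<odot> v) - x \<odot> (e \<odot> (u \<odot> v))" for x u v
  have T0: "T x x x = 0" for x
    using jordan[of x e] by (simp add: T_def)
  have T1: "T (x + x') u v = T x u v + T x' u v" for x x' u v
    by (simp add: T_def bilin algebra_simps)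
  have T2: "T x (u + u') v = T x u v + T x u' v" for x u u' v
    by (simp add: T_def bilin algebra_simps)
  have T3: "T x u v = T x v u" for x u v
    by (simp add: T_def commute[of u v])
  have T4: "T x u (v + v') = T x u v + T x u v'" for x u v v'
    by (metis T2 T3)
  \<comment> \<open>Inclusion-exclusion isolates the six terms with three distinct arguments. They
    agree in pairs by the symmetry \<open>T3\<close>, hence the factor 2.\<close>
  have "2 *\<^sub>R (T b c d + T c d b + T d b c)
      = T (b + c + d) (b + c + d) (b + c + d) - T (b + c) (b + c) (b + c)
      - T (c + d) (c + d) (c + d) - T (b + d) (b + d) (b + d) + T b b b + T c c c + T d d d"
    unfolding T1 T2 T4 using T3[of b c d] T3[of c d b] T3[of d b c]
    by (simp add: algebra_simps scaleR_2)
  also have "\<dots> = 0" by (simp add: T0)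
  finally have "T b c d + T c d b + T d b c = 0" by simp
  then show ?thesis
    by (simp add: T_def algebra_simps commute)
qed

definition trip :: "'b \<Rightarrow> 'b \<Rightarrow> 'b \<Rightarrow> 'b"
  where "trip x y z = (x \<odot> y) \<odot> z + (z \<odot> y) \<odot> x - (x \<odot> z) \<odot> y"

definition U2 :: "'b \<Rightarrow> 'b \<Rightarrow> 'b \<Rightarrow> 'b"
  where "U2 x y z = x \<odot> (y \<odot> z) + y \<odot> (x \<odot> z) - (x \<odot> y) \<odot> z"

abbreviation U :: "'b \<Rightarrow> 'b \<Rightarrow> 'b" where "U x \<equiv> U2 x x"

lemma trip_sym: "trip x y z = trip z y x"
  by (simp add: trip_def commute)

lemma trip_U2: "trip x y z = U2 x z y"
  by (simp add: trip_def U2_def algebra_simps commute)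

lemma trip_bilin:
  "trip (x + x') y z = trip x y z + trip x' y z"
  "trip x (y + y') z = trip x y z + trip x y' z"
  "trip x y (z + z') = trip x y z + trip x y z'"
  "trip (x - x') y z = trip x y z - trip x' y z"
  "trip x (y - y') z = trip x y z - trip x y' z"
  "trip x y (z - z') = trip x y z - trip x y z'"
  by (simp_all add: trip_def bilin algebra_simps)

text \<open>The difference of the two sides is a combination of three defects \<open>?E\<close> of
  the linearized identity. The minus sign in the middle slot is what the factor \<i> and the
  conjugate-linear involution compensate later.\<close>

lemma jp_trip: "a \<odot> trip u v w = trip (a \<odot> u) v w - trip u (a \<odot> v) w + trip u v (a \<odot> w)"
proof -
  let ?E = "\<lambda>b c d e. (b \<odot> c) \<odot> (d \<odot> e) + (c \<odot> d) \<odot> (b \<odot> e) + (d \<odot> b) \<odot> (c \<odot> e)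
    - (b \<odot> ((c \<odot> d) \<odot> e) + c \<odot> ((d \<odot> b) \<odot> e) + d \<odot> ((b \<odot> c) \<odot> e))"
  have "a \<odot> trip u v w - (trip (a \<odot> u) v w - trip u (a \<odot> v) w + trip u v (a \<odot> w))
      = ?E a u w v - ?E a v w u - ?E a u v w"
    by (simp add: trip_def bilin algebra_simps commute)
  then show ?thesis by (simp add: linearized_jordan)
qed

lemma trip_op: "trip x y t = (x \<odot> y) \<odot> t + x \<odot> (y \<odot> t) - y \<odot> (x \<odot> t)"
  by (simp add: trip_def algebra_simps commute)

text \<open>By \<open>trip_op\<close>, \<open>trip x y\<close> is the multiplication by
  \<open>x \<odot> y\<close> plus a commutator of multiplications. Under \<open>jp_trip\<close> the
  middle slot changes sign once for the former and twice for the latter, which turns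
  \<open>trip x y\<close> into \<open>- trip y x\<close> there.\<close>

lemma jordan_triple:
  "trip x y (trip u v w) = trip (trip x y u) v w - trip u (trip y x v) w + trip u v (trip x y w)"
  unfolding trip_op[of x y] trip_op[of y x] jp_trip
  by (simp add: bilin trip_bilin jp_trip algebra_simps commute[of x y])

lemma U_add: "U2 (x + y) w z = U2 x w z + U2 y w z" "U2 w (x + y) z = U2 w x z + U2 w y z"
  "U2 x w (y + z) = U2 x w y + U2 x w z"
  by (simp_all add: U2_def bilin algebra_simps)

lemma U_diff: "U2 (x - y) w z = U2 x w z - U2 y w z" "U2 w (x - y) z = U2 w x z - U2 w y z"
  "U2 x w (y - z) = U2 x w y - U2 x w z"
  by (simp_all add: U2_def bilin algebra_simps)

lemma U_scale: "U2 (r *\<^sub>R x) w z = r *\<^sub>R U2 x w z" "U2 w (r *\<^sub>R x) z = r *\<^sub>R U2 w x z"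
  "U2 x w (r *\<^sub>R z) = r *\<^sub>R U2 x w z"
  by (simp_all add: U2_def bilin algebra_simps)

lemma U2_sym: "U2 x y z = U2 y x z"
  by (simp add: U2_def commute algebra_simps)

text \<open>Write \<open>p\<close>, \<open>q\<close>, \<open>r\<close> for
  \<open>trip x z (U x y)\<close>, \<open>trip x y (U x z)\<close>, \<open>U x (trip y x z)\<close>.
  The triple identity gives \<open>p = 2 q - r\<close>, and exchanging \<open>y\<close> and
  \<open>z\<close> gives \<open>q = 2 p - r\<close>; so all three coincide.\<close>

lemma trip_outer_U:
  "trip x y (U x z) = U x (trip y x z)" "trip x z (U x y) = U x (trip y x z)"
proof -
  have A: "trip x z (U x y) = 2 *\<^sub>R trip x y (U x z) - U x (trip y x z)" for y z
    using jordan_triple[of x z x y x]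
    by (simp add: trip_U2[symmetric] scaleR_2 trip_sym[of z x y])
       (metis trip_sym)
  have "trip x z (U x y) + U x (trip y x z) = trip x y (U x z) + trip x y (U x z)"
    "trip x y (U x z) + U x (trip y x z) = trip x z (U x y) + trip x z (U x y)"
    using A[of y z] A[of z y] trip_sym[of z x y] by (simp_all add: scaleR_2)
  moreover have "3 *\<^sub>R a = a + (a + a)" for a :: 'b
    using scaleR_add_left[of 1 2 a] by (simp add: scaleR_2)
  ultimately have "3 *\<^sub>R trip x z (U x y) = 3 *\<^sub>R trip x y (U x z)"
    by (metis add.left_commute add.commute)
  then have e: "trip x z (U x y) = trip x y (U x z)" by simp
  then show "trip x y (U x z) = U x (trip y x z)" "trip x z (U x y) = U x (trip y x z)"
    using A[of y z] trip_sym[of z x y] by (simp_all add: scaleR_2)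
qed

text \<open>Two instances of the triple identity bring both sides to
  \<open>U x (2 trip y x w - trip z x (U y x))\<close> with \<open>w = trip y x z\<close>;
  \<open>trip_outer_U\<close> moves \<open>U x\<close> to the outside.\<close>

theorem fundamental_formula: "U (U x y) z = U x (U y (U x z))"
proof -
  define w where "w = trip y x z"
  have 1: "trip x z (U x y) = U x w" unfolding w_def by (rule trip_outer_U(2))
  have 2: "trip x w (U x y) = U x (trip y x w)" by (rule trip_outer_U(2))
  have 3: "trip x y (U x w) = U x (trip y x w)" by (rule trip_outer_U(1))
  have 4: "trip x y (U x y) = U x (U y x)" unfolding trip_outer_U(1) trip_U2[of y x y] ..
  have 5: "trip x z (U x (U y x)) = U x (trip z x (U y x))"
    using trip_outer_U(1)[of x z "U y x"] by simp
  have "trip x y (trip x z (U x y))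
      = trip (trip x y x) z (U x y) - trip x (trip y x z) (U x y) + trip x z (trip x y (U x y))"
    by (rule jordan_triple)
  then have A: "U (U x y) z = 2 *\<^sub>R U x (trip y x w) - U x (trip z x (U y x))"
    unfolding 1 3 4 5 w_def[symmetric] 2 by (simp add: trip_U2 scaleR_2 algebra_simps)
  have "trip z x (trip y x y) = trip (trip z x y) x y - trip y (trip x z x) y + trip y x (trip z x y)"
    by (rule jordan_triple)
  moreover have "trip z x y = w" unfolding w_def by (rule trip_sym)
  ultimately have "U y (U x z) = 2 *\<^sub>R trip y x w - trip z x (U y x)"
    by (simp add: trip_U2[symmetric] scaleR_2 trip_sym[of w x y] algebra_simps)
  then show ?thesis unfolding A by (simp add: U_diff U_scale)
qed

text \<open>For pairwise operator commuting \<open>b\<close>, \<open>c\<close>, \<open>d\<close> the operators \<open>U2 b c\<close> multiply like the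
  symmetric kernels \<open>(b s * c t + c s * b t) / 2\<close>, with \<open>d\<close> acting as \<open>(d s + d t) / 2\<close>.\<close>

lemma jp_jp: "((b \<odot> c) \<odot> e) \<odot> d = (b \<odot> c) \<odot> (e \<odot> d) + (b \<odot> e) \<odot> (c \<odot> d)
    + (c \<odot> e) \<odot> (b \<odot> d) - b \<odot> (e \<odot> (c \<odot> d)) - c \<odot> (e \<odot> (b \<odot> d))"
  using linearized_jordan[of b c d e] by (simp add: algebra_simps commute)

lemma jp_U2:
  assumes "\<And>z. b \<odot> (c \<odot> z) = c \<odot> (b \<odot> z)" "\<And>z. b \<odot> (d \<odot> z) = d \<odot> (b \<odot> z)"
    "\<And>z. d \<odot> (c \<odot> z) = c \<odot> (d \<odot> z)"
    "\<And>z. (b \<odot> c) \<odot> (d \<odot> z) = d \<odot> ((b \<odot> c) \<odot> z)"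
    "\<And>z. (b \<odot> d) \<odot> (c \<odot> z) = c \<odot> ((b \<odot> d) \<odot> z)"
    "\<And>z. (c \<odot> d) \<odot> (b \<odot> z) = b \<odot> ((c \<odot> d) \<odot> z)"
  shows "2 *\<^sub>R (d \<odot> U2 b c z) = U2 (d \<odot> b) c z + U2 b (d \<odot> c) z"
proof -
  have a1: "(d \<odot> b) \<odot> c = (b \<odot> c) \<odot> d" using assms(1-3) commute by metis
  have a2: "b \<odot> (d \<odot> c) = (b \<odot> c) \<odot> d" using assms(1-3) commute by metis
  show ?thesis
    unfolding U2_def a1 a2 jp_jp[of b c d z] bilin scaleR_2
    using assms by (simp add: commute[of d b] commute[of d c] algebra_simps)
qed

text \<open>By \<open>jp_jp\<close>, multiplication by \<open>y \<odot> (y \<odot> p)\<close> is a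
  polynomial in the multiplications by \<open>y\<close>, \<open>y \<odot> y\<close>,
  \<open>p\<close> and \<open>y \<odot> p\<close>.\<close>

lemma commute_powers:
  assumes T: "\<And>z. T (y \<odot> z) = y \<odot> T z" "\<And>z. T ((y \<odot> y) \<odot> z) = (y \<odot> y) \<odot> T z"
    and lin: "\<And>x z. T (x + z) = T x + T z" "\<And>x z. T (x - z) = T x - T z"
    and p: "\<And>z. T (p \<odot> z) = p \<odot> T z" "\<And>z. T ((y \<odot> p) \<odot> z) = (y \<odot> p) \<odot> T z"
  shows "T ((y \<odot> (y \<odot> p)) \<odot> z) = (y \<odot> (y \<odot> p)) \<odot> T z"
proof -
  have e: "y \<odot> (y \<odot> p) = (p \<odot> y) \<odot> y" by (simp add: commute)
  show ?thesis
    unfolding e jp_jp[of p y y] lin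
    using T p by (simp add: commute[of p y])
qed

end

section \<open>Power associativity and polynomials in one element\<close>

locale unital_jordan = jordan_product +
  fixes e :: 'a
  assumes unit: "e \<odot> x = x"
begin

lemma unit': "x \<odot> e = x" using unit commute by metis

fun pow :: "'a \<Rightarrow> nat \<Rightarrow> 'a" where
  "pow y 0 = e" | "pow y (Suc n) = y \<odot> pow y n"

lemma pow1: "pow y (Suc 0) = y" by (simp add: unit')

lemma pow_commute_op:
  assumes T: "\<And>z. T (y \<odot> z) = y \<odot> T z" "\<And>z. T ((y \<odot> y) \<odot> z) = (y \<odot> y) \<odot> T z"
    and lin: "\<And>x z. T (x + z) = T x + T z" "\<And>x z. T (x - z) = T x - T z"
  shows "T (pow y n \<odot> z) = pow y n \<odot> T z"
proof -
  \<comment> \<open>The recursion \<open>commute_powers\<close> goes back two powers, so two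
    consecutive ones are carried through the induction.\<close>
  have "(\<forall>z. T (pow y n \<odot> z) = pow y n \<odot> T z) \<and> (\<forall>z. T (pow y (Suc n) \<odot> z) = pow y (Suc n) \<odot> T z)"
  proof (induction n)
    case 0 then show ?case using T by (simp add: unit unit')
  next
    case (Suc n)
    then show ?case using commute_powers[OF T lin, of "pow y n"] by simp
  qed
  then show ?thesis by blast
qed

text \<open>The Jordan identity is the commutation of \<open>y\<close> with
  \<open>y \<odot> y\<close>. Applying \<open>pow_commute_op\<close> to these two multiplications
  makes both commute with all powers, and a third application then treats an arbitrary
  power.\<close>

lemma pow_commute: "pow y m \<odot> (pow y n \<odot> z) = pow y n \<odot> (pow y m \<odot> z)"
proof -
  have jord: "y \<odot> ((y \<odot> y) \<odot> z) = (y \<odot> y) \<odot> (y \<odot> z)" for z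
    using jordan[of y z] by (simp add: commute)
  have 1: "y \<odot> (pow y n \<odot> z) = pow y n \<odot> (y \<odot> z)" for n z
    by (rule pow_commute_op[where T="\<lambda>z. y \<odot> z"]) (use jord in \<open>auto simp: bilin\<close>)
  have 2: "(y \<odot> y) \<odot> (pow y n \<odot> z) = pow y n \<odot> ((y \<odot> y) \<odot> z)" for n z
    by (rule pow_commute_op[where T="\<lambda>z. (y \<odot> y) \<odot> z"]) (use jord in \<open>auto simp: bilin\<close>)
  show ?thesis
    by (rule pow_commute_op[where T="\<lambda>z. pow y m \<odot> z"]) (use 1 2 in \<open>auto simp: bilin\<close>)
qed

definition pev :: "'a \<Rightarrow> real poly \<Rightarrow> 'a"
  where "pev y p = (\<Sum>i\<le>degree p. coeff p i *\<^sub>R pow y i)"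

lemma pev_eq: "degree p \<le> n \<Longrightarrow> pev y p = (\<Sum>i\<le>n. coeff p i *\<^sub>R pow y i)"
  unfolding pev_def
  by (rule sum.mono_neutral_left) (auto simp: coeff_eq_0)

lemma pev_add: "pev y (p + q) = pev y p + pev y q"
proof -
  let ?n = "max (degree p) (degree q)"
  show ?thesis
    by (subst (1 2 3) pev_eq[of _ ?n])
       (auto simp: degree_add_le sum.distrib scaleR_add_left)
qed

lemma pev_smult: "pev y (smult c p) = c *\<^sub>R pev y p"
  by (subst (1 2) pev_eq[of _ "degree p"]) (auto simp: scaleR_sum_right degree_smult_le)

lemma pev_0 [simp]: "pev y 0 = 0" by (simp add: pev_def)

lemma pev_const: "pev y [:c:] = c *\<^sub>R e" by (simp add: pev_def)

lemma pev_pCons: "pev y (pCons c p) = c *\<^sub>R e + y \<odot> pev y p"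
proof -
  have "pev y (pCons c p) = (\<Sum>i\<le>Suc (degree p). coeff (pCons c p) i *\<^sub>R pow y i)"
    by (rule pev_eq) (rule degree_pCons_le)
  also have "\<dots> = c *\<^sub>R e + (\<Sum>i\<le>degree p. coeff p i *\<^sub>R pow y (Suc i))"
    by (subst sum.atMost_Suc_shift) simp
  also have "(\<Sum>i\<le>degree p. coeff p i *\<^sub>R pow y (Suc i)) = y \<odot> pev y p"
    by (simp add: pev_def sum_right scaleR_right)
  finally show ?thesis .
qed

lemma pow_pev_commute: "pow y m \<odot> (pev y p \<odot> z) = pev y p \<odot> (pow y m \<odot> z)"
  by (simp add: pev_def sum_left sum_right scaleR_left scaleR_right pow_commute[of y m])

lemma pev_commute: "pev y p \<odot> (pev y q \<odot> z) = pev y q \<odot> (pev y p \<odot> z)"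
  by (simp add: pev_def[of y q] sum_left sum_right scaleR_left scaleR_right pow_pev_commute)

lemma pev_mult: "pev y (p * q) = pev y p \<odot> pev y q"
proof (induction p)
  case (pCons c p)
  have "pev y (pCons c p * q) = c *\<^sub>R pev y q + y \<odot> (pev y p \<odot> pev y q)"
    by (simp add: pev_add pev_smult pev_pCons pCons)
  moreover have "y \<odot> (pev y p \<odot> pev y q) = (y \<odot> pev y p) \<odot> pev y q"
    using pow_pev_commute[of y "Suc 0" p] pow_pev_commute[of y "Suc 0" q]
      pev_commute[of y p q] commute unit' by (metis pow1)
  ultimately show ?case by (simp add: pev_pCons bilin unit)
qed (simp add: bilin)

end

section \<open>The unitization\<close>

context jb_star_algebra
begin

lemma jprod_add_left: "jprod (x + y) z = jprod x z + jprod y z"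
  by (simp add: jprod_commute[of _ z] jprod_add_right)

lemma jprod_scaleC_left: "jprod (scaleC c x) y = scaleC c (jprod x y)"
  by (simp add: jprod_commute[of _ y] jprod_scaleC_right)

lemma jprod_scaleR: "jprod x (r *\<^sub>R y) = r *\<^sub>R jprod x y" "jprod (r *\<^sub>R x) y = r *\<^sub>R jprod x y"
  by (simp_all add: scaleC_of_real[symmetric] jprod_scaleC_right jprod_scaleC_left)

sublocale A: jordan_product jprod
proof
  show "\<exists>K. \<forall>a b. norm (jprod a b) \<le> norm a * norm b * K"
    by (rule exI[of _ 1]) (simp add: norm_jprod_le)
  show "jprod x y = jprod y x" for x y
    by (rule jprod_commute)
qed (simp_all add: jprod_add_right jprod_add_left jprod_scaleR jordan_identity)

lemma jordan_U_eq: "jordan_U jprod x y = A.U x y"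
  by (simp add: jordan_U_def A.U2_def scaleR_2 jprod_commute)

lemma norm_U2_le: "norm (A.U2 x y z) \<le> 3 * (norm x * norm y * norm z)"
proof -
  have 1: "norm (jprod u (jprod v w)) \<le> norm u * norm v * norm w" for u v w
    by (metis ab_semigroup_mult_class.mult_ac(1) mult_left_mono norm_ge_zero norm_jprod_le order_trans)
  have 2: "norm (jprod (jprod u v) w) \<le> norm u * norm v * norm w" for u v w
    by (metis mult_right_mono norm_ge_zero norm_jprod_le order_trans)
  have "norm (A.U2 x y z) \<le> norm (jprod x (jprod y z)) + norm (jprod y (jprod x z)) + norm (jprod (jprod x y) z)"
    unfolding A.U2_def by (rule order_trans[OF norm_triangle_ineq4 add_right_mono[OF norm_triangle_ineq]])
  also have "\<dots> \<le> norm x * norm y * norm z + norm y * norm x * norm z + norm x * norm y * norm z"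
    by (intro add_mono 1 2)
  finally show ?thesis by (simp add: algebra_simps)
qed

lemma norm_U_star: "norm (A.U x (star x)) = norm x ^ 3"
  using norm_jordan_U_star by (simp add: jordan_U_eq)

text \<open>The norm axiom at \<open>star x\<close> bounds the cube of \<open>norm (star x)\<close>
  by \<open>U2\<close> of three factors, two of which are \<open>star x\<close> again and
  cancel.\<close>

lemma norm_star_le: "norm (star x) \<le> 3 * norm x"
proof (cases "star x = 0")
  case False
  have "norm (star x) ^ 3 \<le> 3 * (norm (star x) * norm (star x) * norm x)"
    using norm_U_star[of "star x"] norm_U2_le[of "star x" "star x" x] by (simp add: star_star)
  then have "norm (star x) * (norm (star x))^2 \<le> (3 * norm x) * (norm (star x))^2"
    by (simp add: power2_eq_square power3_eq_cube algebra_simps)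
  then show ?thesis using False by simp
qed simp

lemma star_scaleR: "star (r *\<^sub>R x) = r *\<^sub>R star x"
  using star_scaleC[of "of_real r" x] by (simp add: scaleC_of_real)

sublocale star: bounded_linear star
  by (rule bounded_linear_intro[of _ 3]) (simp_all add: star_add star_scaleR norm_star_le[unfolded mult.commute[of 3]])

text \<open>The adjoined scalars are real, so that \<open>SB\<close>, which restricts only the first
  component, contains every multiple of \<open>un\<close> as a self-adjoint element.\<close>

definition ujp :: "'a \<times> real \<Rightarrow> 'a \<times> real \<Rightarrow> 'a \<times> real" (infixl "\<odot>" 70)
  where "x \<odot> y = (jprod (fst x) (fst y) + snd x *\<^sub>R fst y + snd y *\<^sub>R fst x, snd x * snd y)"

definition un :: "'a \<times> real" where "un = (0, 1)"

lemma fst_un [simp]: "fst un = 0" and snd_un [simp]: "snd un = 1"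
  by (simp_all add: un_def)

lemma snd_ujp [simp]: "snd (x \<odot> y) = snd x * snd y"
  by (simp add: ujp_def)

lemma norm_ujp_le: "norm (x \<odot> y) \<le> norm x * norm y * 4"
proof -
  have f: "norm (fst z) \<le> norm z" "\<bar>snd z\<bar> \<le> norm z" for z :: "'a \<times> real"
    by (metis norm_fst_le prod.collapse) (metis norm_snd_le prod.collapse real_norm_def)
  have "norm (x \<odot> y) \<le> norm (fst (x \<odot> y)) + norm (snd (x \<odot> y))"
    by (metis norm_Pair_le prod.collapse)
  also have "\<dots> \<le> (norm (fst x) * norm (fst y) + \<bar>snd x\<bar> * norm (fst y) + \<bar>snd y\<bar> * norm (fst x)) + \<bar>snd x\<bar> * \<bar>snd y\<bar>"
    unfolding ujp_def fst_conv snd_conv real_norm_def abs_mult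
    by (intro add_right_mono order_trans[OF norm_triangle_ineq] add_mono norm_jprod_le) simp_all
  also have "\<dots> \<le> (norm x * norm y + norm x * norm y + norm y * norm x) + norm x * norm y"
    by (intro add_mono mult_mono f) simp_all
  finally show ?thesis by simp
qed

sublocale B: unital_jordan ujp un
proof
  show "\<exists>K. \<forall>a b. norm (a \<odot> b) \<le> norm a * norm b * K"
    using norm_ujp_le by blast
  show "(x \<odot> y) \<odot> (x \<odot> x) = x \<odot> (y \<odot> (x \<odot> x))" for x y
    using jordan_identity[of "fst x" "fst y"]
    by (simp add: ujp_def prod_eq_iff A.bilin algebra_simps jprod_commute)
qed (simp_all add: ujp_def un_def prod_eq_iff A.bilin algebra_simps jprod_commute)

definition SB :: "('a \<times> real) set" where "SB = {y. star (fst y) = fst y}"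

lemma SB_un [simp]: "un \<in> SB" by (simp add: SB_def star.zero)

lemma SB_add: "x \<in> SB \<Longrightarrow> y \<in> SB \<Longrightarrow> x + y \<in> SB"
  and SB_diff: "x \<in> SB \<Longrightarrow> y \<in> SB \<Longrightarrow> x - y \<in> SB"
  and SB_scale: "x \<in> SB \<Longrightarrow> r *\<^sub>R x \<in> SB"
  by (simp_all add: SB_def star.add star.diff star.scaleR)

lemma SB_mult: "x \<in> SB \<Longrightarrow> y \<in> SB \<Longrightarrow> x \<odot> y \<in> SB"
  by (simp add: SB_def ujp_def star.add star.scaleR star_jprod jprod_commute)

lemma closed_SB: "closed SB"
  unfolding SB_def
  by (intro closed_Collect_eq continuous_intros star.continuous_on)

lemma ujp_embed: "y \<odot> (x, 0) = (jprod (fst y) x + snd y *\<^sub>R x, 0)"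
  by (simp add: ujp_def)

lemma norm_embed [simp]: "norm (x, 0::real) = norm (x::'a)"
  by (simp add: norm_Pair)

lemma U2_A: "B.U2 (x,0) (y,0) (z,0) = (A.U2 x y z, 0)"
  by (simp add: B.U2_def A.U2_def ujp_def)

text \<open>For \<open>w = x + c z\<close> with \<open>c\<close> equal to \<i> or its negative,
  commutation of \<open>x\<close> and \<open>z\<close> gives
  \<open>U w (star w) = q \<odot> w\<close> with \<open>q\<close> the sum of squares. The norm axiom
  then bounds the square of \<open>norm w\<close> by \<open>norm q\<close>, and \<open>x\<close> is
  the mean of the two choices of \<open>w\<close>.\<close>

lemma norm_sa_le_norm_sum_squares:
  assumes "star x = x" "star z = z"
    and c: "jprod z (jprod x z) = jprod x (jprod z z)" "jprod x (jprod x z) = jprod z (jprod x x)"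
  shows "(norm x)\<^sup>2 \<le> norm (jprod x x + jprod z z)"
proof -
  let ?q = "jprod x x + jprod z z"
  have *: "(norm (x + scaleC c z))\<^sup>2 \<le> norm ?q" if "c * c = -1" "cnj c = -c" for c
  proof -
    define w where "w = x + scaleC c z"
    have sw: "star w = x - scaleC c z"
      using assms(1,2) that by (simp add: w_def star_add star_scaleC)
    have ww: "jprod w (star w) = ?q"
      using that unfolding sw unfolding w_def
      by (simp add: A.bilin jprod_scaleC_left jprod_scaleC_right algebra_simps jprod_commute)
    have w2: "jprod w w = jprod x x - jprod z z + 2 *\<^sub>R scaleC c (jprod x z)"
      using that unfolding w_def
      by (simp add: A.bilin jprod_scaleC_left jprod_scaleC_right algebra_simps jprod_commute scaleR_2)
    have "jprod (jprod w w) (star w) = jprod ?q w"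
      unfolding w2 sw unfolding w_def
      using that c
      by (simp add: A.bilin jprod_scaleC_left jprod_scaleC_right algebra_simps jprod_commute scaleR_2 scale_right_distrib scale_right_diff_distrib)
    then have "A.U w (star w) = jprod ?q w"
      unfolding A.U2_def ww by (simp add: jprod_commute)
    then have "norm w ^ 3 \<le> norm ?q * norm w"
      using norm_U_star[of w] norm_jprod_le[of ?q w] by simp
    then have "norm w * (norm w)\<^sup>2 \<le> norm w * norm ?q"
      by (simp add: power2_eq_square power3_eq_cube algebra_simps)
    then show "(norm (x + scaleC c z))\<^sup>2 \<le> norm ?q"
      unfolding w_def[symmetric] by (cases "w = 0") auto
  qed
  have "norm (x + scaleC \<i> z) \<le> sqrt (norm ?q)" "norm (x + scaleC (-\<i>) z) \<le> sqrt (norm ?q)"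
    using *[of "\<i>"] *[of "-\<i>"] by (auto intro!: real_le_rsqrt)
  moreover have "2 *\<^sub>R x = (x + scaleC \<i> z) + (x + scaleC (-\<i>) z)"
    by (simp add: scaleR_2)
  then have "2 * norm x \<le> norm (x + scaleC \<i> z) + norm (x + scaleC (-\<i>) z)"
    by (metis norm_scaleR norm_triangle_ineq abs_numeral)
  ultimately have "norm x \<le> sqrt (norm ?q)" by linarith
  then show ?thesis
    using power_mono[of "norm x" "sqrt (norm ?q)" 2] by simp
qed

end

section \<open>Commutative subalgebras\<close>

text \<open>In \<open>F_comm\<close> the element \<open>z\<close> is arbitrary: members of
  \<open>F\<close> must commute as operators on the whole unitization, since their \<open>U2\<close>
  operators act there and not only on \<open>F\<close>.\<close>

locale commutative_subalgebra = jb_star_algebra scaleC jprod star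
  for scaleC :: "complex \<Rightarrow> 'a::banach \<Rightarrow> 'a" and jprod star +
  fixes F :: "('a \<times> real) set"
  assumes F_SB: "F \<subseteq> SB"
    and F_un [simp]: "un \<in> F"
    and F_closed: "closed F"
    and F_add: "x \<in> F \<Longrightarrow> y \<in> F \<Longrightarrow> x + y \<in> F"
    and F_scale: "x \<in> F \<Longrightarrow> r *\<^sub>R x \<in> F"
    and F_mult: "x \<in> F \<Longrightarrow> y \<in> F \<Longrightarrow> x \<odot> y \<in> F"
    and F_comm: "x \<in> F \<Longrightarrow> y \<in> F \<Longrightarrow> x \<odot> (y \<odot> z) = y \<odot> (x \<odot> z)"
begin

lemma F_zero [simp]: "0 \<in> F"
  using F_scale[OF F_un, of 0] by simp

lemma F_diff: "x \<in> F \<Longrightarrow> y \<in> F \<Longrightarrow> x - y \<in> F"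
  using F_add[OF _ F_scale, of x y "-1"] by simp

lemma F_assoc:
  assumes "x \<in> F" "y \<in> F" "z \<in> F"
  shows "(x \<odot> y) \<odot> z = x \<odot> (y \<odot> z)"
  by (metis B.commute F_comm assms)

lemma F_mult_square:
  assumes "a \<in> F" "b \<in> F"
  shows "(a \<odot> b) \<odot> (a \<odot> b) = (a \<odot> a) \<odot> (b \<odot> b)"
proof -
  have "(a \<odot> b) \<odot> (a \<odot> b) = a \<odot> (b \<odot> (a \<odot> b))"
    using assms by (intro F_assoc F_mult)
  also have "b \<odot> (a \<odot> b) = a \<odot> (b \<odot> b)"
    using assms by (intro F_comm)
  also have "a \<odot> (a \<odot> (b \<odot> b)) = (a \<odot> a) \<odot> (b \<odot> b)"
    using assms by (intro F_assoc[symmetric] F_mult)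
  finally show ?thesis .
qed

lemma F_fst: "x \<in> F \<Longrightarrow> (fst x, 0) \<in> F"
proof -
  assume "x \<in> F"
  then have "x - snd x *\<^sub>R un \<in> F" by (intro F_diff F_scale F_un)
  moreover have "x - snd x *\<^sub>R un = (fst x, 0)" by (simp add: prod_eq_iff)
  ultimately show ?thesis by simp
qed

lemma norm_le_norm_sum_squares:
  assumes "x \<in> F" "z \<in> F" "snd x = 0" "snd z = 0"
  shows "(norm x)\<^sup>2 \<le> norm (x \<odot> x + z \<odot> z)"
proof -
  obtain a b where x: "x = (a, 0)" and z: "z = (b, 0)"
    using assms(3,4) by (metis prod.collapse)
  have e: "(u, 0) \<odot> (v, 0) = (jprod u v, 0)" for u v
    by (simp add: ujp_def)
  have "star a = a" "star b = b" using assms(1,2) F_SB by (auto simp: x z SB_def)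
  moreover have "z \<odot> (x \<odot> z) = x \<odot> (z \<odot> z)" "x \<odot> (x \<odot> z) = z \<odot> (x \<odot> x)"
    using F_comm[OF assms(2,1), of z] F_comm[OF assms(1,2), of x] by (simp_all add: B.commute[of z x])
  then have "jprod b (jprod a b) = jprod a (jprod b b)" "jprod a (jprod a b) = jprod b (jprod a a)"
    by (simp_all add: x z e)
  ultimately show ?thesis
    using norm_sa_le_norm_sum_squares[of a b] by (simp add: x z e)
qed

lemma norm_square:
  assumes "x \<in> F" "snd x = 0"
  shows "norm (x \<odot> x) = (norm x)\<^sup>2"
proof (rule antisym)
  show "(norm x)\<^sup>2 \<le> norm (x \<odot> x)"
    using norm_le_norm_sum_squares[of x 0] assms by (simp add: B.bilin)
  obtain a where x: "x = (a, 0)" using assms(2) by (metis prod.collapse)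
  show "norm (x \<odot> x) \<le> (norm x)\<^sup>2"
    using norm_jprod_le[of a a] by (simp add: x ujp_def power2_eq_square)
qed

text \<open>The operator norm of \<open>v\<close> on the non-unital part of \<open>F\<close>, joined with the scalar part.\<close>

definition op_bd :: "real \<Rightarrow> 'a \<times> real \<Rightarrow> bool"
  where "op_bd K v \<longleftrightarrow> \<bar>snd v\<bar> \<le> K \<and> (\<forall>c\<in>F. snd c = 0 \<longrightarrow> norm (v \<odot> c) \<le> K * norm c)"

lemma op_bd_nonneg: "op_bd K v \<Longrightarrow> 0 \<le> K"
  unfolding op_bd_def by linarith

lemma op_bd_add: "op_bd K v \<Longrightarrow> op_bd L w \<Longrightarrow> op_bd (K + L) (v + w)"
  unfolding op_bd_def B.add_left ring_distribs
  by (auto intro!: order_trans[OF norm_triangle_ineq add_mono] order_trans[OF abs_triangle_ineq add_mono])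

lemma op_bd_scale: "op_bd K v \<Longrightarrow> op_bd (\<bar>r\<bar> * K) (r *\<^sub>R v)"
  unfolding op_bd_def B.scaleR_left by (auto simp: abs_mult mult.assoc intro!: mult_left_mono)

lemma op_bd_mult:
  assumes "v \<in> F" "w \<in> F" "op_bd K v" "op_bd L w"
  shows "op_bd (K * L) (v \<odot> w)"
proof -
  have "norm ((v \<odot> w) \<odot> c) \<le> K * L * norm c" if "c \<in> F" "snd c = 0" for c
  proof -
    have "norm (v \<odot> (w \<odot> c)) \<le> K * norm (w \<odot> c)"
      using assms that F_mult by (simp add: op_bd_def)
    also have "\<dots> \<le> K * (L * norm c)"
      using assms that op_bd_nonneg by (intro mult_left_mono) (auto simp: op_bd_def)
    finally show ?thesis using F_assoc assms that by simp
  qed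
  moreover have "\<bar>snd v * snd w\<bar> \<le> K * L"
    using assms op_bd_nonneg unfolding abs_mult by (intro mult_mono) (auto simp: op_bd_def)
  ultimately show ?thesis by (simp add: op_bd_def)
qed

lemma op_bd_mono: "op_bd K v \<Longrightarrow> K \<le> L \<Longrightarrow> op_bd L v"
  unfolding op_bd_def by (meson mult_right_mono norm_ge_zero order_trans)

lemma norm_ujp_ideal: "snd c = 0 \<Longrightarrow> norm (v \<odot> c) \<le> (norm (fst v) + \<bar>snd v\<bar>) * norm c"
proof -
  assume "snd c = 0"
  then obtain a where c: "c = (a, 0)" by (metis prod.collapse)
  have "norm (jprod (fst v) a + snd v *\<^sub>R a) \<le> norm (fst v) * norm a + \<bar>snd v\<bar> * norm a"
    by (rule order_trans[OF norm_triangle_ineq add_mono[OF norm_jprod_le]]) simp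
  then show ?thesis by (simp add: c ujp_embed algebra_simps)
qed

lemma op_bd_norm: "op_bd (norm (fst v) + \<bar>snd v\<bar>) v"
  by (simp add: op_bd_def norm_ujp_ideal)

text \<open>Letting \<open>v\<close> act on its own first component turns the operator bound into a
  bound on a square, where \<open>norm_square\<close> applies. The factor 2 pays for removing the
  scalar part.\<close>

lemma norm_fst_le_op_bd:
  assumes "v \<in> F" "op_bd K v"
  shows "norm (fst v) \<le> 2 * K"
proof -
  let ?a = "(fst v, 0::real)"
  have a: "?a \<in> F" using F_fst assms by blast
  have "v = ?a + snd v *\<^sub>R un" by (simp add: un_def prod_eq_iff)
  then have "v \<odot> ?a = ?a \<odot> ?a + snd v *\<^sub>R ?a"
    by (metis B.add_left B.scaleR_left B.unit)
  then have "norm (?a \<odot> ?a) \<le> norm (v \<odot> ?a) + \<bar>snd v\<bar> * norm ?a"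
    by (metis add_diff_cancel norm_scaleR norm_triangle_ineq4)
  also have "\<dots> \<le> K * norm ?a + K * norm ?a"
    using a assms by (intro add_mono mult_right_mono) (auto simp: op_bd_def)
  finally have "norm (fst v) * norm (fst v) \<le> (2 * K) * norm (fst v)"
    using norm_square[OF a] by (simp add: power2_eq_square)
  then show ?thesis
    using op_bd_nonneg[OF assms(2)] by (cases "fst v = 0") auto
qed

lemma norm_le_op_bd:
  assumes "v \<in> F" "op_bd K v"
  shows "norm v \<le> 3 * K"
proof -
  have "norm v \<le> norm (fst v) + \<bar>snd v\<bar>"
    by (metis norm_Pair_le prod.collapse real_norm_def)
  then show ?thesis using norm_fst_le_op_bd[OF assms] assms(2) by (simp add: op_bd_def)
qed

definition is_square :: "'a \<times> real \<Rightarrow> bool"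
  where "is_square v \<longleftrightarrow> (\<exists>w\<in>F. v = w \<odot> w)"

lemma is_square_mult:
  assumes "is_square v" "is_square w"
  shows "is_square (v \<odot> w)"
proof -
  obtain a b where "a \<in> F" "b \<in> F" "v = a \<odot> a" "w = b \<odot> b"
    using assms unfolding is_square_def by blast
  then have "v \<odot> w = (a \<odot> b) \<odot> (a \<odot> b)"
    by (simp add: F_mult_square)
  then show ?thesis using \<open>a \<in> F\<close> \<open>b \<in> F\<close> F_mult is_square_def by blast
qed

lemma is_square_scale:
  assumes "is_square v" "0 \<le> r"
  shows "is_square (r *\<^sub>R v)"
proof -
  obtain a where "a \<in> F" "v = a \<odot> a" using assms unfolding is_square_def by blast
  then have "r *\<^sub>R v = (sqrt r *\<^sub>R a) \<odot> (sqrt r *\<^sub>R a)"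
    using assms(2) by (simp add: B.bilin)
  then show ?thesis using \<open>a \<in> F\<close> F_scale is_square_def by blast
qed

lemma is_square_un: "is_square un"
  unfolding is_square_def using F_un B.unit by metis

text \<open>The square root \<open>un - z\<close> of \<open>un - x\<close> is the limit of the iteration
  \<open>z \<mapsto> (x + z \<odot> z) / 2\<close>.\<close>

lemma is_square_un_diff:
  assumes x: "x \<in> F" "op_bd \<rho> x" and \<rho>: "\<rho> < 1"
  shows "is_square (un - x)"
proof -
  define z where "z = rec_nat 0 (\<lambda>_ v. (1/2) *\<^sub>R (x + v \<odot> v))"
  have z0: "z 0 = 0" and zS: "z (Suc n) = (1/2) *\<^sub>R (x + z n \<odot> z n)" for n
    by (simp_all add: z_def)
  have \<rho>0: "0 \<le> \<rho>" using op_bd_nonneg x by blast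
  have zF: "z n \<in> F" for n
    by (induction n) (simp_all add: z0 zS F_add F_scale F_mult x)
  have zb: "op_bd \<rho> (z n)" for n
  proof (induction n)
    case 0 then show ?case by (simp add: z0 op_bd_def B.bilin \<rho>0)
  next
    case (Suc n)
    have "op_bd (\<bar>1/2\<bar> * (\<rho> + \<rho> * \<rho>)) (z (Suc n))"
      unfolding zS by (intro op_bd_scale op_bd_add op_bd_mult x zF Suc)
    moreover have "\<rho> * \<rho> \<le> \<rho>" using \<rho> \<rho>0 by (simp add: mult_left_le)
    ultimately show ?case by (elim op_bd_mono) simp
  qed
  \<comment> \<open>The difference of two squares factors, and the sum of two iterates has bound
    \<open>2 * \<rho>\<close>; each difference therefore shrinks by the factor
    \<open>\<rho>\<close>.\<close>
  have db: "op_bd (\<rho> * \<rho> ^ n) (z (Suc n) - z n)" for n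
  proof (induction n)
    case 0
    have "op_bd (\<bar>1/2\<bar> * \<rho>) ((1/2) *\<^sub>R x)" by (intro op_bd_scale x)
    then have "op_bd \<rho> ((1/2) *\<^sub>R x)" by (rule op_bd_mono) (use \<rho>0 in simp)
    then show ?case by (simp add: z0 zS B.bilin)
  next
    case (Suc n)
    have "z (Suc (Suc n)) - z (Suc n) = (1/2) *\<^sub>R ((z (Suc n) - z n) \<odot> (z (Suc n) + z n))"
    proof -
      have "(z (Suc n) - z n) \<odot> (z (Suc n) + z n) = z (Suc n) \<odot> z (Suc n) - z n \<odot> z n"
        by (simp add: B.bilin B.commute[of "z n" "z (Suc n)"])
      moreover have "z (Suc (Suc n)) - z (Suc n) = (1/2) *\<^sub>R (z (Suc n) \<odot> z (Suc n) - z n \<odot> z n)"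
        unfolding zS[of "Suc n"] by (subst (3) zS) (simp add: scaleR_add_right scaleR_diff_right)
      ultimately show ?thesis by simp
    qed
    moreover have "op_bd (\<bar>1/2\<bar> * ((\<rho> * \<rho> ^ n) * (\<rho> + \<rho>))) ((1/2) *\<^sub>R ((z (Suc n) - z n) \<odot> (z (Suc n) + z n)))"
      by (intro op_bd_scale op_bd_mult op_bd_add F_add F_diff zF zb Suc)
    ultimately show ?case by (simp add: mult_ac)
  qed
  have "summable (\<lambda>n. z (Suc n) - z n)"
  proof (rule summable_comparison_test')
    show "summable (\<lambda>n. 3 * \<rho> * \<rho> ^ n)" using \<rho> \<rho>0 by (intro summable_mult summable_geometric) simp
    show "norm (z (Suc n) - z n) \<le> 3 * \<rho> * \<rho> ^ n" for n
      using norm_le_op_bd[OF F_diff[OF zF zF] db] by (simp add: mult.assoc)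
  qed
  from summable_LIMSEQ[OF this] obtain L where L: "z \<longlonglongrightarrow> L"
    by (auto simp: sum_lessThan_telescope z0)
  have "L \<in> F" using closed_sequentially[OF F_closed] zF L by blast
  have "(\<lambda>n. z (Suc n)) \<longlonglongrightarrow> (1/2) *\<^sub>R (x + L \<odot> L)"
    unfolding zS by (intro tendsto_intros B.tendsto L)
  then have "L = (1/2) *\<^sub>R (x + L \<odot> L)"
    using L LIMSEQ_Suc LIMSEQ_unique by blast
  then have "2 *\<^sub>R L = 2 *\<^sub>R ((1/2) *\<^sub>R (x + L \<odot> L))" by (rule arg_cong)
  then have "L + L = x + L \<odot> L"
    by (simp add: scaleR_2)
  then have "un - x = (un - L) \<odot> (un - L)"
    by (simp add: B.bilin B.unit B.unit' algebra_simps)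
  then show ?thesis using \<open>L \<in> F\<close> F_diff F_un is_square_def by blast
qed

text \<open>For small \<open>s\<close> the element \<open>v = un - s x\<^sup>2\<close> is a square
  by the iteration. As \<open>v\<close> and \<open>s x\<^sup>2\<close> are squares with sum
  \<open>un\<close>, the sum-of-squares estimate shows that \<open>v\<close> acts contractively.
  Then \<open>v / (1 + s)\<close> has bound below 1, and \<open>un + x\<^sup>2\<close> is a positive
  multiple of \<open>un - v / (1 + s)\<close>.\<close>

lemma is_square_un_add_square:
  assumes x: "x \<in> F"
  shows "is_square (un + x \<odot> x)"
proof -
  define s where "s = 1 / (2 * (norm (fst (x \<odot> x)) + \<bar>snd (x \<odot> x)\<bar> + 1))"
  have s: "0 < s" by (simp add: s_def add_nonneg_pos)
  define v where "v = un - s *\<^sub>R (x \<odot> x)"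
  have "op_bd (\<bar>s\<bar> * (norm (fst (x \<odot> x)) + \<bar>snd (x \<odot> x)\<bar>)) (s *\<^sub>R (x \<odot> x))"
    by (intro op_bd_scale op_bd_norm)
  moreover have "\<bar>s\<bar> * (norm (fst (x \<odot> x)) + \<bar>snd (x \<odot> x)\<bar>) \<le> 1/2"
    using s by (simp add: s_def field_simps)
  ultimately have "op_bd (1/2) (s *\<^sub>R (x \<odot> x))" by (rule op_bd_mono)
  then have sq: "is_square v"
    unfolding v_def using x by (intro is_square_un_diff[of _ "1/2"] F_scale F_mult) simp_all
  then obtain b where b: "b \<in> F" "v = b \<odot> b" unfolding is_square_def by blast
  have bc: "norm (b \<odot> c) \<le> norm c" if c: "c \<in> F" "snd c = 0" for c
  proof -
    define d where "d = sqrt s *\<^sub>R (x \<odot> c)"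
    have "(b \<odot> c) \<odot> (b \<odot> c) = v \<odot> (c \<odot> c)"
      using b c by (simp add: F_mult_square)
    moreover have "(x \<odot> c) \<odot> (x \<odot> c) = (x \<odot> x) \<odot> (c \<odot> c)"
      by (rule F_mult_square[OF x c(1)])
    then have "d \<odot> d = (s *\<^sub>R (x \<odot> x)) \<odot> (c \<odot> c)"
      using s by (simp add: d_def B.bilin)
    ultimately have "(b \<odot> c) \<odot> (b \<odot> c) + d \<odot> d = c \<odot> c"
      by (simp add: v_def B.bilin B.unit)
    moreover have "(norm (b \<odot> c))\<^sup>2 \<le> norm ((b \<odot> c) \<odot> (b \<odot> c) + d \<odot> d)"
      using b c x by (intro norm_le_norm_sum_squares) (auto simp: d_def F_mult F_scale)
    ultimately have "(norm (b \<odot> c))\<^sup>2 \<le> (norm c)\<^sup>2" using norm_square c by simp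
    then show ?thesis by (simp add: abs_le_square_iff[symmetric])
  qed
  have "norm (v \<odot> c) \<le> norm c" if c: "c \<in> F" "snd c = 0" for c
    using bc[OF F_mult[OF b(1) c(1)]] bc[OF c] c b F_assoc by simp
  moreover have "\<bar>snd v\<bar> \<le> 1"
  proof -
    have "0 \<le> snd v" by (simp add: b)
    moreover have "snd v \<le> 1" using s by (simp add: v_def)
    ultimately show ?thesis by simp
  qed
  ultimately have v1: "op_bd 1 v" by (simp add: op_bd_def)
  have "op_bd (\<bar>1/(1+s)\<bar> * 1) ((1/(1+s)) *\<^sub>R v)" by (intro op_bd_scale v1)
  then have "is_square (un - (1/(1+s)) *\<^sub>R v)"
    using b s by (intro is_square_un_diff) (auto simp: F_scale F_mult)
  then have "is_square (((1+s)/s) *\<^sub>R (un - (1/(1+s)) *\<^sub>R v))"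
    using s by (intro is_square_scale) auto
  also have "((1+s)/s) *\<^sub>R (un - (1/(1+s)) *\<^sub>R v) = un + x \<odot> x"
  proof -
    have e: "(1+s)/s - 1/s = 1" using s by (simp add: field_simps)
    have "((1+s)/s) *\<^sub>R (un - (1/(1+s)) *\<^sub>R v) = ((1+s)/s) *\<^sub>R un - (1/s) *\<^sub>R v"
      using s by (simp add: scaleR_diff_right)
    also have "\<dots> = ((1+s)/s - 1/s) *\<^sub>R un + x \<odot> x"
      using s by (simp add: v_def scaleR_diff_right scaleR_diff_left)
    finally show ?thesis unfolding e by simp
  qed
  finally show ?thesis .
qed

lemma pev_in_F: "y \<in> F \<Longrightarrow> B.pev y p \<in> F"
  by (induction p) (simp_all add: B.pev_pCons F_add F_scale F_mult)

lemma snd_pev: "snd (B.pev y p) = poly p (snd y)"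
  by (induction p) (simp_all add: B.pev_pCons)

end

section \<open>Continuous functional calculus\<close>

lemma complex_poly_eval_hom:
  fixes z :: complex
  defines "ev \<equiv> \<lambda>p. poly (map_poly complex_of_real p) z"
  shows "ev (p + q) = ev p + ev q" "ev (p * q) = ev p * ev q"
proof -
  have pC: "ev (pCons c p) = of_real c + z * ev p" for c p
    by (simp add: ev_def map_poly_pCons)
  have ev0: "ev 0 = 0" by (simp add: ev_def)
  show add: "ev (p + q) = ev p + ev q" for p q
    by (induction p q rule: poly_induct2) (simp_all add: pC ev0 algebra_simps)
  have sm: "ev (smult c p) = of_real c * ev p" for c p
    by (induction p) (simp_all add: pC ev0 algebra_simps)
  show "ev (p * q) = ev p * ev q"
    by (induction p) (simp_all add: pC ev0 add sm algebra_simps)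
qed

lemma poly_map_poly_of_real: "poly (map_poly of_real p) (of_real x :: complex) = of_real (poly p x)"
  by (induction p) (simp_all add: map_poly_pCons)

text \<open>The remainder on division is a real polynomial of degree at most 1 with a non-real root,
  hence zero.\<close>

lemma real_quadratic_factor:
  fixes q :: "real poly" and z :: complex
  assumes z: "poly (map_poly of_real q) z = 0" and im: "Im z \<noteq> 0"
  shows "[:(Re z)\<^sup>2 + (Im z)\<^sup>2, - 2 * Re z, 1:] dvd q"
proof -
  let ?s = "[:(Re z)\<^sup>2 + (Im z)\<^sup>2, - 2 * Re z, 1:]"
  let ?ev = "\<lambda>p. poly (map_poly complex_of_real p) z"
  have s0: "?ev ?s = 0"
    by (simp add: map_poly_pCons complex_eq_iff power2_eq_square algebra_simps)
  have "?ev q = ?ev (?s * (q div ?s) + q mod ?s)" by (simp only: mult_div_mod_eq)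
  also have "\<dots> = ?ev (q mod ?s)" by (simp only: complex_poly_eval_hom s0) simp
  finally have m0: "?ev (q mod ?s) = 0" using z by simp
  have "degree (q mod ?s) < 2 \<or> q mod ?s = 0"
    using degree_mod_less[of ?s q] by auto
  then have d: "degree (q mod ?s) \<le> 1" by auto
  obtain a r where ar: "q mod ?s = pCons a r" by (rule pCons_cases)
  have "degree r = 0" using d unfolding ar by (simp split: if_splits)
  then obtain b where "r = [:b:]" by (metis degree_0_id)
  with ar have ab: "q mod ?s = [:a, b:]" by simp
  have "b * Im z = 0" "a + b * Re z = 0"
    using m0 unfolding ab by (simp_all add: map_poly_pCons complex_eq_iff mult.commute)
  then have "q mod ?s = 0" using im ab by simp
  then show ?thesis by (simp add: mod_eq_0_iff_dvd)
qed

section \<open>Norms of polynomials, with an interval in place of the spectrum\<close>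

context commutative_subalgebra
begin

text \<open>A complex root yields a real factor of degree 1 or 2 that is positive on the interval. A
  linear factor has its root outside \<open>[-R, R]\<close> and falls under
  \<open>is_square_un_diff\<close>; a quadratic one is a multiple of \<open>un\<close> plus a
  square. Products of squares in \<open>F\<close> are squares.\<close>

lemma is_square_positive_poly:
  assumes y: "y \<in> F" and R: "norm (fst y) + \<bar>snd y\<bar> < R"
  shows "(\<And>t. \<bar>t\<bar> \<le> R \<Longrightarrow> 0 < poly q t) \<Longrightarrow> is_square (B.pev y q)"
proof (induction "degree q" arbitrary: q rule: less_induct)
  case less
  have R0: "0 < R" using R by (smt (verit) norm_ge_zero)
  show ?case
  proof (cases "degree q = 0")
    case True
    then obtain c where q: "q = [:c:]" by (metis degree_0_id)
    then have "0 < c" using less.prems[of 0] R0 by simp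
    then show ?thesis unfolding q B.pev_const by (intro is_square_scale is_square_un) simp
  next
    case False
    let ?Q = "map_poly complex_of_real q"
    have "degree ?Q = degree q" by (simp add: degree_map_poly)
    then have "\<not> constant (poly ?Q)" using False by (simp add: constant_degree)
    then obtain z where z: "poly ?Q z = 0" using fundamental_theorem_of_algebra by blast
    have q0: "q \<noteq> 0" using False by auto
    have step: "is_square (B.pev y q)"
      if q: "q = l * r" and dl: "0 < degree l" and l: "\<And>t. \<bar>t\<bar> \<le> R \<Longrightarrow> 0 < poly l t"
        and sl: "is_square (B.pev y l)" for l r
    proof -
      have lr: "l \<noteq> 0" "r \<noteq> 0" using q q0 by auto
      then have "degree r < degree q" using q dl degree_mult_eq by (metis less_add_same_cancel2)
      moreover have "0 < poly r t" if "\<bar>t\<bar> \<le> R" for t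
        using l[OF that] less.prems[OF that] by (simp add: q zero_less_mult_iff)
      ultimately have "is_square (B.pev y r)" by (rule less.hyps)
      then show ?thesis
        unfolding q B.pev_mult by (intro is_square_mult sl)
    qed
    show ?thesis
    proof (cases "Im z = 0")
      case True
      define x where "x = Re z"
      have zx: "z = of_real x" using True by (simp add: x_def complex_eq_iff)
      have x0: "poly q x = 0"
        using z unfolding zx poly_map_poly_of_real by simp
      then have xR: "R < \<bar>x\<bar>" using less.prems[of x] by force
      then have xn: "x \<noteq> 0" using R0 by auto
      obtain r where r: "q = [:-x, 1:] * r" using x0 poly_eq_0_iff_dvd by blast
      \<comment> \<open>Normalizing the factor to the value 1 at 0 makes it positive on the interval
        for either sign of \<open>x\<close>.\<close>
      have e: "[:-x, 1:] = smult (-x) [:1, -1/x:]" using xn by simp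
      have "q = [:1, -1/x:] * smult (-x) r"
        unfolding r e by (metis mult_smult_left mult_smult_right)
      then show ?thesis
      proof (rule step)
        show "0 < degree [:1, -1/x:]" using xn by simp
        show "0 < poly [:1, -1/x:] t" if "\<bar>t\<bar> \<le> R" for t
        proof -
          have "\<bar>t / x\<bar> < 1" using that xR xn by (simp add: abs_divide divide_less_eq)
          then have "t / x < 1" by linarith
          then show ?thesis by simp
        qed
        have "op_bd (\<bar>1/x\<bar> * (norm (fst y) + \<bar>snd y\<bar>)) ((1/x) *\<^sub>R y)"
          by (intro op_bd_scale op_bd_norm)
        moreover have "\<bar>1/x\<bar> * (norm (fst y) + \<bar>snd y\<bar>) < 1"
          using R xR xn by (simp add: abs_divide divide_less_eq)
        ultimately have "is_square (un - (1/x) *\<^sub>R y)"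
          by (intro is_square_un_diff) (use y F_scale in auto)
        then show "is_square (B.pev y [:1, -1/x:])"
          by (simp add: B.pev_pCons B.bilin B.unit')
      qed
    next
      case False
      let ?l = "[:(Re z)\<^sup>2 + (Im z)\<^sup>2, - 2 * Re z, 1:]"
      obtain r where "q = ?l * r" using real_quadratic_factor[OF z False] by blast
      then show ?thesis
      proof (rule step)
        show "0 < degree ?l" by simp
        show "0 < poly ?l t" for t
        proof -
          have e: "poly ?l t = (t - Re z)\<^sup>2 + (Im z)\<^sup>2"
            by (simp add: power2_eq_square algebra_simps)
          show ?thesis unfolding e using False by (simp add: add_nonneg_pos)
        qed
        define x where "x = (1 / Im z) *\<^sub>R (y - Re z *\<^sub>R un)"
        have xF: "x \<in> F" unfolding x_def using y by (intro F_scale F_diff) auto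
        have "is_square ((Im z)\<^sup>2 *\<^sub>R (un + x \<odot> x))"
          by (intro is_square_scale is_square_un_add_square xF) simp
        moreover have "(Im z)\<^sup>2 *\<^sub>R (x \<odot> x) = (Im z *\<^sub>R x) \<odot> (Im z *\<^sub>R x)"
          by (simp add: B.bilin power2_eq_square)
        moreover have "Im z *\<^sub>R x = y - Re z *\<^sub>R un" using False by (simp add: x_def)
        ultimately have "is_square ((Im z)\<^sup>2 *\<^sub>R un + (y - Re z *\<^sub>R un) \<odot> (y - Re z *\<^sub>R un))"
          by (simp add: scaleR_add_right)
        also have "(Im z)\<^sup>2 *\<^sub>R un + (y - Re z *\<^sub>R un) \<odot> (y - Re z *\<^sub>R un) = B.pev y ?l"
        proof -
          have d: "(Re z * 2) *\<^sub>R y = Re z *\<^sub>R y + Re z *\<^sub>R y"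
            by (metis mult_2_right scaleR_add_left)
          show ?thesis
            by (simp add: B.pev_pCons B.bilin B.unit B.unit' power2_eq_square algebra_simps d)
        qed
        finally show "is_square (B.pev y ?l)" .
      qed
    qed
  qed
qed

text \<open>If \<open>p\<close> stays strictly below 1 in absolute value, then
  \<open>1 - p\<^sup>2\<close> is positive on the interval and so evaluates to a square. Two squares
  adding up to \<open>un\<close> are contractive by the sum-of-squares estimate.\<close>

lemma op_bd_pev:
  assumes y: "y \<in> F" and R: "norm (fst y) + \<bar>snd y\<bar> < R"
    and p: "\<And>t. \<bar>t\<bar> \<le> R \<Longrightarrow> \<bar>poly p t\<bar> \<le> M"
  shows "op_bd M (B.pev y p)"
proof -
  have R0: "0 < R" using R by (smt (verit) norm_ge_zero)
  have less1: "norm (B.pev y p \<odot> c) \<le> norm c"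
    if p: "\<And>t. \<bar>t\<bar> \<le> R \<Longrightarrow> \<bar>poly p t\<bar> < 1" and c: "c \<in> F" "snd c = 0" for p c
  proof -
    have "is_square (B.pev y ([:1:] - p * p))"
    proof (rule is_square_positive_poly[OF y R])
      fix t assume "\<bar>t\<bar> \<le> R"
      then have "(poly p t)\<^sup>2 < 1" using p by (simp add: abs_square_less_1)
      then show "0 < poly ([:1:] - p * p) t" by (simp add: power2_eq_square)
    qed
    then obtain b where b: "b \<in> F" "B.pev y ([:1:] - p * p) = b \<odot> b"
      unfolding is_square_def by blast
    let ?x = "B.pev y p"
    have x: "?x \<in> F" using y by (rule pev_in_F)
    have "[:1:] - p * p + p * p = [:1:]" by simp
    then have "b \<odot> b + ?x \<odot> ?x = un"
      by (metis B.pev_add B.pev_const B.pev_mult b(2) scaleR_one)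
    then have "(?x \<odot> ?x) \<odot> (c \<odot> c) + (b \<odot> b) \<odot> (c \<odot> c) = c \<odot> c"
      by (metis B.add_left B.unit add.commute)
    then have "(?x \<odot> c) \<odot> (?x \<odot> c) + (b \<odot> c) \<odot> (b \<odot> c) = c \<odot> c"
      using F_mult_square[OF x c(1)] F_mult_square[OF b(1) c(1)] by simp
    moreover have "(norm (?x \<odot> c))\<^sup>2 \<le> norm ((?x \<odot> c) \<odot> (?x \<odot> c) + (b \<odot> c) \<odot> (b \<odot> c))"
      by (intro norm_le_norm_sum_squares F_mult b x c) (simp_all add: c)
    ultimately have "(norm (?x \<odot> c))\<^sup>2 \<le> (norm c)\<^sup>2" using norm_square c by simp
    then show ?thesis by (simp add: abs_le_square_iff[symmetric])
  qed
  have "norm (B.pev y p \<odot> c) \<le> M * norm c" if c: "c \<in> F" "snd c = 0" for c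
  proof (cases "c = 0")
    case False
    \<comment> \<open>The slack \<open>d\<close> supplies the strict inequality that
      \<open>less1\<close> demands.\<close>
    have "norm (B.pev y p \<odot> c) \<le> (M + d) * norm c" if d: "0 < d" for d
    proof -
      have Md: "0 < M + d" using p[of 0] R0 d by simp
      have "\<bar>poly (smult (1/(M+d)) p) t\<bar> < 1" if "\<bar>t\<bar> \<le> R" for t
        using p[OF that] d Md by (simp add: abs_mult divide_less_eq)
      from less1[OF this c] have "norm ((1/(M+d)) *\<^sub>R (B.pev y p \<odot> c)) \<le> norm c"
        by (simp only: B.pev_smult B.scaleR_left)
      then show ?thesis using Md by (simp add: divide_le_eq mult.commute)
    qed
    from this[of "e / norm c" for e] have "norm (B.pev y p \<odot> c) \<le> M * norm c + e" if "0 < e" for e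
      using that False by (simp add: distrib_right)
    then show ?thesis by (rule field_le_epsilon)
  qed (simp add: B.bilin)
  moreover have "\<bar>snd (B.pev y p)\<bar> \<le> M"
    unfolding snd_pev by (rule p) (use R norm_ge_zero[of "fst y"] in linarith)
  ultimately show ?thesis by (simp add: op_bd_def)
qed

lemma norm_pev_le:
  assumes "y \<in> F" "norm (fst y) + \<bar>snd y\<bar> < R" "\<And>t. \<bar>t\<bar> \<le> R \<Longrightarrow> \<bar>poly p t\<bar> \<le> M"
  shows "norm (B.pev y p) \<le> 3 * M"
  using assms by (intro norm_le_op_bd pev_in_F op_bd_pev)

end

section \<open>Extension from polynomials to continuous functions\<close>

context jb_star_algebra
begin

lemma SB_zero: "0 \<in> SB"
  by (simp add: SB_def star.zero)

definition gen :: "'a \<times> real \<Rightarrow> ('a \<times> real) set"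
  where "gen y = closure (range (B.pev y))"

lemma commutative_subalgebra_gen:
  assumes y: "y \<in> SB"
  shows "commutative_subalgebra scaleC jprod star (gen y)"
proof
  have "B.pev y p \<in> SB" for p
    by (induction p) (simp_all add: B.pev_pCons SB_add SB_scale SB_mult y SB_zero)
  then show "gen y \<subseteq> SB"
    unfolding gen_def by (intro closure_minimal closed_SB) auto
  show "un \<in> gen y"
    unfolding gen_def using B.pev_const[of y 1] closure_subset by (metis rangeI scaleR_one subsetD)
  show "closed (gen y)" by (simp add: gen_def)
  have seq: "\<exists>P. (\<lambda>n. B.pev y (P n)) \<longlonglongrightarrow> v" if "v \<in> gen y" for v
  proof -
    obtain f where f: "\<And>n. f n \<in> range (B.pev y)" "f \<longlonglongrightarrow> v"
      using \<open>v \<in> gen y\<close> unfolding gen_def closure_sequential by blast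
    then have "\<forall>n. \<exists>p. f n = B.pev y p" by blast
    then obtain P where "\<And>n. f n = B.pev y (P n)" by metis
    then have "f = (\<lambda>n. B.pev y (P n))" by blast
    with f(2) show ?thesis by metis
  qed
  have lim: "v \<in> gen y" if "(\<lambda>n. B.pev y (P n)) \<longlonglongrightarrow> v" for P v
    using that unfolding gen_def closure_sequential
    by (intro exI[of _ "\<lambda>n. B.pev y (P n)"]) auto
  fix v w assume "v \<in> gen y" "w \<in> gen y"
  then obtain P Q where P: "(\<lambda>n. B.pev y (P n)) \<longlonglongrightarrow> v" and Q: "(\<lambda>n. B.pev y (Q n)) \<longlonglongrightarrow> w"
    using seq by metis
  show "v + w \<in> gen y"
    using lim[of "\<lambda>n. P n + Q n"] tendsto_add[OF P Q] by (simp add: B.pev_add)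
  show "v \<odot> w \<in> gen y"
    using lim[of "\<lambda>n. P n * Q n"] B.tendsto[OF P Q] by (simp add: B.pev_mult)
  show "r *\<^sub>R v \<in> gen y" for r
    using lim[of "\<lambda>n. smult r (P n)"] tendsto_scaleR[OF tendsto_const P] by (simp add: B.pev_smult)
  show "v \<odot> (w \<odot> z) = w \<odot> (v \<odot> z)" for z
  proof (rule LIMSEQ_unique)
    show "(\<lambda>n. B.pev y (P n) \<odot> (B.pev y (Q n) \<odot> z)) \<longlonglongrightarrow> v \<odot> (w \<odot> z)"
      by (intro B.tendsto P Q tendsto_const)
    show "(\<lambda>n. B.pev y (P n) \<odot> (B.pev y (Q n) \<odot> z)) \<longlonglongrightarrow> w \<odot> (v \<odot> z)"
      unfolding B.pev_commute[of y "P _"] by (intro B.tendsto P Q tendsto_const)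
  qed
qed

lemma gen_self: "y \<in> gen y"
proof -
  have "B.pev y [:0, 1:] = y" by (simp add: B.pev_pCons B.unit' B.bilin)
  then show ?thesis unfolding gen_def using closure_subset by (metis rangeI subsetD)
qed

text \<open>The summand 1 leaves room for the strict bound on \<open>R\<close> in
  \<open>is_square_positive_poly\<close>. It also makes the interval longer than the spectrum, so
  functions must be continuous beyond the spectrum.\<close>

definition rad :: "'a \<times> real \<Rightarrow> real"
  where "rad y = norm (fst y) + \<bar>snd y\<bar> + 1"

abbreviation intv :: "'a \<times> real \<Rightarrow> real set"
  where "intv y \<equiv> {- rad y..rad y}"

lemma snd_in_intv: "snd y \<in> intv y"
  using norm_ge_zero[of "fst y"] unfolding rad_def atLeastAtMost_iff by linarith

definition approx :: "'a \<times> real \<Rightarrow> (real \<Rightarrow> real) \<Rightarrow> (nat \<Rightarrow> real poly) \<Rightarrow> bool"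
  where "approx y f P \<longleftrightarrow> uniform_limit (intv y) (\<lambda>n. poly (P n)) f sequentially"

lemma approxD:
  "approx y f P \<Longrightarrow> 0 < e \<Longrightarrow> \<forall>\<^sub>F n in sequentially. \<forall>t\<in>intv y. dist (poly (P n) t) (f t) < e"
  unfolding approx_def by (rule uniform_limitD)

text \<open>The description is meaningful for \<open>y \<in> SB\<close> and \<open>f\<close>
  continuous on the interval: uniform approximation makes the values Cauchy and their limit
  independent of the approximating sequence.\<close>

definition fc :: "'a \<times> real \<Rightarrow> (real \<Rightarrow> real) \<Rightarrow> 'a \<times> real"
  where "fc y f = (THE v. \<exists>P. approx y f P \<and> (\<lambda>n. B.pev y (P n)) \<longlonglongrightarrow> v)"

lemma approx_exists:
  assumes f: "continuous_on (intv y) f"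
  shows "\<exists>P. approx y f P"
proof -
  have "\<exists>p. \<forall>t\<in>intv y. \<bar>f t - poly p t\<bar> < inverse (real (Suc n))" for n
  proof -
    obtain g where g: "real_polynomial_function g" "\<And>t. t \<in> intv y \<Longrightarrow> \<bar>f t - g t\<bar> < inverse (real (Suc n))"
      using Stone_Weierstrass_real_polynomial_function[OF compact_Icc f, of "inverse (real (Suc n))"] by auto
    obtain a m where "g = (\<lambda>x. \<Sum>i\<le>m. a i * x ^ i)"
      using g(1) real_polynomial_function_iff_sum by blast
    then have "g = poly (\<Sum>i\<le>m. monom (a i) i)"
      by (simp add: fun_eq_iff poly_sum poly_monom)
    then show ?thesis using g(2) by metis
  qed
  then obtain P where P: "\<And>n t. t \<in> intv y \<Longrightarrow> \<bar>f t - poly (P n) t\<bar> < inverse (real (Suc n))"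
    by metis
  have "uniform_limit (intv y) (\<lambda>n. poly (P n)) f sequentially"
  proof (rule uniform_limitI)
    fix e :: real assume "0 < e"
    then have "\<forall>\<^sub>F n in sequentially. inverse (real (Suc n)) < e"
      using LIMSEQ_inverse_real_of_nat order_tendstoD(2) by blast
    then show "\<forall>\<^sub>F n in sequentially. \<forall>t\<in>intv y. dist (poly (P n) t) (f t) < e"
    proof eventually_elim
      case (elim n)
      then show ?case using P[of _ n] by (force simp: dist_real_def abs_minus_commute)
    qed
  qed
  then show ?thesis unfolding approx_def by blast
qed

lemma norm_pev_le:
  assumes "y \<in> SB" "\<And>t. t \<in> intv y \<Longrightarrow> \<bar>poly p t\<bar> \<le> M"
  shows "norm (B.pev y p) \<le> 3 * M"
proof -
  interpret C: commutative_subalgebra scaleC jprod star "gen y"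
    by (rule commutative_subalgebra_gen) (rule assms)
  show ?thesis
  proof (rule C.norm_pev_le[where R="rad y", OF gen_self])
    fix t assume "\<bar>t\<bar> \<le> rad y"
    then have "t \<in> intv y" by auto
    then show "\<bar>poly p t\<bar> \<le> M" by (rule assms(2))
  qed (simp add: rad_def)
qed

lemma approx_diff_tendsto_0:
  assumes y: "y \<in> SB" and P: "approx y f P" and Q: "approx y f Q"
  shows "(\<lambda>n. B.pev y (P n) - B.pev y (Q n)) \<longlonglongrightarrow> 0"
proof (rule LIMSEQ_I)
  fix e :: real assume e: "0 < e"
  have "\<forall>\<^sub>F n in sequentially. \<forall>t\<in>intv y. dist (poly (P n) t) (f t) < e/8"
    "\<forall>\<^sub>F n in sequentially. \<forall>t\<in>intv y. dist (poly (Q n) t) (f t) < e/8"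
    using approxD[OF P, of "e/8"] approxD[OF Q, of "e/8"] e by simp_all
  then have "\<forall>\<^sub>F n in sequentially. norm (B.pev y (P n) - B.pev y (Q n)) < e"
  proof eventually_elim
    case (elim n)
    have "\<bar>poly (P n - Q n) t\<bar> \<le> e/4" if "t \<in> intv y" for t
      using elim(1)[rule_format, OF that] elim(2)[rule_format, OF that]
      unfolding dist_real_def poly_diff by arith
    from norm_pev_le[OF y this] have "norm (B.pev y (P n - Q n)) \<le> 3 * (e/4)" .
    moreover have "B.pev y (P n - Q n) + B.pev y (Q n) = B.pev y (P n)"
      by (metis B.pev_add diff_add_cancel)
    ultimately show ?case using e by (simp add: eq_diff_eq[symmetric])
  qed
  then show "\<exists>N. \<forall>n\<ge>N. norm (B.pev y (P n) - B.pev y (Q n) - 0) < e"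
    by (simp add: eventually_sequentially)
qed

lemma approx_convergent:
  assumes y: "y \<in> SB" and P: "approx y f P"
  shows "\<exists>v. (\<lambda>n. B.pev y (P n)) \<longlonglongrightarrow> v"
proof -
  have "Cauchy (\<lambda>n. B.pev y (P n))"
  proof (rule CauchyI)
    fix e :: real assume e: "0 < e"
    have "\<forall>\<^sub>F n in sequentially. \<forall>t\<in>intv y. dist (poly (P n) t) (f t) < e/8"
      using approxD[OF P, of "e/8"] e by simp
    then obtain N where N: "\<And>n t. n \<ge> N \<Longrightarrow> t \<in> intv y \<Longrightarrow> dist (poly (P n) t) (f t) < e/8"
      unfolding eventually_sequentially by blast
    have "norm (B.pev y (P m) - B.pev y (P n)) < e" if "m \<ge> N" "n \<ge> N" for m n
    proof -
      have "\<bar>poly (P m - P n) t\<bar> \<le> e/4" if "t \<in> intv y" for t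
        using N[OF \<open>m \<ge> N\<close> that] N[OF \<open>n \<ge> N\<close> that]
        unfolding dist_real_def poly_diff by arith
      from norm_pev_le[OF y this] have "norm (B.pev y (P m - P n)) \<le> 3 * (e/4)" .
      moreover have "B.pev y (P m - P n) + B.pev y (P n) = B.pev y (P m)"
        by (metis B.pev_add diff_add_cancel)
      ultimately show ?thesis using e by (simp add: eq_diff_eq[symmetric])
    qed
    then show "\<exists>M. \<forall>m\<ge>M. \<forall>n\<ge>M. norm (B.pev y (P m) - B.pev y (P n)) < e" by blast
  qed
  then show ?thesis by (simp add: Cauchy_convergent_iff convergent_def)
qed

lemma approx_fc:
  assumes y: "y \<in> SB" and P: "approx y f P"
  shows "(\<lambda>n. B.pev y (P n)) \<longlonglongrightarrow> fc y f"
proof -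
  obtain v where v: "(\<lambda>n. B.pev y (P n)) \<longlonglongrightarrow> v" using approx_convergent assms by blast
  have "fc y f = v" unfolding fc_def
  proof (rule the_equality)
    show "\<exists>P. approx y f P \<and> (\<lambda>n. B.pev y (P n)) \<longlonglongrightarrow> v" using P v by blast
    fix w assume "\<exists>P. approx y f P \<and> (\<lambda>n. B.pev y (P n)) \<longlonglongrightarrow> w"
    then obtain Q where Q: "approx y f Q" "(\<lambda>n. B.pev y (Q n)) \<longlonglongrightarrow> w" by blast
    have "v - w = 0"
      using approx_diff_tendsto_0[OF y P Q(1)] tendsto_diff[OF v Q(2)] LIMSEQ_unique by blast
    then show "w = v" by simp
  qed
  then show ?thesis using v by simp
qed

lemma fc_approx:
  assumes "y \<in> SB" "continuous_on (intv y) f"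
  obtains P where "approx y f P" "(\<lambda>n. B.pev y (P n)) \<longlonglongrightarrow> fc y f"
  using approx_exists approx_fc assms by blast

lemma fc_poly: "y \<in> SB \<Longrightarrow> fc y (poly p) = B.pev y p"
proof -
  assume y: "y \<in> SB"
  have "approx y (poly p) (\<lambda>_. p)" by (simp add: approx_def uniform_limit_const)
  from approx_fc[OF y this] show ?thesis using LIMSEQ_unique tendsto_const by blast
qed

lemma fc_const: "y \<in> SB \<Longrightarrow> fc y (\<lambda>t. c) = c *\<^sub>R un"
proof -
  have e: "(\<lambda>t. c) = poly [:c:]" by (simp add: fun_eq_iff)
  assume "y \<in> SB"
  then show ?thesis unfolding e by (simp only: fc_poly B.pev_const)
qed

lemma fc_id: "y \<in> SB \<Longrightarrow> fc y (\<lambda>t. t) = y"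
proof -
  have e: "(\<lambda>t::real. t) = poly [:0, 1:]" by (simp add: fun_eq_iff)
  assume "y \<in> SB"
  then show ?thesis unfolding e by (simp only: fc_poly) (simp add: B.pev_pCons B.unit' B.bilin)
qed

lemma fc_cong: "(\<And>t. t \<in> intv y \<Longrightarrow> f t = g t) \<Longrightarrow> fc y f = fc y g"
proof -
  assume "\<And>t. t \<in> intv y \<Longrightarrow> f t = g t"
  then have "approx y f P = approx y g P" for P
    unfolding approx_def by (intro uniform_limit_cong) auto
  then show ?thesis by (simp add: fc_def)
qed

lemma fc_add:
  assumes y: "y \<in> SB" and f: "continuous_on (intv y) f" and g: "continuous_on (intv y) g"
  shows "fc y (\<lambda>t. f t + g t) = fc y f + fc y g"
proof -
  obtain P Q where P: "approx y f P" "(\<lambda>n. B.pev y (P n)) \<longlonglongrightarrow> fc y f"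
    and Q: "approx y g Q" "(\<lambda>n. B.pev y (Q n)) \<longlonglongrightarrow> fc y g"
    using fc_approx[OF y f] fc_approx[OF y g] by metis
  have "approx y (\<lambda>t. f t + g t) (\<lambda>n. P n + Q n)"
    using P(1) Q(1) unfolding approx_def poly_add by (intro uniform_limit_intros)
  from approx_fc[OF y this] show ?thesis
    using tendsto_add[OF P(2) Q(2)] LIMSEQ_unique unfolding B.pev_add by blast
qed

lemma fc_mult:
  assumes y: "y \<in> SB" and f: "continuous_on (intv y) f" and g: "continuous_on (intv y) g"
  shows "fc y (\<lambda>t. f t * g t) = fc y f \<odot> fc y g"
proof -
  obtain P Q where P: "approx y f P" "(\<lambda>n. B.pev y (P n)) \<longlonglongrightarrow> fc y f"
    and Q: "approx y g Q" "(\<lambda>n. B.pev y (Q n)) \<longlonglongrightarrow> fc y g"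
    using fc_approx[OF y f] fc_approx[OF y g] by metis
  have b: "bounded (f ` intv y)" "bounded (g ` intv y)"
    using f g compact_continuous_image compact_imp_bounded by blast+
  have "approx y (\<lambda>t. f t * g t) (\<lambda>n. P n * Q n)"
    using P(1) Q(1) b unfolding approx_def poly_mult by (intro uniform_lim_mult)
  from approx_fc[OF y this] show ?thesis
    using B.tendsto[OF P(2) Q(2)] LIMSEQ_unique unfolding B.pev_mult by blast
qed

lemma fc_scale:
  assumes y: "y \<in> SB" and f: "continuous_on (intv y) f"
  shows "fc y (\<lambda>t. r * f t) = r *\<^sub>R fc y f"
  using fc_mult[OF y continuous_on_const f, of r] by (simp add: fc_const y B.bilin B.unit)

lemma fc_diff:
  assumes y: "y \<in> SB" and f: "continuous_on (intv y) f" and g: "continuous_on (intv y) g"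
  shows "fc y (\<lambda>t. f t - g t) = fc y f - fc y g"
  using fc_add[OF y f continuous_on_mult[OF continuous_on_const g, of "-1"]] fc_scale[OF y g, of "-1"]
  by simp

lemma fc_in_gen:
  assumes "y \<in> SB" "continuous_on (intv y) f"
  shows "fc y f \<in> gen y"
proof -
  obtain P where "approx y f P" "(\<lambda>n. B.pev y (P n)) \<longlonglongrightarrow> fc y f"
    using fc_approx[OF assms] .
  then show ?thesis unfolding gen_def closure_sequential
    by (intro exI[of _ "\<lambda>n. B.pev y (P n)"]) auto
qed

lemma fc_SB:
  assumes "y \<in> SB" "continuous_on (intv y) f"
  shows "fc y f \<in> SB"
  using fc_in_gen[OF assms] commutative_subalgebra.F_SB[OF commutative_subalgebra_gen] assms by blast

text \<open>\<open>snd\<close> is a character, so it evaluates functions at \<open>snd y\<close>. In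
  particular, functions vanishing at \<open>snd y\<close> give elements of the original
  algebra.\<close>

lemma snd_fc:
  assumes y: "y \<in> SB" and f: "continuous_on (intv y) f"
  shows "snd (fc y f) = f (snd y)"
proof -
  interpret C: commutative_subalgebra scaleC jprod star "gen y"
    by (rule commutative_subalgebra_gen) (rule assms)
  obtain P where P: "approx y f P" "(\<lambda>n. B.pev y (P n)) \<longlonglongrightarrow> fc y f"
    using fc_approx[OF y f] .
  have "(\<lambda>n. poly (P n) (snd y)) \<longlonglongrightarrow> f (snd y)"
    using tendsto_uniform_limitI[OF P(1)[unfolded approx_def] snd_in_intv] .
  then show ?thesis
    using tendsto_snd[OF P(2)] LIMSEQ_unique unfolding C.snd_pev by blast
qed

lemma norm_fc_ujp_le:
  assumes y: "y \<in> SB" and f: "continuous_on (intv y) f" and M: "\<And>t. t \<in> intv y \<Longrightarrow> \<bar>f t\<bar> \<le> M"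
  shows "commutative_subalgebra.op_bd jprod (gen y) M (fc y f)"
proof -
  interpret C: commutative_subalgebra scaleC jprod star "gen y"
    by (rule commutative_subalgebra_gen) (rule assms)
  obtain P where P: "approx y f P" "(\<lambda>n. B.pev y (P n)) \<longlonglongrightarrow> fc y f"
    using fc_approx[OF y f] .
  have "norm (fc y f \<odot> c) \<le> M * norm c + e * norm c" if c: "c \<in> gen y" "snd c = 0" and e: "0 < e" for c e
  proof (rule tendsto_upperbound)
    show "(\<lambda>n. norm (B.pev y (P n) \<odot> c)) \<longlonglongrightarrow> norm (fc y f \<odot> c)"
      by (intro tendsto_norm B.tendsto P tendsto_const)
    have "\<forall>\<^sub>F n in sequentially. \<forall>t\<in>intv y. dist (poly (P n) t) (f t) < e"
      using approxD[OF P(1) e] .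
    then show "\<forall>\<^sub>F n in sequentially. norm (B.pev y (P n) \<odot> c) \<le> M * norm c + e * norm c"
    proof eventually_elim
      case (elim n)
      have "C.op_bd (M + e) (B.pev y (P n))"
      proof (rule C.op_bd_pev[where R="rad y", OF gen_self])
        fix t assume "\<bar>t\<bar> \<le> rad y"
        then have "t \<in> intv y" by auto
        then show "\<bar>poly (P n) t\<bar> \<le> M + e"
          using M[of t] elim[rule_format, of t] unfolding dist_real_def by arith
      qed (simp add: rad_def)
      then show ?case using c by (simp add: C.op_bd_def algebra_simps)
    qed
  qed simp
  then have *: "norm (fc y f \<odot> c) \<le> M * norm c + e * norm c" if "c \<in> gen y" "snd c = 0" "0 < e" for c e
    using that by blast
  have "norm (fc y f \<odot> c) \<le> M * norm c" if c: "c \<in> gen y" "snd c = 0" for c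
  proof (cases "c = 0")
    case False
    show ?thesis
    proof (rule field_le_epsilon)
      fix e :: real assume "0 < e"
      then show "norm (fc y f \<odot> c) \<le> M * norm c + e"
        using *[OF c, of "e / norm c"] False by simp
    qed
  qed (simp add: B.bilin)
  then show ?thesis
    using M[OF snd_in_intv] snd_fc[OF y f] by (simp add: C.op_bd_def)
qed

lemma norm_fc_le:
  assumes y: "y \<in> SB" and f: "continuous_on (intv y) f" and M: "\<And>t. t \<in> intv y \<Longrightarrow> \<bar>f t\<bar> \<le> M"
  shows "norm (fc y f) \<le> 3 * M"
  by (rule commutative_subalgebra.norm_le_op_bd[OF commutative_subalgebra_gen[OF y]])
     (auto intro: fc_in_gen norm_fc_ujp_le assms)

text \<open>Inside the original algebra the constant 3 of \<open>norm_fc_le\<close> improves to 1,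
  because the norm of a square is the square of the norm. Comparing order with norm relies on this
  sharp constant.\<close>

lemma norm_fc_le_ideal:
  assumes y: "y \<in> SB" and f: "continuous_on (intv y) f" and M: "\<And>t. t \<in> intv y \<Longrightarrow> \<bar>f t\<bar> \<le> M"
    and 0: "f (snd y) = 0"
  shows "norm (fc y f) \<le> M"
proof -
  interpret C: commutative_subalgebra scaleC jprod star "gen y"
    by (rule commutative_subalgebra_gen) (rule assms)
  have v: "fc y f \<in> gen y" "snd (fc y f) = 0" using fc_in_gen snd_fc 0 y f by auto
  then have "norm (fc y f \<odot> fc y f) \<le> M * norm (fc y f)"
    using norm_fc_ujp_le[OF y f M] by (simp add: C.op_bd_def)
  then have "norm (fc y f) * norm (fc y f) \<le> M * norm (fc y f)"
    using C.norm_square[OF v] by (simp add: power2_eq_square)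
  moreover have "0 \<le> M" using M[OF snd_in_intv] by linarith
  ultimately show ?thesis by (cases "fc y f = 0") auto
qed

end

text \<open>\<open>x\<close> is a convex combination of \<open>x + s v\<close> and
  \<open>x - t v\<close>. If the second is longer than \<open>x\<close> only to higher order, the
  first cannot be shorter.\<close>

lemma norm_expansive:
  fixes x v :: "'b::real_normed_vector"
  assumes "\<And>d. 0 < d \<Longrightarrow> \<exists>t>0. norm (x - t *\<^sub>R v) \<le> (1 + t * d) * norm x" and s: "0 \<le> s"
  shows "norm x \<le> norm (x + s *\<^sub>R v)"
proof -
  have *: "norm x \<le> norm (x + s *\<^sub>R v) + s * d * norm x" if d: "0 < d" for d
  proof -
    obtain t where t: "0 < t" "norm (x - t *\<^sub>R v) \<le> (1 + t * d) * norm x"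
      using assms(1)[OF d] by blast
    have "(1 + s/t) *\<^sub>R x = (x + s *\<^sub>R v) + (s/t) *\<^sub>R (x - t *\<^sub>R v)"
      using t(1) by (simp only: scaleR_add_left scaleR_diff_right) simp
    then have "norm ((1 + s/t) *\<^sub>R x) \<le> norm (x + s *\<^sub>R v) + norm ((s/t) *\<^sub>R (x - t *\<^sub>R v))"
      by (metis norm_triangle_ineq)
    then have "(1 + s/t) * norm x \<le> norm (x + s *\<^sub>R v) + (s/t) * norm (x - t *\<^sub>R v)"
      using s t(1) by (simp only: norm_scaleR) (simp add: abs_of_nonneg)
    also have "\<dots> \<le> norm (x + s *\<^sub>R v) + (s/t) * ((1 + t * d) * norm x)"
      using s t by (intro add_left_mono mult_left_mono) auto
    also have "(s/t) * ((1 + t * d) * norm x) = (s/t) * norm x + s * d * norm x"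
      using t(1) by (simp add: field_simps)
    finally show ?thesis by (simp add: distrib_right)
  qed
  show ?thesis
  proof (cases "s * norm x = 0")
    case True
    then show ?thesis by auto
  next
    case False
    show ?thesis
    proof (rule field_le_epsilon)
      fix e :: real assume "0 < e"
      then show "norm x \<le> norm (x + s *\<^sub>R v) + e"
        using *[of "e / (s * norm x)"] False s by (simp add: zero_less_mult_iff)
    qed
  qed
qed

section \<open>The \<open>U2\<close> operators of commuting elements\<close>

context commutative_subalgebra
begin

lemma F_jp_U2:
  assumes "b \<in> F" "c \<in> F" "d \<in> F"
  shows "2 *\<^sub>R (d \<odot> B.U2 b c z) = B.U2 (d \<odot> b) c z + B.U2 b (d \<odot> c) z"
  by (rule B.jp_U2) (use assms in \<open>auto intro: F_comm F_mult\<close>)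

lemma F_jp_U:
  assumes "r \<in> F" "y \<in> F"
  shows "r \<odot> B.U y z = B.U2 (r \<odot> y) y z" "r \<odot> B.U y z = B.U y (r \<odot> z)"
proof -
  have "2 *\<^sub>R (r \<odot> B.U y z) = 2 *\<^sub>R B.U2 (r \<odot> y) y z"
    using F_jp_U2[OF assms(2,2,1), of z] B.U2_sym[of y "r \<odot> y"] by (simp add: scaleR_2)
  then show "r \<odot> B.U y z = B.U2 (r \<odot> y) y z" by simp
  show "r \<odot> B.U y z = B.U y (r \<odot> z)"
    using assms by (simp add: B.U2_def B.bilin F_comm[of r y] F_comm[of r "y \<odot> y"] F_mult)
qed

text \<open>\<open>U d\<close> is twice the square of the multiplication by \<open>d\<close> minus
  the multiplication by \<open>d \<odot> d\<close>. In terms of kernels, \<open>(d s + d t)\<^sup>2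
  / 2 - ((d s)\<^sup>2 + (d t)\<^sup>2) / 2 = d s * d t\<close>.\<close>

lemma F_U_U2:
  assumes "b \<in> F" "c \<in> F" "d \<in> F"
  shows "B.U d (B.U2 b c z) = B.U2 (d \<odot> b) (d \<odot> c) z"
proof -
  let ?G = "\<lambda>b c. B.U2 b c z"
  have 1: "2 *\<^sub>R (d \<odot> ?G b c) = ?G (d \<odot> b) c + ?G b (d \<odot> c)" if "b \<in> F" "c \<in> F" for b c
    using F_jp_U2 that assms(3) by blast
  have "4 *\<^sub>R (d \<odot> (d \<odot> ?G b c)) = 2 *\<^sub>R (d \<odot> (2 *\<^sub>R (d \<odot> ?G b c)))"
    by (simp add: B.bilin)
  also have "\<dots> = 2 *\<^sub>R (d \<odot> ?G (d \<odot> b) c) + 2 *\<^sub>R (d \<odot> ?G b (d \<odot> c))"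
    by (simp only: 1 assms B.add_right scaleR_add_right)
  also have "\<dots> = ?G (d \<odot> (d \<odot> b)) c + 2 *\<^sub>R ?G (d \<odot> b) (d \<odot> c) + ?G b (d \<odot> (d \<odot> c))"
    by (simp only: 1 F_mult assms) (simp add: scaleR_2)
  finally have A: "4 *\<^sub>R (d \<odot> (d \<odot> ?G b c))
    = ?G (d \<odot> (d \<odot> b)) c + 2 *\<^sub>R ?G (d \<odot> b) (d \<odot> c) + ?G b (d \<odot> (d \<odot> c))" .
  have "2 *\<^sub>R ((d \<odot> d) \<odot> ?G b c) = ?G (d \<odot> (d \<odot> b)) c + ?G b (d \<odot> (d \<odot> c))"
    using F_jp_U2[of b c "d \<odot> d" z] assms by (simp add: F_mult F_assoc)
  then have "2 *\<^sub>R B.U d (?G b c) = 2 *\<^sub>R ?G (d \<odot> b) (d \<odot> c)"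
  proof -
    have "2 *\<^sub>R B.U d (?G b c) = 4 *\<^sub>R (d \<odot> (d \<odot> ?G b c)) - 2 *\<^sub>R ((d \<odot> d) \<odot> ?G b c)"
      using scaleR_add_left[of 2 2 "d \<odot> (d \<odot> ?G b c)"]
      unfolding B.U2_def[of d d] by (simp add: scaleR_add_right scaleR_diff_right)
    then show ?thesis using A \<open>2 *\<^sub>R ((d \<odot> d) \<odot> ?G b c) = _\<close> by simp
  qed
  then show ?thesis by simp
qed

end

context jb_star_algebra
begin

lemma U_un: "B.U un z = z"
  by (simp add: B.U2_def B.unit)

lemma U_apply_un: "B.U z un = z \<odot> z"
  by (simp add: B.U2_def B.unit')

text \<open>There are three terms with two products each, and each product costs the factor 4 of
  \<open>norm_ujp_le\<close>.\<close>

lemma norm_UB_le: "norm (B.U2 x y z) \<le> 48 * (norm x * norm y * norm z)"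
proof -
  have 1: "norm (u \<odot> (v \<odot> w)) \<le> 16 * (norm u * norm v * norm w)" for u v w
  proof -
    have "norm (u \<odot> (v \<odot> w)) \<le> norm u * norm (v \<odot> w) * 4" by (rule norm_ujp_le)
    also have "\<dots> \<le> norm u * (norm v * norm w * 4) * 4"
      by (intro mult_right_mono mult_left_mono norm_ujp_le) simp_all
    finally show ?thesis by simp
  qed
  have 2: "norm ((u \<odot> v) \<odot> w) \<le> 16 * (norm u * norm v * norm w)" for u v w
    using 1[of w u v] by (simp add: B.commute[of w] mult_ac)
  have "norm (B.U2 x y z) \<le> norm (x \<odot> (y \<odot> z)) + norm (y \<odot> (x \<odot> z)) + norm ((x \<odot> y) \<odot> z)"
    unfolding B.U2_def by (rule order_trans[OF norm_triangle_ineq4 add_right_mono[OF norm_triangle_ineq]])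
  also have "\<dots> \<le> 16 * (norm x * norm y * norm z) + 16 * (norm y * norm x * norm z) + 16 * (norm x * norm y * norm z)"
    by (intro add_mono 1 2)
  finally show ?thesis by (simp add: algebra_simps)
qed

lemma SB_U2: "x \<in> SB \<Longrightarrow> y \<in> SB \<Longrightarrow> z \<in> SB \<Longrightarrow> B.U2 x y z \<in> SB"
  by (simp add: B.U2_def SB_add SB_diff SB_mult)

text \<open>This multiplicativity is used both to invert \<open>U\<close> operators and to run the
  factorization argument.\<close>

lemma U_fc_fc:
  assumes "y \<in> SB" "continuous_on (intv y) f" "continuous_on (intv y) g"
  shows "B.U (fc y f) (B.U (fc y g) z) = B.U (fc y (\<lambda>t. f t * g t)) z"
  using commutative_subalgebra.F_U_U2[OF commutative_subalgebra_gen, OF assms(1) fc_in_gen fc_in_gen fc_in_gen]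
  by (simp add: assms fc_mult)

section \<open>Accretive elements\<close>

text \<open>The test vectors are the pairs \<open>(x, 0)\<close>, which multiplication preserves and
  on which the norm is the given JB* norm.\<close>

definition accretive :: "'a \<times> real \<Rightarrow> bool"
  where "accretive y \<longleftrightarrow> (\<forall>s\<ge>0. \<forall>x. norm x \<le> norm ((x, 0) + s *\<^sub>R (y \<odot> (x, 0))))"

lemma act_bound: "norm (y \<odot> (x, 0)) \<le> (norm (fst y) + \<bar>snd y\<bar>) * norm x"
  unfolding ujp_embed norm_embed distrib_right
  by (rule order_trans[OF norm_triangle_ineq add_mono[OF norm_jprod_le]]) simp

lemma accretiveI:
  assumes "\<And>d. 0 < d \<Longrightarrow> \<exists>t>0. \<forall>x. norm ((x, 0) - t *\<^sub>R (y \<odot> (x, 0))) \<le> (1 + t * d) * norm x"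
  shows "accretive y"
  unfolding accretive_def
proof (intro allI impI)
  fix s :: real and x :: 'a assume s: "0 \<le> s"
  show "norm x \<le> norm ((x, 0) + s *\<^sub>R (y \<odot> (x, 0)))"
    using norm_expansive[OF _ s, of "(x, 0)" "y \<odot> (x, 0)"] assms by (simp only: norm_embed) blast
qed

text \<open>Apply accretivity to the vector \<open>(1 - t L) x\<close>, where \<open>L\<close> is
  the multiplication: \<open>(1 + t L) (1 - t L) = 1 - t\<^sup>2 L\<^sup>2\<close> leaves a
  quadratic error.\<close>

lemma accretive_bound:
  assumes "accretive y" "0 \<le> t"
  shows "norm ((x, 0) - t *\<^sub>R (y \<odot> (x, 0))) \<le> (1 + (t * (norm (fst y) + \<bar>snd y\<bar>))\<^sup>2) * norm x"
proof -
  let ?x = "(x, 0::real)" and ?k = "norm (fst y) + \<bar>snd y\<bar>"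
  obtain v where v: "?x - t *\<^sub>R (y \<odot> ?x) = (v, 0)"
    by (simp add: ujp_embed)
  have "norm v \<le> norm ((v, 0) + t *\<^sub>R (y \<odot> (v, 0)))"
    using assms by (simp add: accretive_def)
  also have "(v, 0) + t *\<^sub>R (y \<odot> (v, 0)) = ?x - (t * t) *\<^sub>R (y \<odot> (y \<odot> ?x))"
    unfolding v[symmetric] by (simp add: B.bilin scaleR_diff_right)
  also have "norm \<dots> \<le> norm x + (t * t) * (?k * (?k * norm x))"
  proof (rule order_trans[OF norm_triangle_ineq4], intro add_mono)
    have "norm (y \<odot> (y \<odot> ?x)) \<le> ?k * norm (y \<odot> ?x)"
      using act_bound[of y "fst (y \<odot> ?x)"] by (simp add: ujp_embed)
    also have "\<dots> \<le> ?k * (?k * norm x)" by (intro mult_left_mono act_bound) simp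
    finally show "norm ((t * t) *\<^sub>R (y \<odot> (y \<odot> ?x))) \<le> (t * t) * (?k * (?k * norm x))"
      by (simp add: mult_left_mono)
  qed simp
  finally show ?thesis unfolding v by (simp add: power2_eq_square algebra_simps)
qed

text \<open>\<open>1 - t (L + M)\<close> is the mean of \<open>1 - 2 t L\<close> and
  \<open>1 - 2 t M\<close>, whose norms exceed 1 only to second order in \<open>t\<close>.\<close>

lemma accretive_add:
  assumes "accretive y" "accretive z"
  shows "accretive (y + z)"
proof (rule accretiveI)
  fix d :: real assume d: "0 < d"
  define k where "k = (norm (fst y) + \<bar>snd y\<bar>)\<^sup>2 + (norm (fst z) + \<bar>snd z\<bar>)\<^sup>2 + 1"
  have k: "0 < k" by (simp add: k_def add_nonneg_pos)
  define t where "t = d / (4 * k)"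
  have t: "0 < t" using d k by (simp add: t_def)
  have "norm ((x, 0) - t *\<^sub>R ((y + z) \<odot> (x, 0))) \<le> (1 + t * d) * norm x" for x
  proof -
    let ?x = "(x, 0::real)"
    have "2 *\<^sub>R (?x - t *\<^sub>R ((y + z) \<odot> ?x)) = (?x - (2*t) *\<^sub>R (y \<odot> ?x)) + (?x - (2*t) *\<^sub>R (z \<odot> ?x))"
      by (simp only: B.add_left scaleR_add_right scaleR_diff_right scaleR_scaleR) (simp add: scaleR_2)
    then have "2 * norm (?x - t *\<^sub>R ((y + z) \<odot> ?x)) \<le> norm (?x - (2*t) *\<^sub>R (y \<odot> ?x)) + norm (?x - (2*t) *\<^sub>R (z \<odot> ?x))"
      by (metis norm_scaleR norm_triangle_ineq abs_numeral)
    also have "\<dots> \<le> (1 + (2*t * (norm (fst y) + \<bar>snd y\<bar>))\<^sup>2) * norm x + (1 + (2*t * (norm (fst z) + \<bar>snd z\<bar>))\<^sup>2) * norm x"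
      using t assms by (intro add_mono accretive_bound) auto
    also have "\<dots> = (2 + 4 * t\<^sup>2 * (k - 1)) * norm x"
    proof -
      have "(1 + (2*t*p)\<^sup>2) * n + (1 + (2*t*q)\<^sup>2) * n = (2 + 4 * t\<^sup>2 * (p\<^sup>2 + q\<^sup>2)) * n" for p q n :: real
        by (simp add: power_mult_distrib algebra_simps)
      then show ?thesis by (simp only: k_def add_diff_cancel_right')
    qed
    also have "\<dots> \<le> (2 + 2 * (t * d)) * norm x"
    proof (intro mult_right_mono add_left_mono)
      have "4 * t\<^sup>2 * (k - 1) \<le> 4 * t\<^sup>2 * k" using k by (intro mult_left_mono) auto
      also have "\<dots> = t * d" using k by (simp add: t_def power2_eq_square field_simps)
      finally show "4 * t\<^sup>2 * (k - 1) \<le> 2 * (t * d)" using t d by (smt (verit) mult_pos_pos)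
    qed simp
    finally show ?thesis by (simp add: algebra_simps)
  qed
  then show "\<exists>t>0. \<forall>x. norm ((x, 0) - t *\<^sub>R ((y + z) \<odot> (x, 0))) \<le> (1 + t * d) * norm x"
    using t by blast
qed

lemma accretive_scale:
  assumes "accretive y" "0 \<le> r"
  shows "accretive (r *\<^sub>R y)"
  unfolding accretive_def
proof (intro allI impI)
  fix s :: real and x :: 'a assume "0 \<le> s"
  then have "0 \<le> s * r" using assms by simp
  then have "norm x \<le> norm ((x, 0) + (s * r) *\<^sub>R (y \<odot> (x, 0)))"
    using assms(1) unfolding accretive_def by blast
  then show "norm x \<le> norm ((x, 0) + s *\<^sub>R (r *\<^sub>R y \<odot> (x, 0)))" by (simp add: B.bilin)
qed

lemma accretive_LIMSEQ:
  assumes "\<And>n. accretive (y n)" "y \<longlonglongrightarrow> z"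
  shows "accretive z"
  unfolding accretive_def
proof (intro allI impI)
  fix s :: real and x :: 'a assume "0 \<le> s"
  then have "norm x \<le> norm ((x, 0) + s *\<^sub>R (y n \<odot> (x, 0)))" for n
    using assms(1) unfolding accretive_def by blast
  moreover have "(\<lambda>n. norm ((x, 0) + s *\<^sub>R (y n \<odot> (x, 0)))) \<longlonglongrightarrow> norm ((x, 0) + s *\<^sub>R (z \<odot> (x, 0)))"
    by (intro tendsto_intros B.tendsto assms(2))
  ultimately show "norm x \<le> norm ((x, 0) + s *\<^sub>R (z \<odot> (x, 0)))"
    by (intro LIMSEQ_le_const) auto
qed

lemma accretive_un_diff:
  assumes "\<And>x. norm (y \<odot> (x, 0)) \<le> c * norm x"
  shows "accretive (c *\<^sub>R un - y)"
  unfolding accretive_def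
proof (intro allI impI)
  fix s :: real and x :: 'a assume s: "0 \<le> s"
  let ?x = "(x, 0::real)"
  have e: "?x + s *\<^sub>R ((c *\<^sub>R un - y) \<odot> ?x) = (1 + s * c) *\<^sub>R ?x - s *\<^sub>R (y \<odot> ?x)"
    by (simp only: B.diff_left B.scaleR_left B.unit scaleR_add_left scaleR_diff_right scaleR_scaleR scaleR_one add_diff_eq)
  have "norm ((1 + s * c) *\<^sub>R ?x) - norm (s *\<^sub>R (y \<odot> ?x)) \<le> norm ((1 + s * c) *\<^sub>R ?x - s *\<^sub>R (y \<odot> ?x))"
    by (rule norm_triangle_ineq2)
  moreover have "(1 + s * c) * norm x \<le> norm ((1 + s * c) *\<^sub>R ?x)"
    by (simp only: norm_scaleR norm_embed) (simp add: mult_right_mono)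
  moreover have "norm (s *\<^sub>R (y \<odot> ?x)) \<le> s * (c * norm x)"
    using s assms[of x] by (simp add: mult_left_mono)
  moreover have "(1 + s * c) * norm x - s * (c * norm x) = norm x"
    by (simp add: algebra_simps)
  ultimately show "norm x \<le> norm (?x + s *\<^sub>R ((c *\<^sub>R un - y) \<odot> ?x))"
    unfolding e by linarith
qed

text \<open>Multiplication by \<open>\<i>\<close> times a self-adjoint element is a derivation of the triple product
  \<open>U x (star x)\<close>, whose norm is \<open>norm x ^ 3\<close>; comparing norms of cubes shows that it is
  infinitesimally isometric.\<close>

lemma hermitian_infinitesimal:
  fixes k :: real
  assumes a: "star a = a" and t: "\<bar>t\<bar> \<le> 1"
  defines "D \<equiv> \<lambda>x. scaleC \<i> (jprod a x + k *\<^sub>R x)" and "\<kappa> \<equiv> norm a + \<bar>k\<bar>"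
  shows "norm (x + t *\<^sub>R D x) \<le> (1 + t\<^sup>2 * (27 * \<kappa>\<^sup>2 + 9 * \<kappa>^3)) * norm x"
proof -
  let ?tr = "A.trip"
  let ?K = "27 * \<kappa>\<^sup>2 + 9 * \<kappa>^3"
  define T where "T x = x + t *\<^sub>R D x" for x
  have sR: "scaleC c (r *\<^sub>R x) = r *\<^sub>R scaleC c x" for c r x
    unfolding scaleC_of_real[symmetric] by (simp add: mult.commute)
  have \<kappa>0: "0 \<le> \<kappa>" by (simp add: \<kappa>_def)
  have Dn: "norm (D x) \<le> \<kappa> * norm x" for x
    unfolding D_def norm_scaleC \<kappa>_def distrib_right
    by (simp, rule order_trans[OF norm_triangle_ineq add_mono[OF norm_jprod_le]]) simp
  have Dlin: "D (x + y) = D x + D y" "D (r *\<^sub>R x) = r *\<^sub>R D x" for x y r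
    by (simp_all add: D_def A.bilin sR scale_right_distrib scaleR_add_right algebra_simps)
  have Dtr: "D (?tr x (star x) x) = ?tr (D x) (star x) x + ?tr x (star (D x)) x + ?tr x (star x) (D x)" for x
  proof -
    have sD: "star (D x) = scaleC (-\<i>) (jprod a (star x) + k *\<^sub>R star x)"
      by (simp add: D_def star_scaleC star_add star_scaleR star_jprod a jprod_commute)
    have C: "?tr (scaleC c u) v w = scaleC c (?tr u v w)" "?tr u (scaleC c v) w = scaleC c (?tr u v w)"
      "?tr u v (scaleC c w) = scaleC c (?tr u v w)" for c u v w
      by (simp_all add: A.trip_def jprod_scaleC_left jprod_scaleC_right scale_right_distrib scale_right_diff_distrib)
    have R: "?tr (r *\<^sub>R u) v w = r *\<^sub>R (?tr u v w)" "?tr u (r *\<^sub>R v) w = r *\<^sub>R (?tr u v w)"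
      "?tr u v (r *\<^sub>R w) = r *\<^sub>R (?tr u v w)" for r u v w
      unfolding scaleC_of_real[symmetric] by (rule C)+
    have M: "?tr u (- v) w = - ?tr u v w" for u v w
      by (simp add: A.trip_def A.bilin)
    show ?thesis
      unfolding sD unfolding D_def
      by (simp add: M C R A.trip_bilin A.jp_trip[of a] sR scale_right_distrib scale_right_diff_distrib)
  qed
  have trn: "norm (?tr u v w) \<le> 3 * (norm u * norm v * norm w)" for u v w
    using norm_U2_le[of u w v] by (simp add: A.trip_U2 mult_ac)
  have T3: "norm (T x) ^ 3 \<le> norm (T (?tr x (star x) x)) + t\<^sup>2 * ?K * norm x ^ 3" for x
  proof -
    let ?u = "D x" and ?s = "star x"
    have sT: "star (T x) = star x + t *\<^sub>R star ?u"
      by (simp add: T_def star_add star_scaleR)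
    have R: "?tr (r *\<^sub>R u) v w = r *\<^sub>R (?tr u v w)" "?tr u (r *\<^sub>R v) w = r *\<^sub>R (?tr u v w)"
      "?tr u v (r *\<^sub>R w) = r *\<^sub>R (?tr u v w)" for r u v w
      by (simp_all add: A.trip_def A.bilin scaleR_add_right scaleR_diff_right)
    define E2 where "E2 = ?tr x (star ?u) ?u + ?tr ?u (star ?u) x + ?tr ?u ?s ?u"
    define E3 where "E3 = ?tr ?u (star ?u) ?u"
    \<comment> \<open>By the derivation property the terms up to first order form \<open>T\<close>
      of the cube. What remains is three terms of size \<open>9 * \<kappa>\<^sup>2\<close> and one
      of size \<open>9 * \<kappa>^3\<close>, whence \<open>?K\<close>.\<close>
    have "?tr (T x) (star (T x)) (T x) = T (?tr x ?s x) + t\<^sup>2 *\<^sub>R E2 + t ^ 3 *\<^sub>R E3"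
      unfolding sT unfolding T_def Dtr E2_def E3_def
      by (simp add: A.trip_bilin R scaleR_add_right power2_eq_square power3_eq_cube)
    moreover have "norm (T x) ^ 3 = norm (?tr (T x) (star (T x)) (T x))"
      using norm_U_star[of "T x"] by (simp add: A.trip_U2)
    ultimately have 1: "norm (T x) ^ 3 \<le> norm (T (?tr x ?s x)) + norm (t\<^sup>2 *\<^sub>R E2) + norm (t ^ 3 *\<^sub>R E3)"
      by (metis norm_triangle_ineq norm_triangle_le add_mono_thms_linordered_semiring(3))
    have sn: "norm (star x) \<le> 3 * norm x" "norm (star ?u) \<le> 3 * (\<kappa> * norm x)"
      using norm_star_le[of x] norm_star_le[of ?u] Dn[of x] by linarith+
    have b1: "norm (?tr x (star ?u) ?u) \<le> 3 * (norm x * (3 * (\<kappa> * norm x)) * (\<kappa> * norm x))"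
      by (rule order_trans[OF trn]) (intro mult_left_mono mult_mono sn Dn, auto simp: \<kappa>0)
    have b2: "norm (?tr ?u (star ?u) x) \<le> 3 * ((\<kappa> * norm x) * (3 * (\<kappa> * norm x)) * norm x)"
      by (rule order_trans[OF trn]) (intro mult_left_mono mult_mono sn Dn, auto simp: \<kappa>0)
    have b3: "norm (?tr ?u ?s ?u) \<le> 3 * ((\<kappa> * norm x) * (3 * norm x) * (\<kappa> * norm x))"
      by (rule order_trans[OF trn]) (intro mult_left_mono mult_mono sn Dn, auto simp: \<kappa>0)
    have b4: "norm E3 \<le> 3 * ((\<kappa> * norm x) * (3 * (\<kappa> * norm x)) * (\<kappa> * norm x))"
      unfolding E3_def
      by (rule order_trans[OF trn]) (intro mult_left_mono mult_mono sn Dn, auto simp: \<kappa>0)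
    have "norm E2 \<le> norm (?tr x (star ?u) ?u) + norm (?tr ?u (star ?u) x) + norm (?tr ?u ?s ?u)"
      unfolding E2_def by (rule order_trans[OF norm_triangle_ineq add_right_mono[OF norm_triangle_ineq]])
    also have "\<dots> \<le> 27 * \<kappa>\<^sup>2 * norm x ^ 3"
      using b1 b2 b3 by (simp add: power2_eq_square power3_eq_cube algebra_simps)
    finally have E2: "norm (t\<^sup>2 *\<^sub>R E2) \<le> t\<^sup>2 * (27 * \<kappa>\<^sup>2 * norm x ^ 3)"
      by (simp add: mult_left_mono)
    have E3': "norm E3 \<le> 9 * \<kappa>^3 * norm x ^ 3"
      using b4 by (simp add: power2_eq_square power3_eq_cube algebra_simps)
    have "\<bar>t ^ 3\<bar> \<le> t\<^sup>2"
    proof -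
      have "\<bar>t ^ 3\<bar> = \<bar>t\<bar> * t\<^sup>2" by (simp add: power2_eq_square power3_eq_cube abs_mult)
      also have "\<dots> \<le> 1 * t\<^sup>2" using t by (intro mult_right_mono) auto
      finally show ?thesis by simp
    qed
    then have "norm (t ^ 3 *\<^sub>R E3) \<le> t\<^sup>2 * (9 * \<kappa>^3 * norm x ^ 3)"
      unfolding norm_scaleR real_norm_def using E3' by (intro mult_mono) auto
    with 1 E2 show ?thesis by (simp add: algebra_simps)
  qed
  have T: "bounded_linear T"
  proof (rule bounded_linear_intro)
    show "norm (T x) \<le> norm x * (1 + \<bar>t\<bar> * \<kappa>)" for x
    proof -
      have "norm (T x) \<le> norm x + \<bar>t\<bar> * norm (D x)" unfolding T_def by (rule norm_triangle_le) simp
      also have "\<dots> \<le> norm x + \<bar>t\<bar> * (\<kappa> * norm x)" by (intro add_left_mono mult_left_mono Dn) simp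
      finally show ?thesis by (simp add: algebra_simps)
    qed
  qed (simp_all add: T_def Dlin scaleR_add_right algebra_simps)
  \<comment> \<open>The estimate for cubes yields \<open>G ^ 3 \<le> G + t\<^sup>2 * ?K\<close>.
    Since \<open>G - 1 \<le> G ^ 3 - G\<close> whenever \<open>1 \<le> G\<close>, the norm itself
    exceeds 1 by at most the same error.\<close>
  define G where "G = onorm T"
  have G: "norm (T x) \<le> G * norm x" for x unfolding G_def by (rule onorm[OF T])
  have G0: "0 \<le> G" unfolding G_def by (rule onorm_pos_le[OF T])
  have K0: "0 \<le> t\<^sup>2 * ?K" using \<kappa>0 by simp
  have "norm (T x) \<le> root 3 (G + t\<^sup>2 * ?K) * norm x" for x
  proof -
    have "norm (T x) ^ 3 \<le> G * norm (?tr x (star x) x) + t\<^sup>2 * ?K * norm x ^ 3"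
      using T3[of x] G[of "?tr x (star x) x"] by linarith
    also have "norm (?tr x (star x) x) = norm x ^ 3"
      using norm_U_star[of x] by (simp add: A.trip_U2)
    also have "G * norm x ^ 3 + t\<^sup>2 * ?K * norm x ^ 3 = (root 3 (G + t\<^sup>2 * ?K) * norm x) ^ 3"
      using G0 K0 by (simp add: power_mult_distrib algebra_simps)
    finally show ?thesis
      by (rule power_le_imp_le_base[where n=2, unfolded numeral_2_eq_2, folded numeral_3_eq_3]) (use G0 K0 in simp)
  qed
  note TG = this
  have "onorm T \<le> root 3 (G + t\<^sup>2 * ?K)" 
    by (rule onorm_bound[OF _ TG]) (use G0 K0 in simp)
  then have "G \<le> root 3 (G + t\<^sup>2 * ?K)" by (simp only: G_def)
  then have "G ^ 3 \<le> (root 3 (G + t\<^sup>2 * ?K)) ^ 3" using G0 by (intro power_mono)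
  then have G3: "G ^ 3 \<le> G + t\<^sup>2 * ?K" using G0 K0 by simp
  have "G \<le> 1 + t\<^sup>2 * ?K"
  proof (rule ccontr)
    assume "\<not> ?thesis"
    then have g: "1 + t\<^sup>2 * ?K < G" by simp
    then have "1 \<le> G" using K0 by linarith
    have "1 * (G - 1) \<le> (G * (G + 1)) * (G - 1)"
      using \<open>1 \<le> G\<close> by (intro mult_right_mono) (auto intro: order_trans[OF _ mult_mono[of 1 G 1 "G+1"]])
    then have "G - 1 \<le> G ^ 3 - G" by (simp add: power3_eq_cube algebra_simps)
    then show False using G3 g by linarith
  qed
  then have "G * norm x \<le> (1 + t\<^sup>2 * ?K) * norm x" by (intro mult_right_mono) auto
  then show ?thesis using G[of x] unfolding T_def by linarith
qed

text \<open>The error of \<open>hermitian_infinitesimal\<close> is quadratic and insensitive to the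
  sign of \<open>t\<close>, so \<open>norm_expansive\<close> serves both signs of
  \<open>s\<close>.\<close>

lemma hermitian_expansive:
  assumes y: "y \<in> SB"
  shows "norm x \<le> norm (x + s *\<^sub>R scaleC \<i> (jprod (fst y) x + snd y *\<^sub>R x))"
proof -
  let ?v = "scaleC \<i> (jprod (fst y) x + snd y *\<^sub>R x)"
  let ?k = "norm (fst y) + \<bar>snd y\<bar>"
  define K where "K = 27 * ?k\<^sup>2 + 9 * ?k ^ 3"
  have K: "0 \<le> K" by (simp add: K_def)
  have small: "\<exists>t>0. norm (x + (e * t) *\<^sub>R ?v) \<le> (1 + t * d) * norm x" if "0 < d" "\<bar>e\<bar> = 1" for d e
  proof (intro exI conjI)
    let ?t = "min 1 (d / (K + 1))"
    show t: "0 < ?t" using that K by (simp add: add_nonneg_pos)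
    have "\<bar>e * ?t\<bar> \<le> 1" using t that by (simp add: abs_mult)
    from hermitian_infinitesimal[OF _ this, of "fst y" x "snd y"] y
    have "norm (x + (e * ?t) *\<^sub>R ?v) \<le> (1 + (e * ?t)\<^sup>2 * K) * norm x" by (simp add: SB_def K_def)
    also have "(e * ?t)\<^sup>2 * K \<le> ?t * d"
    proof -
      have "(e * ?t)\<^sup>2 = ?t\<^sup>2" using that by (metis abs_1 mult_1 power2_abs power_mult_distrib power_one)
      moreover have "?t * K \<le> d"
      proof -
        have "?t * K \<le> (d / (K + 1)) * (K + 1)" using K that by (intro mult_mono) auto
        also have "\<dots> = d" using K by simp
        finally show ?thesis .
      qed
      then have "?t * (?t * K) \<le> ?t * d" using t by (intro mult_left_mono) auto
      ultimately show ?thesis by (simp only: power2_eq_square mult.assoc)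
    qed
    then have "(1 + (e * ?t)\<^sup>2 * K) * norm x \<le> (1 + ?t * d) * norm x" by (intro mult_right_mono) auto
    finally show "norm (x + (e * ?t) *\<^sub>R ?v) \<le> (1 + ?t * d) * norm x" .
  qed
  have "norm x \<le> norm (x + s *\<^sub>R ?v)" if "0 \<le> s"
    using small[of _ "-1"] that by (intro norm_expansive) simp_all
  moreover have "norm x \<le> norm (x + (- s) *\<^sub>R (- ?v))" if "s \<le> 0"
    using small[of _ 1] that by (intro norm_expansive) simp_all
  ultimately show ?thesis by (cases "0 \<le> s") auto
qed

text \<open>With \<open>D\<close> equal to \<i> times the multiplication by \<open>y\<close> and
  \<open>r = sqrt s\<close>, the operator \<open>(1 + r D) (1 - r D)\<close> is 1 plus
  \<open>s\<close> times the square of that multiplication, and both factors are expansive.\<close>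

lemma hermitian_square_expansive:
  assumes y: "y \<in> SB" and v: "snd v = 0" and s: "0 \<le> s"
  shows "norm v \<le> norm (v + s *\<^sub>R (y \<odot> (y \<odot> v)))"
proof -
  obtain x where vx: "v = (x, 0)" using v by (metis prod.collapse)
  define H where "H x = jprod (fst y) x + snd y *\<^sub>R x" for x
  define D where "D x = scaleC \<i> (H x)" for x
  let ?t = "sqrt s"
  have sR: "scaleC c (r *\<^sub>R x) = r *\<^sub>R scaleC c x" for c r x
    unfolding scaleC_of_real[symmetric] by (simp add: mult.commute)
  have lin: "H (x - r *\<^sub>R y) = H x - r *\<^sub>R H y" "H (scaleC c x) = scaleC c (H x)" for x y r c
    by (simp_all add: H_def A.bilin jprod_scaleC_right sR scale_right_distrib algebra_simps)
  have DD: "D (D x) = - H (H x)" by (simp add: D_def lin)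
  have Dl: "D (x - r *\<^sub>R y) = D x - r *\<^sub>R D y" for x y r
    by (simp add: D_def lin sR scale_right_diff_distrib)
  have "norm x \<le> norm (x - ?t *\<^sub>R D x)"
    using hermitian_expansive[OF y, of x "- ?t"] by (simp add: D_def H_def)
  also have "\<dots> \<le> norm ((x - ?t *\<^sub>R D x) + ?t *\<^sub>R D (x - ?t *\<^sub>R D x))"
    using hermitian_expansive[OF y, of "x - ?t *\<^sub>R D x" ?t] unfolding D_def H_def .
  also have "(x - ?t *\<^sub>R D x) + ?t *\<^sub>R D (x - ?t *\<^sub>R D x) = x + s *\<^sub>R H (H x)"
    using s by (simp add: Dl DD scaleR_diff_right scaleR_add_right)
  also have "norm \<dots> = norm (v + s *\<^sub>R (y \<odot> (y \<odot> v)))"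
    by (simp add: vx ujp_embed H_def)
  finally show ?thesis by (simp add: vx)
qed

lemma funpow_ujp_lin:
  "(((\<odot>) c) ^^ k) (u + v) = (((\<odot>) c) ^^ k) u + (((\<odot>) c) ^^ k) v"
  "(((\<odot>) c) ^^ k) (r *\<^sub>R u) = r *\<^sub>R (((\<odot>) c) ^^ k) u"
  by (induction k) (simp_all add: B.bilin)

text \<open>Expanding powers of multiplication by \<open>c\<close> into averages of \<open>U2 (c ^ i) (c ^ j)\<close> shows that
  they are uniformly bounded.\<close>

lemma power_bounded:
  assumes y: "y \<in> SB" and \<theta>: "0 \<le> \<theta>" "\<theta> * (rad y)\<^sup>2 \<le> 1"
  shows "norm ((((\<odot>) (un - \<theta> *\<^sub>R (y \<odot> y))) ^^ k) (x, 0)) \<le> 432 * norm x"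
proof -
  interpret C: commutative_subalgebra scaleC jprod star "gen y"
    by (rule commutative_subalgebra_gen) (rule assms)
  let ?c = "un - \<theta> *\<^sub>R (y \<odot> y)"
  define p where "p i = fc y (\<lambda>t. (1 - \<theta> * (t * t)) ^ i)" for i
  have cont: "continuous_on (intv y) (\<lambda>t. (1 - \<theta> * (t * t)) ^ i)" for i
    by (intro continuous_intros)
  have c: "?c = p 1"
  proof -
    have "fc y (\<lambda>t. 1 - \<theta> * (t * t)) = fc y (\<lambda>t. 1) - \<theta> *\<^sub>R (fc y (\<lambda>t. t) \<odot> fc y (\<lambda>t. t))"
      using fc_scale[OF y continuous_on_mult[OF continuous_on_id continuous_on_id], of \<theta>]
        fc_mult[OF y continuous_on_id continuous_on_id] y
      by (subst fc_diff) (auto intro!: continuous_intros)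
    then show ?thesis using y by (simp add: p_def fc_const fc_id)
  qed
  have pF: "p i \<in> gen y" for i unfolding p_def by (intro fc_in_gen y cont)
  have pS: "?c \<odot> p i = p (Suc i)" for i
    unfolding c using fc_mult[OF y cont cont, of 1 i] by (simp add: p_def)
  have pn: "norm (p i) \<le> 3" for i
  proof -
    have "\<bar>(1 - \<theta> * (t * t)) ^ i\<bar> \<le> 1" if "t \<in> intv y" for t
    proof -
      have "t * t \<le> (rad y)\<^sup>2" using that by (auto simp: power2_eq_square[symmetric] abs_le_square_iff[symmetric])
      then have "\<theta> * (t * t) \<le> 1" using \<theta> by (meson mult_left_mono order_trans)
      moreover have "0 \<le> \<theta> * (t * t)" using \<theta> by simp
      ultimately show ?thesis by (simp add: power_abs power_le_one)
    qed
    then show ?thesis using norm_fc_le[OF y cont, of i 1] by (simp add: p_def)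
  qed
  have main: "norm ((((\<odot>) ?c) ^^ k) (B.U2 (p i) (p j) (x, 0))) \<le> 432 * norm x" for i j
  proof (induction k arbitrary: i j)
    case 0
    \<comment> \<open>The constant 432 is 48 from \<open>norm_UB_le\<close> times the bound 3 for
      each of \<open>p i\<close> and \<open>p j\<close>.\<close>
    have "norm (B.U2 (p i) (p j) (x, 0)) \<le> 48 * (norm (p i) * norm (p j) * norm (x, 0::real))"
      by (rule norm_UB_le)
    also have "\<dots> \<le> 48 * (3 * 3 * norm x)"
      by (intro mult_left_mono mult_mono pn) simp_all
    finally show ?case by simp
  next
    case (Suc k)
    have "2 *\<^sub>R (?c \<odot> B.U2 (p i) (p j) (x, 0)) = B.U2 (p (Suc i)) (p j) (x, 0) + B.U2 (p i) (p (Suc j)) (x, 0)"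
      using C.F_jp_U2[OF pF pF, of ?c i j] pF[of 1] unfolding c[symmetric] pS by simp
    then have "2 *\<^sub>R (((\<odot>) ?c) ^^ k) (?c \<odot> B.U2 (p i) (p j) (x, 0))
        = (((\<odot>) ?c) ^^ k) (B.U2 (p (Suc i)) (p j) (x, 0)) + (((\<odot>) ?c) ^^ k) (B.U2 (p i) (p (Suc j)) (x, 0))"
      by (metis funpow_ujp_lin)
    then have "2 * norm ((((\<odot>) ?c) ^^ k) (?c \<odot> B.U2 (p i) (p j) (x, 0))) \<le> 432 * norm x + 432 * norm x"
      using norm_triangle_mono[OF Suc Suc] by (metis abs_numeral norm_scaleR)
    then show ?case by (simp add: funpow_swap1)
  qed
  have "p 0 = un" using y by (simp add: p_def fc_const)
  then show ?thesis using main[of 0 0] by (simp add: U_un)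
qed

text \<open>The hypothesis is convexity up to \<open>\<epsilon>\<close>: the sequence grows at least
  at its initial slope, so a bound on a late term limits the first increment.\<close>

lemma concave_growth:
  fixes n :: "nat \<Rightarrow> real"
  assumes "\<And>k. n (Suc (Suc k)) + n k \<ge> 2 * n (Suc k) - \<epsilon>" "0 \<le> \<epsilon>"
  shows "n m \<ge> n 0 + real m * (n 1 - n 0) - (real m)\<^sup>2 * \<epsilon>"
proof -
  have d: "n (Suc k) - n k \<ge> n 1 - n 0 - real k * \<epsilon>" for k
  proof (induction k)
    case (Suc k)
    then show ?case using assms(1)[of k] by (simp add: algebra_simps)
  qed simp
  show ?thesis
  proof (induction m)
    case (Suc m)
    have "n (Suc m) \<ge> n 0 + real m * (n 1 - n 0) - (real m)\<^sup>2 * \<epsilon> + (n 1 - n 0 - real m * \<epsilon>)"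
      using Suc d[of m] by linarith
    moreover have "((real m)\<^sup>2 + real m) * \<epsilon> \<le> (real (Suc m))\<^sup>2 * \<epsilon>"
      by (intro mult_right_mono assms) (simp add: power2_eq_square algebra_simps)
    ultimately show ?case by (simp add: algebra_simps)
  qed simp
qed

text \<open>Let \<open>L\<close> be the multiplication by \<open>q = y \<odot> y\<close>. The norms
  of \<open>w k = (1 - \<theta> L) ^ k x\<close> are bounded uniformly in \<open>k\<close> by
  \<open>power_bounded\<close>, and are convex up to order \<open>\<theta> ^ 3\<close> by
  \<open>hermitian_square_expansive\<close> for \<open>q\<close>. Hence the first step can increase
  the norm only by \<open>o(\<theta>)\<close>.\<close>

lemma accretive_square:
  assumes y: "y \<in> SB"
  shows "accretive (y \<odot> y)"
proof (rule accretiveI)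
  fix d :: real assume d: "0 < d"
  define q where "q = y \<odot> y"
  define \<kappa> where "\<kappa> = norm (fst q) + \<bar>snd q\<bar>"
  have \<kappa>: "0 \<le> \<kappa>" by (simp add: \<kappa>_def)
  have q: "q \<in> SB" by (simp add: q_def SB_mult y)
  have qb: "norm (q \<odot> v) \<le> \<kappa> * norm v" if "snd v = 0" for v
    using act_bound[of q "fst v"] that by (metis \<kappa>_def norm_embed prod.collapse)
  \<comment> \<open>The term \<open>rad y\<close> secures the hypothesis of
    \<open>power_bounded\<close> for \<open>\<theta> = 1 / j\<^sup>2\<close>; the term with
    \<open>d\<close> is what the last comparison requires.\<close>
  obtain j :: nat where j: "432 * (1 + \<kappa> ^ 3) / d + \<bar>rad y\<bar> + 1 < real j"
    using reals_Archimedean2 by blast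
  have "0 \<le> 432 * (1 + \<kappa> ^ 3) / d" using d \<kappa> by simp
  with j have j1: "1 < real j" and jr: "\<bar>rad y\<bar> < real j" and jd: "432 * (1 + \<kappa> ^ 3) / d < real j"
    by linarith+
  define \<theta> where "\<theta> = 1 / (real j)\<^sup>2"
  have \<theta>: "0 < \<theta>" using j1 by (simp add: \<theta>_def)
  have \<theta>r: "\<theta> * (rad y)\<^sup>2 \<le> 1"
  proof -
    have "(rad y)\<^sup>2 \<le> (real j)\<^sup>2" using jr by (simp add: abs_le_square_iff[symmetric])
    then show ?thesis using j1 by (simp add: \<theta>_def)
  qed
  have "norm ((x, 0) - \<theta> *\<^sub>R (q \<odot> (x, 0))) \<le> (1 + \<theta> * d) * norm x" for x
  proof -
    define w where "w k = (((\<odot>) (un - \<theta> *\<^sub>R q)) ^^ k) (x, 0)" for k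
    have w0: "w 0 = (x, 0)" by (simp add: w_def)
    have wS: "w (Suc k) = w k - \<theta> *\<^sub>R (q \<odot> w k)" for k
      by (simp add: w_def B.bilin B.unit)
    have ws: "snd (w k) = 0" for k by (induction k) (simp_all add: w0 wS)
    have wn: "norm (w k) \<le> 432 * norm x" for k
      unfolding w_def q_def using y \<theta> \<theta>r by (intro power_bounded) auto
    define \<epsilon> where "\<epsilon> = \<theta> ^ 3 * (\<kappa> ^ 3 * (432 * norm x))"
    have \<epsilon>: "0 \<le> \<epsilon>" using \<theta> \<kappa> by (simp add: \<epsilon>_def)
    have conv: "norm (w (Suc (Suc k))) + norm (w k) \<ge> 2 * norm (w (Suc k)) - \<epsilon>" for k
    proof -
      let ?H = "\<lambda>v. q \<odot> v"
      have "w (Suc (Suc k)) + w k = 2 *\<^sub>R w (Suc k) + (\<theta> * \<theta>) *\<^sub>R ?H (?H (w k))"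
      proof -
        have "(2 * \<theta>) *\<^sub>R v = \<theta> *\<^sub>R v + \<theta> *\<^sub>R v" for v :: "'a \<times> real"
          by (metis mult_2 scaleR_add_left)
        then show ?thesis by (simp add: wS scaleR_2 B.bilin scaleR_diff_right)
      qed
      also have "(\<theta> * \<theta>) *\<^sub>R ?H (?H (w k)) = (\<theta> * \<theta>) *\<^sub>R ?H (?H (w (Suc k))) + \<theta> ^ 3 *\<^sub>R ?H (?H (?H (w k)))"
        by (simp add: wS B.bilin scaleR_diff_right power3_eq_cube)
      finally have e: "w (Suc (Suc k)) + w k
        = 2 *\<^sub>R (w (Suc k) + (\<theta> * \<theta> / 2) *\<^sub>R ?H (?H (w (Suc k)))) + \<theta> ^ 3 *\<^sub>R ?H (?H (?H (w k)))"
        by (simp add: scaleR_add_right)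
      have h: "norm (w (Suc k)) \<le> norm (w (Suc k) + (\<theta> * \<theta> / 2) *\<^sub>R ?H (?H (w (Suc k))))"
        using \<theta> by (intro hermitian_square_expansive q ws) simp
      have "norm (?H (?H (?H (w k)))) \<le> \<kappa> * (\<kappa> * (\<kappa> * norm (w k)))"
        using \<kappa> by (intro order_trans[OF qb] mult_left_mono) (simp_all add: ws)
      also have "\<dots> \<le> \<kappa> * (\<kappa> * (\<kappa> * (432 * norm x)))"
        by (intro mult_left_mono wn \<kappa>)
      finally have "norm (\<theta> ^ 3 *\<^sub>R ?H (?H (?H (w k)))) \<le> \<epsilon>"
        using \<theta> by (simp add: \<epsilon>_def power3_eq_cube mult.assoc)
      moreover have "norm (2 *\<^sub>R (w (Suc k) + (\<theta> * \<theta> / 2) *\<^sub>R ?H (?H (w (Suc k)))))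
          \<le> norm (w (Suc (Suc k)) + w k) + norm (\<theta> ^ 3 *\<^sub>R ?H (?H (?H (w k))))"
        unfolding e by (metis add_diff_cancel_right' norm_triangle_ineq4)
      moreover have "norm (w (Suc (Suc k)) + w k) \<le> norm (w (Suc (Suc k))) + norm (w k)"
        by (rule norm_triangle_ineq)
      ultimately show ?thesis using h by (simp only: norm_scaleR abs_numeral)
    qed
    \<comment> \<open>This balances the two errors: \<open>m\<^sup>2 * \<theta> ^ 3 = 1\<close>, so
      the first increment is of order \<open>1 / j ^ 3\<close>, which is small against
      \<open>\<theta> * d = d / j\<^sup>2\<close>.\<close>
    define m where "m = j ^ 3"
    have m: "0 < real m" using j1 by (simp add: m_def)
    let ?\<delta> = "norm (w 1) - norm (w 0)"
    have "real m * ?\<delta> \<le> 432 * norm x + (real m)\<^sup>2 * \<epsilon>"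
      using concave_growth[of "\<lambda>k. norm (w k)", OF conv \<epsilon>, of m] wn[of m] norm_ge_zero[of "w 0"] by linarith
    also have "(real m)\<^sup>2 * \<epsilon> = \<kappa> ^ 3 * (432 * norm x)"
      using j1 by (simp add: \<epsilon>_def m_def \<theta>_def power_mult[symmetric] field_simps)
    also have "432 * norm x + \<kappa> ^ 3 * (432 * norm x) = 432 * (1 + \<kappa> ^ 3) * norm x"
      by (simp add: algebra_simps)
    also have "\<dots> \<le> (d * real j) * norm x"
      using jd d by (intro mult_right_mono) (auto simp: divide_less_eq mult.commute)
    also have "d * real j = real m * (\<theta> * d)"
      using j1 by (simp add: m_def \<theta>_def power2_eq_square power3_eq_cube)
    finally have "real m * ?\<delta> \<le> real m * (\<theta> * d * norm x)" by (simp only: mult.assoc)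
    then have "?\<delta> \<le> \<theta> * d * norm x" using m by simp
    then show ?thesis by (simp add: w0 wS algebra_simps)
  qed
  then show "\<exists>t>0. \<forall>x. norm ((x, 0) - t *\<^sub>R (y \<odot> y \<odot> (x, 0))) \<le> (1 + t * d) * norm x"
    using \<theta> unfolding q_def by blast
qed

end

section \<open>Positive elements\<close>

context jb_star_algebra
begin

text \<open>Accretivity does not control the scalar part: if the algebra has a unit
  \<open>u\<close>, then \<open>(u, -1)\<close> acts as zero on it. Hence the separate condition on
  \<open>snd\<close>.\<close>

definition pos :: "'a \<times> real \<Rightarrow> bool"
  where "pos y \<longleftrightarrow> y \<in> SB \<and> 0 \<le> snd y \<and> accretive y"

lemma pos_SB: "pos y \<Longrightarrow> y \<in> SB" and pos_snd: "pos y \<Longrightarrow> 0 \<le> snd y"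
  by (simp_all add: pos_def)

lemma pos_add: "pos y \<Longrightarrow> pos z \<Longrightarrow> pos (y + z)"
  by (simp add: pos_def SB_add accretive_add)

lemma pos_scale: "pos y \<Longrightarrow> 0 \<le> r \<Longrightarrow> pos (r *\<^sub>R y)"
  by (simp add: pos_def SB_scale accretive_scale)

lemma pos_square: "y \<in> SB \<Longrightarrow> pos (y \<odot> y)"
  by (simp add: pos_def SB_mult accretive_square)

lemma pos_un_diff: "y \<in> SB \<Longrightarrow> snd y \<le> c \<Longrightarrow> (\<And>x. norm (y \<odot> (x, 0)) \<le> c * norm x) \<Longrightarrow> pos (c *\<^sub>R un - y)"
  by (simp add: pos_def SB_diff SB_scale accretive_un_diff)

lemma pos_un: "0 \<le> c \<Longrightarrow> pos (c *\<^sub>R un)"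
  using pos_un_diff[of 0 c] by (simp add: SB_zero B.bilin)

lemma pos_zero: "pos 0" using pos_un[of 0] by simp

lemma pos_norm_diff:
  assumes y: "y \<in> SB" and c: "norm (fst y) + \<bar>snd y\<bar> \<le> c"
  shows "pos (c *\<^sub>R un - y)"
proof (rule pos_un_diff[OF y])
  show "snd y \<le> c" using c norm_ge_zero[of "fst y"] by linarith
  show "norm (y \<odot> (x, 0)) \<le> c * norm x" for x
    by (rule order_trans[OF act_bound mult_right_mono[OF c]]) simp
qed

lemma pos_LIMSEQ:
  assumes "\<And>n. pos (y n)" "y \<longlonglongrightarrow> z"
  shows "pos z"
proof -
  have "z \<in> SB" using closed_sequentially[OF closed_SB] assms pos_SB by blast
  moreover have "0 \<le> snd z"
    using LIMSEQ_le_const[OF tendsto_snd[OF assms(2)]] pos_snd[OF assms(1)] by blast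
  moreover have "accretive z"
    using assms accretive_LIMSEQ[of y z] by (simp add: pos_def)
  ultimately show ?thesis by (simp add: pos_def)
qed

lemma pos_epsilon:
  assumes "\<And>e. 0 < e \<Longrightarrow> pos (y + e *\<^sub>R z)"
  shows "pos y"
proof (rule pos_LIMSEQ)
  show "pos (y + inverse (real (Suc n)) *\<^sub>R z)" for n by (rule assms) simp
  show "(\<lambda>n. y + inverse (real (Suc n)) *\<^sub>R z) \<longlonglongrightarrow> y"
    using tendsto_add[OF tendsto_const tendsto_scaleR[OF LIMSEQ_inverse_real_of_nat tendsto_const], of y z]
    by simp
qed

lemma pos_fcI:
  assumes y: "y \<in> SB" and f: "continuous_on (intv y) f" and 0: "\<And>t. t \<in> intv y \<Longrightarrow> 0 \<le> f t"
  shows "pos (fc y f)"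
proof -
  have c: "continuous_on (intv y) (\<lambda>t. sqrt (f t))" by (intro continuous_intros f)
  have "fc y f = fc y (\<lambda>t. sqrt (f t) * sqrt (f t))" by (rule fc_cong) (simp add: 0)
  also have "\<dots> = fc y (\<lambda>t. sqrt (f t)) \<odot> fc y (\<lambda>t. sqrt (f t))" by (rule fc_mult[OF y c c])
  finally show ?thesis using pos_square[OF fc_SB[OF y c]] by simp
qed

lemma bernoulli_decay:
  fixes u :: real
  assumes "0 \<le> u" "u \<le> 1"
  shows "real k * (u * (1 - u) ^ k) \<le> 1"
proof -
  have "1 + real k * u \<le> (1 + u) ^ k"
    using assms by (intro Bernoulli_inequality) simp
  then have "(1 + real k * u) * (1 - u) ^ k \<le> (1 + u) ^ k * (1 - u) ^ k"
    using assms by (intro mult_right_mono) auto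
  also have "\<dots> = (1 - u * u) ^ k"
    by (simp add: power_mult_distrib[symmetric] algebra_simps)
  also have "\<dots> \<le> 1" using assms by (intro power_le_one) (auto simp: mult_le_one)
  finally have "(1 - u) ^ k + real k * (u * (1 - u) ^ k) \<le> 1" by (simp add: algebra_simps)
  moreover have "0 \<le> (1 - u) ^ k" using assms by simp
  ultimately show ?thesis by linarith
qed

text \<open>If \<open>n\<close> is the negative part of a positive element, accretivity makes multiplication by
  \<open>un - n / R\<close> norm-increasing on the multiples of \<open>n\<close>, while \<open>(un - n / R) ^ k \<odot> n\<close> tends to zero.\<close>

lemma pos_fc_neg_part:
  assumes y: "y \<in> SB" and f: "continuous_on (intv y) f" and p: "pos (fc y f)"
  shows "fc y (\<lambda>t. max (- f t) 0) = 0"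
proof -
  obtain R where R: "0 < R" "\<And>t. t \<in> intv y \<Longrightarrow> \<bar>f t\<bar> \<le> R"
    using compact_imp_bounded[OF compact_continuous_image[OF f compact_Icc]]
    unfolding bounded_pos by (metis image_eqI real_norm_def)
  define n where "n t = max (- f t) 0" for t
  have n: "0 \<le> n t" "n t \<le> R" "f t * n t = - (n t * n t)" if "t \<in> intv y" for t
    using R(1) R(2)[OF that] by (auto simp: n_def max_def)
  define m where "m k = fc y (\<lambda>t. n t * (1 - n t / R) ^ k)" for k
  have cn: "continuous_on (intv y) n" unfolding n_def by (intro continuous_intros f)
  have cm: "continuous_on (intv y) (\<lambda>t. n t * (1 - n t / R) ^ k)" for k
    using R(1) by (intro continuous_intros cn) auto
  have f0: "0 \<le> f (snd y)" using pos_snd[OF p] snd_fc[OF y f] by simp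
  then have n0: "n (snd y) = 0" by (simp add: n_def)
  have sm: "snd (m k) = 0" for k unfolding m_def using snd_fc[OF y cm] n0 by simp
  \<comment> \<open>Since \<open>f t * n t = - (n t * n t)\<close>, multiplication by
    \<open>1 + f / R\<close> acts on multiples of \<open>n\<close> as
    \<open>1 - n / R\<close>.\<close>
  have step: "m k + (1/R) *\<^sub>R (fc y f \<odot> m k) = m (Suc k)" for k
  proof -
    have "m k + (1/R) *\<^sub>R (fc y f \<odot> m k) = fc y (\<lambda>t. n t * (1 - n t / R) ^ k + (1/R) * (f t * (n t * (1 - n t / R) ^ k)))"
      unfolding m_def fc_mult[OF y f cm, symmetric] fc_scale[OF y continuous_on_mult[OF f cm], symmetric]
      by (rule fc_add[symmetric, OF y cm]) (intro continuous_on_mult continuous_on_const f cm)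
    also have "\<dots> = m (Suc k)" unfolding m_def
    proof (rule fc_cong)
      fix t assume t: "t \<in> intv y"
      have "n t * (1 - n t / R) ^ k + (1/R) * (f t * (n t * (1 - n t / R) ^ k))
          = (n t + (1/R) * (f t * n t)) * (1 - n t / R) ^ k" by (simp add: algebra_simps)
      also have "\<dots> = n t * (1 - n t / R) ^ Suc k" unfolding n(3)[OF t] by (simp add: algebra_simps)
      finally show "n t * (1 - n t / R) ^ k + (1/R) * (f t * (n t * (1 - n t / R) ^ k)) = n t * (1 - n t / R) ^ Suc k" .
    qed
    finally show ?thesis .
  qed
  have inc: "norm (m k) \<le> norm (m (Suc k))" for k
  proof -
    obtain x where x: "m k = (x, 0)" using sm by (metis prod.collapse)
    have "norm x \<le> norm ((x, 0) + (1/R) *\<^sub>R (fc y f \<odot> (x, 0)))"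
      using p R(1) by (simp add: pos_def accretive_def)
    then show ?thesis unfolding step[of k, symmetric] x by simp
  qed
  have "norm (m 0) \<le> norm (m k)" for k
    by (induction k) (use inc order_trans in auto)
  moreover have "norm (m (Suc k)) \<le> R * inverse (real (Suc k))" for k
    unfolding m_def
  proof (rule norm_fc_le_ideal[OF y cm])
    fix t assume t: "t \<in> intv y"
    let ?u = "n t / R"
    have u: "0 \<le> ?u" "?u \<le> 1" using n[OF t] R(1) by auto
    have "real (Suc k) * (?u * (1 - ?u) ^ Suc k) \<le> 1" by (rule bernoulli_decay[OF u])
    then have "n t * (1 - ?u) ^ Suc k \<le> R * inverse (real (Suc k))"
      using R(1) by (simp add: field_simps)
    moreover have "0 \<le> n t * (1 - ?u) ^ Suc k" using n[OF t] u by simp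
    ultimately show "\<bar>n t * (1 - ?u) ^ Suc k\<bar> \<le> R * inverse (real (Suc k))" by linarith
  qed (simp add: n0)
  ultimately have "norm (m 0) \<le> R * inverse (real (Suc k))" for k using order_trans by blast
  moreover have "(\<lambda>k. R * inverse (real (Suc k))) \<longlonglongrightarrow> R * 0"
    by (intro tendsto_intros LIMSEQ_inverse_real_of_nat)
  ultimately have "norm (m 0) \<le> R * 0" by (intro LIMSEQ_le_const) auto
  then show ?thesis by (simp add: m_def n_def)
qed

lemma pos_fc_max:
  assumes y: "y \<in> SB" and f: "continuous_on (intv y) f" and p: "pos (fc y f)"
  shows "fc y f = fc y (\<lambda>t. max (f t) 0)"
proof -
  have "fc y f = fc y (\<lambda>t. max (f t) 0 - max (- f t) 0)" by (rule fc_cong) auto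
  also have "\<dots> = fc y (\<lambda>t. max (f t) 0) - fc y (\<lambda>t. max (- f t) 0)"
    by (intro fc_diff y continuous_intros f)
  finally show ?thesis using pos_fc_neg_part[OF assms] by simp
qed

text \<open>The parts of \<open>a\<close> above \<open>c\<close> and below \<open>- c\<close> vanish
  by \<open>pos_fc_neg_part\<close>, so \<open>a\<close> equals its truncation to
  \<open>[-c, c]\<close>, where the sharp bound of \<open>norm_fc_le_ideal\<close> applies.\<close>

lemma norm_le_of_pos:
  assumes a: "a \<in> SB" "snd a = 0" and c: "0 \<le> c" and p: "pos (c *\<^sub>R un - a)" "pos (c *\<^sub>R un + a)"
  shows "norm a \<le> c"
proof -
  have e1: "c *\<^sub>R un - a = fc a (\<lambda>t. c - t)"
    using fc_diff[OF a(1) continuous_on_const continuous_on_id, of c] a(1) by (simp add: fc_const fc_id)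
  have e2: "c *\<^sub>R un + a = fc a (\<lambda>t. c + t)"
    using fc_add[OF a(1) continuous_on_const continuous_on_id, of c] a(1) by (simp add: fc_const fc_id)
  have n1: "fc a (\<lambda>t. max (- (c - t)) 0) = 0"
    by (rule pos_fc_neg_part[OF a(1)]) (use p e1 in \<open>auto intro!: continuous_intros\<close>)
  have n2: "fc a (\<lambda>t. max (- (c + t)) 0) = 0"
    by (rule pos_fc_neg_part[OF a(1)]) (use p e2 in \<open>auto intro!: continuous_intros\<close>)
  let ?k = "\<lambda>t. max (- c) (min c t)"
  have "a = fc a (\<lambda>t. t)" using a by (simp add: fc_id)
  also have "\<dots> = fc a (\<lambda>t. (?k t + max (- (c - t)) 0) - max (- (c + t)) 0)"
    using c by (intro fc_cong) (auto simp: max_def min_def)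
  also have "\<dots> = fc a (\<lambda>t. ?k t + max (- (c - t)) 0) - fc a (\<lambda>t. max (- (c + t)) 0)"
    by (intro fc_diff a(1) continuous_intros)
  also have "fc a (\<lambda>t. ?k t + max (- (c - t)) 0) = fc a ?k + fc a (\<lambda>t. max (- (c - t)) 0)"
    by (intro fc_add a(1) continuous_intros)
  finally have "a = fc a ?k" using n1 n2 by simp
  moreover have "norm (fc a ?k) \<le> c"
    by (rule norm_fc_le_ideal[OF a(1)]) (use c a in \<open>auto intro!: continuous_intros\<close>)
  ultimately show ?thesis by simp
qed

text \<open>The function \<open>r = \<epsilon> / (\<epsilon> + y)\<close> is large only near 0, so
  \<open>r \<odot> y\<close> is small, and so is
  \<open>U y (r \<odot> x) = U2 (r \<odot> y) y x\<close>. As \<open>U y\<close> is bounded below,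
  \<open>r\<close> acts with norm at most 1/2, and \<open>r \<le> 1/2\<close> means
  \<open>y \<ge> \<epsilon>\<close>.\<close>

lemma pos_lower_bound:
  assumes y: "pos y" "0 < snd y" and K: "0 < K" "\<And>x. norm x \<le> K * norm (B.U y (x, 0))"
  shows "\<exists>\<epsilon>>0. pos (y - \<epsilon> *\<^sub>R un)"
proof -
  note yS = pos_SB[OF y(1)]
  interpret C: commutative_subalgebra scaleC jprod star "gen y"
    by (rule commutative_subalgebra_gen[OF yS])
  let ?m = "\<lambda>t::real. max t 0"
  have cmm: "continuous_on (intv y) ?m" by (intro continuous_intros)
  have ym: "y = fc y ?m"
    using pos_fc_max[OF yS continuous_on_id] y(1) fc_id[OF yS] by simp
  \<comment> \<open>The factor 144 is 48 from \<open>norm_UB_le\<close> times 3 from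
    \<open>ry\<close>; the second entry makes the final bound 1/2. The entry \<open>snd y\<close>
    gives the same bound for the scalar part of \<open>r\<close>.\<close>
  define \<epsilon> where "\<epsilon> = min (snd y) (inverse (K * (144 * (norm y + 1)) * 2))"
  have n0: "0 < norm y + 1" by (simp add: add_nonneg_pos)
  then have n1: "0 < K * (144 * (norm y + 1)) * 2" using K(1) by simp
  have \<epsilon>: "0 < \<epsilon>" using y(2) n1 unfolding \<epsilon>_def min_less_iff_conj by (metis positive_imp_inverse_positive)
  define k where "k t = \<epsilon> / (\<epsilon> + ?m t)" for t
  have ck: "continuous_on (intv y) k"
    unfolding k_def using \<epsilon> by (intro continuous_intros) (auto simp: max_def split: if_splits)
  let ?r = "fc y k"
  have rF: "?r \<in> gen y" by (rule fc_in_gen[OF yS ck])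
  have ry: "norm (?r \<odot> y) \<le> 3 * \<epsilon>"
  proof -
    have "?r \<odot> y = fc y (\<lambda>t. k t * ?m t)"
      using fc_mult[OF yS ck cmm] ym by simp
    also have "norm \<dots> \<le> 3 * \<epsilon>"
    proof (rule norm_fc_le[OF yS])
      fix t
      have "\<epsilon> * ?m t \<le> \<epsilon> * (\<epsilon> + ?m t)" using \<epsilon> by (intro mult_left_mono) auto
      moreover have "0 < \<epsilon> + ?m t" using \<epsilon> by (simp add: add_pos_nonneg)
      ultimately show "\<bar>k t * ?m t\<bar> \<le> \<epsilon>"
        using \<epsilon> by (simp add: k_def abs_mult abs_divide divide_le_eq mult.commute)
    qed (intro continuous_intros ck)
    finally show ?thesis .
  qed
  have rb: "norm (?r \<odot> (x, 0)) \<le> 1/2 * norm x" for x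
  proof -
    have "norm (?r \<odot> (x, 0)) \<le> K * norm (B.U y (?r \<odot> (x, 0)))"
      using K(2)[of "fst (?r \<odot> (x, 0))"] by (simp add: ujp_embed)
    also have "B.U y (?r \<odot> (x, 0)) = B.U2 (?r \<odot> y) y (x, 0)"
      using C.F_jp_U[OF rF gen_self] by simp
    also have "norm \<dots> \<le> 48 * (norm (?r \<odot> y) * norm y * norm (x, 0::real))"
      by (rule norm_UB_le)
    also have "\<dots> \<le> 48 * ((3 * \<epsilon>) * (norm y + 1) * norm x)"
      using \<epsilon> by (intro mult_left_mono mult_mono ry) auto
    finally have "norm (?r \<odot> (x, 0)) \<le> (K * (144 * (norm y + 1)) * \<epsilon>) * norm x"
      using K(1) by (simp add: mult_left_mono algebra_simps)
    also have "K * (144 * (norm y + 1)) * \<epsilon> \<le> K * (144 * (norm y + 1)) * inverse (K * (144 * (norm y + 1)) * 2)"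
      using K(1) n0 by (intro mult_left_mono) (auto simp: \<epsilon>_def)
    also have "\<dots> = 1/2"
    proof -
      have "L * inverse (L * 2) = 1/2" if "0 < L" for L :: real using that by (simp add: field_simps)
      moreover have "0 < K * (144 * (norm y + 1))" using n1 by simp
      ultimately show ?thesis by blast
    qed
    finally show ?thesis by (simp add: mult_right_mono)
  qed
  have "pos ((1/2) *\<^sub>R un - ?r)"
  proof (rule pos_un_diff[OF fc_SB[OF yS ck] _ rb])
    have "\<epsilon> \<le> snd y" by (simp add: \<epsilon>_def)
    then have "k (snd y) \<le> 1/2" using \<epsilon> by (simp add: k_def max_def divide_le_eq)
    then show "snd ?r \<le> 1/2" using snd_fc[OF yS ck] by simp
  qed
  also have "(1/2) *\<^sub>R un - ?r = fc y (\<lambda>t. 1/2 - k t)"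
    using fc_diff[OF yS continuous_on_const ck] by (simp add: fc_const yS)
  finally have neg: "fc y (\<lambda>t. max (- (1/2 - k t)) 0) = 0"
    by (intro pos_fc_neg_part yS continuous_intros ck)
  \<comment> \<open>This weight clears the denominator:
    \<open>(1/2 - k t) * ?w t = ?m t - \<epsilon>\<close>.\<close>
  let ?w = "\<lambda>t. 2 * (\<epsilon> + ?m t)"
  have cw: "continuous_on (intv y) ?w" by (intro continuous_intros)
  have cp: "continuous_on (intv y) (\<lambda>t. max (1/2 - k t) 0)" and cq: "continuous_on (intv y) (\<lambda>t. max (- (1/2 - k t)) 0)"
    by (intro continuous_intros ck)+
  have "y - \<epsilon> *\<^sub>R un = fc y (\<lambda>t. ?m t - \<epsilon>)"
    using fc_diff[OF yS cmm continuous_on_const, of \<epsilon>] ym by (simp add: fc_const yS)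
  also have "\<dots> = fc y (\<lambda>t. max (1/2 - k t) 0 * ?w t - max (- (1/2 - k t)) 0 * ?w t)"
  proof (rule fc_cong)
    fix t
    have "max (1/2 - k t) 0 * ?w t - max (- (1/2 - k t)) 0 * ?w t = (max (1/2 - k t) 0 - max (- (1/2 - k t)) 0) * ?w t"
      by (simp only: left_diff_distrib)
    also have "max (1/2 - k t) 0 - max (- (1/2 - k t)) 0 = 1/2 - k t" by auto
    also have "(1/2 - k t) * ?w t = ?m t - \<epsilon>"
    proof -
      have "0 < \<epsilon> + ?m t" using \<epsilon> by (simp add: add_pos_nonneg)
      then show ?thesis unfolding k_def by (simp add: field_simps)
    qed
    finally show "?m t - \<epsilon> = max (1/2 - k t) 0 * ?w t - max (- (1/2 - k t)) 0 * ?w t" ..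
  qed
  also have "\<dots> = fc y (\<lambda>t. max (1/2 - k t) 0 * ?w t) - fc y (\<lambda>t. max (- (1/2 - k t)) 0) \<odot> fc y ?w"
    using fc_diff[OF yS continuous_on_mult[OF cp cw] continuous_on_mult[OF cq cw]] fc_mult[OF yS cq cw] by simp
  also have "\<dots> = fc y (\<lambda>t. max (1/2 - k t) 0 * ?w t)"
    unfolding neg by (simp add: B.bilin)
  finally have "y - \<epsilon> *\<^sub>R un = fc y (\<lambda>t. max (1/2 - k t) 0 * ?w t)" .
  moreover have "pos \<dots>"
    by (rule pos_fcI[OF yS continuous_on_mult[OF cp cw]]) (use \<epsilon> in simp)
  ultimately show ?thesis using \<epsilon> by auto
qed

text \<open>A continuity argument: the shifts \<open>r \<ge> 0\<close> with
  \<open>x + r *\<^sub>R un\<close> positive form a nonempty closed set, and by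
  \<open>pos_lower_bound\<close> its least element cannot be positive.\<close>

lemma pos_if_shifts_bounded_below:
  assumes x: "x \<in> SB" "0 \<le> snd x"
    and K: "\<And>r. 0 < r \<Longrightarrow> \<exists>K>0. \<forall>v. norm v \<le> K * norm (B.U (x + r *\<^sub>R un) (v, 0))"
  shows "pos x"
proof -
  define T where "T = {r. 0 \<le> r \<and> pos (x + r *\<^sub>R un)}"
  let ?c = "norm (fst x) + \<bar>snd x\<bar>"
  have "pos (?c *\<^sub>R un - (-1) *\<^sub>R x)"
    by (rule pos_norm_diff[OF SB_scale[OF x(1)]]) simp
  then have "?c \<in> T" by (simp add: T_def add.commute)
  then have ne: "T \<noteq> {}" by blast
  have bb: "bdd_below T" unfolding T_def by (rule bdd_belowI[of _ 0]) simp
  have cl: "closed T"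
  proof (rule closed_sequential_limits[THEN iffD2], intro allI impI)
    fix r l assume r: "(\<forall>n. r n \<in> T) \<and> r \<longlonglongrightarrow> l"
    have "pos (x + l *\<^sub>R un)"
      by (rule pos_LIMSEQ[of "\<lambda>n. x + r n *\<^sub>R un"]) (use r in \<open>auto simp: T_def intro!: tendsto_intros\<close>)
    moreover have "0 \<le> l" using r LIMSEQ_le_const[of r l 0] by (auto simp: T_def)
    ultimately show "l \<in> T" by (simp add: T_def)
  qed
  define s where "s = Inf T"
  have sT: "s \<in> T" unfolding s_def by (rule closed_contains_Inf[OF ne bb cl])
  have "s = 0"
  proof (rule ccontr)
    assume "s \<noteq> 0"
    then have s: "0 < s" "pos (x + s *\<^sub>R un)" using sT by (auto simp: T_def)
    obtain K' where K': "0 < K'" "\<And>v. norm v \<le> K' * norm (B.U (x + s *\<^sub>R un) (v, 0))"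
      using K[OF s(1)] by blast
    obtain e where e: "0 < e" "pos (x + s *\<^sub>R un - e *\<^sub>R un)"
      using pos_lower_bound[OF s(2) _ K'] x s by auto
    have "pos ((x + s *\<^sub>R un - e *\<^sub>R un) + (e - min e s) *\<^sub>R un)"
      by (intro pos_add e pos_un) simp
    then have "pos (x + (s - min e s) *\<^sub>R un)" by (simp add: algebra_simps)
    then have "s - min e s \<in> T" by (simp add: T_def)
    then have "s \<le> s - min e s" unfolding s_def by (rule cInf_lower[OF _ bb])
    then show False using e s by simp
  qed
  then show ?thesis using sT by (simp add: T_def)
qed

text \<open>The calculus lives on an interval containing 0, where neither the inverse nor the square
  root of \<open>t\<close> is available. Replacing \<open>t\<close> by \<open>max t \<delta>\<close>
  repairs this without changing \<open>z\<close>.\<close>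

lemma pos_ge_fc:
  assumes "pos (z - \<delta> *\<^sub>R un)" "z \<in> SB"
  shows "z = fc z (\<lambda>t. max t \<delta>)"
proof -
  have "z - \<delta> *\<^sub>R un = fc z (\<lambda>t. t - \<delta>)"
    using fc_diff[OF assms(2) continuous_on_id continuous_on_const, of \<delta>] assms(2) by (simp add: fc_id fc_const)
  then have "z - \<delta> *\<^sub>R un = fc z (\<lambda>t. max (t - \<delta>) 0)"
    using pos_fc_max[OF assms(2), of "\<lambda>t. t - \<delta>"] assms(1) by (simp add: continuous_intros)
  also have "\<dots> = fc z (\<lambda>t. max t \<delta> - \<delta>)" by (rule fc_cong) auto
  also have "\<dots> = fc z (\<lambda>t. max t \<delta>) - \<delta> *\<^sub>R un"
    using fc_diff[OF assms(2) _ continuous_on_const, of "\<lambda>t. max t \<delta>" \<delta>] assms(2)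
    by (simp add: fc_const continuous_intros)
  finally show ?thesis by simp
qed

lemma U_inverse:
  assumes "z \<in> SB" "z = fc z f" "continuous_on (intv z) f" "\<And>t. t \<in> intv z \<Longrightarrow> 0 < f t"
  shows "B.U (fc z (\<lambda>t. 1 / f t)) (B.U z v) = v" "B.U z (B.U (fc z (\<lambda>t. 1 / f t)) v) = v"
proof -
  have c: "continuous_on (intv z) (\<lambda>t. 1 / f t)"
    by (intro continuous_intros assms(3)) (use assms(4) in force)
  have "fc z (\<lambda>t. 1 / f t * f t) = fc z (\<lambda>t. 1)" "fc z (\<lambda>t. f t * (1 / f t)) = fc z (\<lambda>t. 1)"
    by (rule fc_cong, use assms(4) in force)+
  then show "B.U (fc z (\<lambda>t. 1 / f t)) (B.U z v) = v" "B.U z (B.U (fc z (\<lambda>t. 1 / f t)) v) = v"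
    using U_fc_fc[OF assms(1) c assms(3), of v] U_fc_fc[OF assms(1) assms(3) c, of v] assms(1,2)
    by (simp_all add: fc_const U_un)
qed

text \<open>With \<open>w\<close> the inverse of \<open>c\<close>,
  \<open>U c p + r *\<^sub>R un = U c z\<close> for \<open>z = p + r w\<^sup>2\<close>, which is
  bounded below by a multiple of \<open>un\<close>. The fundamental formula then writes the
  \<open>U\<close> operator of this shift as a product of three invertible ones.\<close>

lemma pos_U_of_ge:
  assumes c: "pos (c - \<delta> *\<^sub>R un)" "c \<in> SB" "0 < \<delta>" and p: "pos p"
  shows "pos (B.U c p)"
proof (rule pos_if_shifts_bounded_below)
  have pS: "p \<in> SB" using p by (rule pos_SB)
  show "B.U c p \<in> SB" by (intro SB_U2 c pS)
  show "0 \<le> snd (B.U c p)" using pos_snd[OF p]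
    by (simp add: B.U2_def mult.assoc[symmetric])
  let ?f = "\<lambda>t. max t \<delta>"
  have f: "continuous_on (intv z) ?f" for z by (intro continuous_intros)
  define w where "w = fc c (\<lambda>t. 1 / ?f t)"
  have ci: "continuous_on (intv c) (\<lambda>t. 1 / ?f t)"
    by (intro continuous_intros) (use c(3) in auto)
  have wS: "w \<in> SB" unfolding w_def by (rule fc_SB[OF c(2) ci])
  have inv: "B.U w (B.U c v) = v" "B.U c (B.U w v) = v" for v
    unfolding w_def by (rule U_inverse[OF c(2) pos_ge_fc[OF c(1,2)] f], use c(3) in simp)+
  let ?M = "max (rad c) \<delta>"
  have M: "0 < ?M" using c(3) by simp
  have wl: "pos (w \<odot> w - (1 / (?M * ?M)) *\<^sub>R un)"
  proof -
    have "w \<odot> w - (1 / (?M * ?M)) *\<^sub>R un = fc c (\<lambda>t. 1 / ?f t * (1 / ?f t) - 1 / (?M * ?M))"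
      using fc_mult[OF c(2) ci ci] fc_diff[OF c(2) continuous_on_mult[OF ci ci] continuous_on_const, of "1 / (?M * ?M)"]
      by (simp add: w_def fc_const c(2))
    also have "pos \<dots>"
    proof (rule pos_fcI[OF c(2)])
      fix t assume "t \<in> intv c"
      then have "?f t \<le> ?M" by auto
      then have "?f t * ?f t \<le> ?M * ?M" using c(3) by (intro mult_mono) auto
      then show "0 \<le> 1 / ?f t * (1 / ?f t) - 1 / (?M * ?M)"
        using c(3) by (simp add: frac_le)
    qed (intro continuous_intros continuous_on_mult ci)
    finally show ?thesis .
  qed
  fix r :: real assume r: "0 < r"
  define z where "z = p + r *\<^sub>R (w \<odot> w)"
  define \<eta> where "\<eta> = r / (?M * ?M)"
  have \<eta>: "0 < \<eta>" using r M by (simp add: \<eta>_def)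
  have zS: "z \<in> SB" unfolding z_def by (intro SB_add SB_scale SB_mult pS wS)
  have "pos (p + r *\<^sub>R (w \<odot> w - (1 / (?M * ?M)) *\<^sub>R un))"
    by (intro pos_add p pos_scale wl) (use r in simp)
  then have "pos (z - \<eta> *\<^sub>R un)" by (simp add: z_def \<eta>_def scaleR_diff_right add_diff_eq)
  define u where "u = fc z (\<lambda>t. 1 / max t \<eta>)"
  have uz: "B.U u (B.U z v) = v" for v
    unfolding u_def
    by (rule U_inverse(1)[OF zS pos_ge_fc[OF \<open>pos (z - \<eta> *\<^sub>R un)\<close> zS]]) (use \<eta> in \<open>auto intro!: continuous_intros\<close>)
  have e: "B.U c p + r *\<^sub>R un = B.U c z"
    unfolding z_def B.U_add B.U_scale using inv(2)[of un] by (simp add: U_apply_un)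
  have recover: "v = B.U w (B.U u (B.U w (B.U (B.U c p + r *\<^sub>R un) v)))" for v
    unfolding e B.fundamental_formula by (simp add: inv uz)
  define K where "K = 48 * (norm w * norm w) * (48 * (norm u * norm u) * (48 * (norm w * norm w))) + 1"
  have U1: "norm (B.U a v) \<le> 48 * (norm a * norm a) * norm v" for a v
    using norm_UB_le[of a a v] by (simp add: mult_ac)
  have "norm v \<le> K * norm (B.U (B.U c p + r *\<^sub>R un) v)" for v
  proof -
    let ?v = "B.U (B.U c p + r *\<^sub>R un) v"
    have "norm v \<le> 48 * (norm w * norm w) * norm (B.U u (B.U w ?v))"
      by (subst recover) (rule U1)
    also have "\<dots> \<le> 48 * (norm w * norm w) * (48 * (norm u * norm u) * norm (B.U w ?v))"
      by (intro mult_left_mono U1) simp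
    also have "\<dots> \<le> 48 * (norm w * norm w) * (48 * (norm u * norm u) * (48 * (norm w * norm w) * norm ?v))"
      by (intro mult_left_mono U1) simp_all
    also have "\<dots> \<le> K * norm ?v" by (simp add: K_def algebra_simps)
    finally show ?thesis .
  qed
  from this[of "(_, 0)"] have "norm v \<le> K * norm (B.U (B.U c p + r *\<^sub>R un) (v, 0))" for v by simp
  moreover have "0 < K" unfolding K_def by (intro add_nonneg_pos mult_nonneg_nonneg) auto
  ultimately show "\<exists>K>0. \<forall>v. norm v \<le> K * norm (B.U (B.U c p + r *\<^sub>R un) (v, 0))" by blast
qed

text \<open>Writing \<open>p + e\<close> as a square \<open>c \<odot> c\<close> with \<open>c\<close> invertible, the fundamental formula gives
  \<open>U a (c \<odot> c) = U (inverse c) (U c a \<odot> U c a)\<close>.\<close>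

theorem pos_U:
  assumes a: "a \<in> SB" and p: "pos p"
  shows "pos (B.U a p)"
proof (rule pos_epsilon)
  fix e :: real assume e: "0 < e"
  define z where "z = p + e *\<^sub>R un"
  have pS: "p \<in> SB" using p by (rule pos_SB)
  have zS: "z \<in> SB" by (simp add: z_def SB_add SB_scale pS)
  let ?f = "\<lambda>t. max t e" and ?g = "\<lambda>t. sqrt (max t e)" and ?h = "\<lambda>t. 1 / sqrt (max t e)"
  have cg: "continuous_on (intv z) ?g" by (intro continuous_intros)
  have ch: "continuous_on (intv z) ?h" by (intro continuous_intros) (use e in auto)
  have zf: "z = fc z ?f" by (rule pos_ge_fc) (use p zS in \<open>simp_all add: z_def\<close>)
  define c where "c = fc z ?g"
  define w where "w = fc z ?h"
  have cS: "c \<in> SB" and wS: "w \<in> SB" unfolding c_def w_def using fc_SB zS cg ch by blast+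
  have cc: "c \<odot> c = z"
  proof -
    have "c \<odot> c = fc z (\<lambda>t. ?g t * ?g t)" unfolding c_def by (rule fc_mult[OF zS cg cg, symmetric])
    also have "\<dots> = fc z ?f" by (rule fc_cong) (use e in auto)
    finally show ?thesis using zf by simp
  qed
  have wc: "B.U w (B.U c v) = v" for v
  proof -
    have "fc z (\<lambda>t. ?h t * ?g t) = fc z (\<lambda>t. 1)" by (rule fc_cong) (use e in auto)
    then show ?thesis unfolding w_def c_def U_fc_fc[OF zS ch cg] by (simp add: fc_const zS U_un)
  qed
  let ?M = "sqrt (max (rad z) e)"
  have M: "0 < ?M" using e by simp
  have wl: "pos (w - (1 / ?M) *\<^sub>R un)"
  proof -
    have "w - (1 / ?M) *\<^sub>R un = fc z (\<lambda>t. ?h t - 1 / ?M)"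
      using fc_diff[OF zS ch continuous_on_const, of "1 / ?M"] by (simp add: w_def fc_const zS)
    also have "pos \<dots>"
    proof (rule pos_fcI[OF zS])
      fix t assume "t \<in> intv z"
      then have "?g t \<le> ?M" by auto
      then show "0 \<le> ?h t - 1 / ?M" using e by (simp add: frac_le)
    qed (intro continuous_intros ch)
    finally show ?thesis .
  qed
  let ?x = "B.U c a"
  have "?x \<odot> ?x = B.U ?x un" by (simp add: U_apply_un)
  also have "\<dots> = B.U c (B.U a (B.U c un))" by (rule B.fundamental_formula)
  also have "\<dots> = B.U c (B.U a z)" by (simp add: U_apply_un cc)
  finally have "B.U w (?x \<odot> ?x) = B.U a z" by (simp add: wc)
  moreover have "pos (B.U w (?x \<odot> ?x))"
    by (rule pos_U_of_ge[OF wl wS]) (use M SB_U2[OF cS cS a] in \<open>auto intro: pos_square\<close>)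
  ultimately have "pos (B.U a z)" by simp
  then show "pos (B.U a p + e *\<^sub>R (a \<odot> a))"
    by (simp add: z_def B.U_add B.U_scale U_apply_un)
qed

end

section \<open>Local units for a functional\<close>

context jb_star_algebra
begin

lemma U2_snd: "snd (B.U2 x y z) = snd x * snd y * snd z"
  by (simp add: B.U2_def)

lemma fc_sum_one:
  assumes "H \<in> SB" "continuous_on (intv H) g"
  shows "fc H (\<lambda>t. 1 - g t) = un - fc H g"
  using fc_diff[OF assms(1) continuous_on_const assms(2), of 1] assms(1) by (simp add: fc_const)

lemma U_decompose: "z - B.U e z = 2 *\<^sub>R B.U2 e (un - e) z + B.U (un - e) z"
  using U_un[of z] by (simp add: B.U_diff B.U_add scaleR_2 B.U2_sym[of un e] U_un)

lemma U_combination: "B.U (\<alpha> *\<^sub>R e + \<beta> *\<^sub>R f) z = (\<alpha> * \<alpha>) *\<^sub>R B.U e z + (2 * \<alpha> * \<beta>) *\<^sub>R B.U2 e f z + (\<beta> * \<beta>) *\<^sub>R B.U f z"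
proof -
  have "(2 * \<alpha> * \<beta>) *\<^sub>R B.U2 e f z = (\<alpha> * \<beta>) *\<^sub>R B.U2 e f z + (\<alpha> * \<beta>) *\<^sub>R B.U2 e f z"
    by (simp flip: scaleR_add_left)
  then show ?thesis by (simp add: B.U_add B.U_scale B.U2_sym[of f e] scaleR_add_right mult.commute)
qed

lemma pos_un_diff_norm: "(x, 0) \<in> SB \<Longrightarrow> norm x \<le> c \<Longrightarrow> pos (c *\<^sub>R un - (x, 0))"
  by (rule pos_norm_diff) simp_all

lemma pos_un_add_norm: "(x, 0) \<in> SB \<Longrightarrow> norm x \<le> c \<Longrightarrow> pos (c *\<^sub>R un + (x, 0))"
  using pos_norm_diff[of "(-1) *\<^sub>R (x, 0)" c] SB_scale[of "(x, 0)" "-1"]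
  by (simp add: diff_conv_add_uminus)

text \<open>It is 0 for \<open>k * t \<le> 1\<close> and 1 for \<open>k * t \<ge> 2\<close>. For
  positive \<open>k\<close>, doubling \<open>k\<close> puts the plateau over every point where the
  original is nonzero.\<close>

definition ramp :: "real \<Rightarrow> real \<Rightarrow> real"
  where "ramp k t = max 0 (min 1 (k * t - 1))"

lemma ramp_range: "0 \<le> ramp k t" "ramp k t \<le> 1" by (simp_all add: ramp_def)

lemma ramp_0 [simp]: "ramp k 0 = 0" by (simp add: ramp_def)

lemma continuous_ramp: "continuous_on S (ramp k)"
  unfolding ramp_def by (intro continuous_intros)

text \<open>With \<open>f = un - e\<close>, the operator \<open>U f\<close> sees \<open>H\<close>
  only below \<open>2 / k\<close>, so \<open>p \<le> C H\<close> makes \<open>U f p\<close> small.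
  The mixed term is controlled by a Cauchy-Schwarz argument between \<open>U e p\<close> and
  \<open>U f p\<close>.\<close>

lemma approx_unit:
  assumes H: "pos H" and p: "pos p" "snd p = 0" "norm p \<le> 1" and C: "0 \<le> C" "pos (C *\<^sub>R H - p)"
    and \<eta>: "0 < \<eta>"
  shows "\<exists>k0>0. \<forall>k\<ge>k0. norm (p - B.U (fc H (ramp k)) p) \<le> \<eta>"
proof -
  define s where "s = \<eta> / 3"
  have s: "0 < s" using \<eta> by (simp add: s_def)
  \<comment> \<open>With \<open>\<beta> \<le> b0\<close> both \<open>\<beta>\<close> and
    \<open>\<beta> / s\<close> are at most \<open>s\<close>, so the three errors add up to at most
    \<open>3 * s = \<eta>\<close>.\<close>
  define b0 where "b0 = min s (s * s)"
  have b0: "0 < b0" using s by (simp add: b0_def)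
  define k0 where "k0 = 2 * (C + 1) / b0"
  have k0: "0 < k0" using C b0 by (simp add: k0_def)
  note HS = pos_SB[OF H] and pS = pos_SB[OF p(1)]
  have "norm (p - B.U (fc H (ramp k)) p) \<le> \<eta>" if k: "k \<ge> k0" for k
  proof -
    have kp: "0 < k" using k k0 by linarith
    define e where "e = fc H (ramp k)"
    have cr: "continuous_on (intv H) (ramp k)" by (rule continuous_ramp)
    define f where "f = un - e"
    have cf: "continuous_on (intv H) (\<lambda>t. 1 - ramp k t)" by (intro continuous_intros cr)
    have f: "f = fc H (\<lambda>t. 1 - ramp k t)" unfolding f_def e_def using fc_sum_one[OF HS cr] ..
    have eS: "e \<in> SB" unfolding e_def by (rule fc_SB[OF HS cr])
    have fS: "f \<in> SB" unfolding f_def by (intro SB_diff eS SB_un)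
    define \<beta> where "\<beta> = C * (2 / k)"
    have \<beta>0: "0 \<le> \<beta>" using C kp by (simp add: \<beta>_def)
    have "2 * (C + 1) \<le> b0 * k" using k b0 by (simp add: k0_def divide_le_eq mult.commute)
    then have \<beta>: "\<beta> \<le> b0" using kp by (simp add: \<beta>_def divide_le_eq)
    have fH: "pos ((2 / k) *\<^sub>R un - B.U f H)"
    proof -
      have cc: "continuous_on (intv H) (\<lambda>t. (1 - ramp k t) * (1 - ramp k t))"
        by (intro continuous_intros cr)
      have "B.U f H = (f \<odot> f) \<odot> H"
      proof -
        have HF: "H = fc H (\<lambda>t. t)" using fc_id[OF HS] ..
        have fHf: "f \<odot> (f \<odot> H) = (f \<odot> f) \<odot> H"
          using commutative_subalgebra.F_assoc[OF commutative_subalgebra_gen[OF HS] fc_in_gen[OF HS cf] fc_in_gen[OF HS cf] gen_self]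
          unfolding f[symmetric] ..
        show ?thesis by (simp add: B.U2_def fHf)
      qed
      also have "\<dots> = fc H (\<lambda>t. (1 - ramp k t) * (1 - ramp k t) * t)"
        using fc_mult[OF HS cf cf] fc_mult[OF HS cc continuous_on_id] fc_id[OF HS] f by simp
      finally have "(2 / k) *\<^sub>R un - B.U f H = fc H (\<lambda>t. 2 / k - (1 - ramp k t) * (1 - ramp k t) * t)"
        using fc_diff[OF HS continuous_on_const continuous_on_mult[OF cc continuous_on_id], of "2/k"]
        by (simp add: fc_const HS)
      also have "pos \<dots>"
      proof (rule pos_fcI[OF HS])
        fix t
        show "0 \<le> 2 / k - (1 - ramp k t) * (1 - ramp k t) * t"
        proof (cases "t \<le> 2 / k")
          case True
          have q: "0 \<le> (1 - ramp k t) * (1 - ramp k t)" "(1 - ramp k t) * (1 - ramp k t) \<le> 1"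
            using ramp_range[of k t] by (auto intro: mult_le_one)
          show ?thesis
          proof (cases "0 \<le> t")
            case True
            have "(1 - ramp k t) * (1 - ramp k t) * t \<le> 1 * t" using q True by (intro mult_right_mono)
            then show ?thesis using \<open>t \<le> 2 / k\<close> by simp
          next
            case False
            then have "(1 - ramp k t) * (1 - ramp k t) * t \<le> 0" using q by (simp add: mult_nonneg_nonpos)
            moreover have "0 \<le> 2 / k" using kp by simp
            ultimately show ?thesis by linarith
          qed
        next
          case False
          then have "2 \<le> k * t" using kp by (simp add: divide_le_eq mult.commute not_le divide_less_eq)
          then have "ramp k t = 1" by (simp add: ramp_def)
          then show ?thesis using kp by simp
        qed
      qed (intro continuous_intros continuous_on_mult[OF cc continuous_on_id])
      finally show ?thesis .
    qed
    have Ufp: "pos (\<beta> *\<^sub>R un - B.U f p)"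
    proof -
      have "pos (B.U f (C *\<^sub>R H - p) + C *\<^sub>R ((2 / k) *\<^sub>R un - B.U f H))"
        by (intro pos_add pos_scale pos_U fS C fH)
      then show ?thesis by (simp add: B.U_diff B.U_scale \<beta>_def scaleR_diff_right)
    qed
    have Uf0: "pos (B.U f p)" by (intro pos_U fS p)
    have pp: "pos (un - p)"
      using pos_un_diff_norm[of "fst p" 1] pS p by (metis norm_embed prod.collapse scaleR_one)
    have ee: "pos (un - e \<odot> e)"
    proof -
      have "un - e \<odot> e = fc H (\<lambda>t. 1 - ramp k t * ramp k t)"
        unfolding e_def fc_mult[OF HS cr cr, symmetric] by (rule fc_sum_one[symmetric, OF HS]) (intro continuous_intros cr)
      also have "pos \<dots>"
        by (rule pos_fcI[OF HS]) (use ramp_range in \<open>auto intro!: continuous_intros cr mult_le_one\<close>)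
      finally show ?thesis .
    qed
    have Uep: "pos (un - B.U e p)"
    proof -
      have "pos (B.U e (un - p) + (un - e \<odot> e))" by (intro pos_add pos_U eS pp ee)
      then show ?thesis by (simp add: B.U_diff U_apply_un)
    qed
    \<comment> \<open>Positivity of \<open>U (sqrt s e + (\<sigma> / sqrt s) f) p\<close> weights
      the two diagonal terms by \<open>s\<close> and \<open>1 / s\<close>, for both signs
      \<open>\<sigma>\<close>.\<close>
    have cross: "pos ((s + \<beta> / s) *\<^sub>R un + (2 * \<sigma>) *\<^sub>R B.U2 e f p)" if \<sigma>: "\<sigma> * \<sigma> = 1" for \<sigma>
    proof -
      have "pos (B.U (sqrt s *\<^sub>R e + (\<sigma> / sqrt s) *\<^sub>R f) p)"
        by (intro pos_U SB_add SB_scale eS fS p)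
      moreover have "sqrt s * sqrt s = s" "2 * sqrt s * (\<sigma> / sqrt s) = 2 * \<sigma>" "\<sigma> / sqrt s * (\<sigma> / sqrt s) = 1 / s"
        using s \<sigma> by (simp_all add: field_simps)
      ultimately have "pos (s *\<^sub>R B.U e p + (2 * \<sigma>) *\<^sub>R B.U2 e f p + (1 / s) *\<^sub>R B.U f p)"
        unfolding U_combination by (simp only:)
      then have "pos (s *\<^sub>R (un - B.U e p) + (1 / s) *\<^sub>R (\<beta> *\<^sub>R un - B.U f p)
          + (s *\<^sub>R B.U e p + (2 * \<sigma>) *\<^sub>R B.U2 e f p + (1 / s) *\<^sub>R B.U f p))"
        using s by (intro pos_add[OF pos_add[OF pos_scale[OF Uep] pos_scale[OF Ufp]]]) simp_all
      then show ?thesis by (simp add: scaleR_diff_right scaleR_add_left)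
    qed
    let ?d = "p - B.U e p"
    have d: "?d = 2 *\<^sub>R B.U2 e f p + B.U f p" unfolding f_def by (rule U_decompose)
    have "norm ?d \<le> s + \<beta> / s + \<beta>"
    proof (rule norm_le_of_pos)
      show "?d \<in> SB" by (intro SB_diff SB_U2 pS eS)
      show "snd ?d = 0" using p by (simp add: U2_snd)
      show "0 \<le> s + \<beta> / s + \<beta>" using s \<beta>0 by simp
      have "pos ((s + \<beta> / s) *\<^sub>R un + (2 * (-1)) *\<^sub>R B.U2 e f p + (\<beta> *\<^sub>R un - B.U f p))"
        by (intro pos_add cross Ufp) simp
      then show "pos ((s + \<beta> / s + \<beta>) *\<^sub>R un - ?d)" unfolding d by (simp add: scaleR_add_left algebra_simps)
      have "pos ((s + \<beta> / s) *\<^sub>R un + (2 * 1) *\<^sub>R B.U2 e f p + B.U f p + \<beta> *\<^sub>R un)"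
        by (intro pos_add cross Uf0 pos_un \<beta>0) simp
      then show "pos ((s + \<beta> / s + \<beta>) *\<^sub>R un + ?d)" unfolding d by (simp add: scaleR_add_left algebra_simps)
    qed
    moreover have "\<beta> / s \<le> s" using \<beta> s by (simp add: b0_def divide_le_eq)
    moreover have "\<beta> \<le> s" using \<beta> by (simp add: b0_def)
    ultimately show ?thesis unfolding e_def[symmetric] by (simp add: s_def)
  qed
  then show ?thesis using k0 by blast
qed

text \<open>If \<open>\<rho>\<close> almost attains its norm \<open>N\<close> at \<open>x \<approx> U e x\<close> then perturbing \<open>x\<close> by the diagonal part
  \<open>U (un - e) y\<close> does not increase its norm, and perturbing it by the off-diagonal part
  \<open>2 t U2 e (un - e) y\<close> increases it only by \<open>t\<^sup>2\<close>; so \<open>\<rho>\<close> is small on both parts.\<close>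

lemma functional_local_unit:
  fixes \<rho> :: "'a \<Rightarrow> real"
  assumes \<rho>: "linear \<rho>" and N: "0 \<le> N" "\<And>x. star x = x \<Longrightarrow> \<bar>\<rho> x\<bar> \<le> N * norm x"
    and x: "star x = x" "norm x \<le> 1" "\<rho> x \<ge> N - \<epsilon>"
    and H: "H \<in> SB" and g: "continuous_on (intv H) g" "\<And>t. 0 \<le> g t" "\<And>t. g t \<le> 1"
    and e: "e = fc H g" and xe: "norm ((x, 0) - B.U e (x, 0)) \<le> \<eta>"
    and y: "pos (y, 0)" "norm y \<le> 1" and \<tau>: "0 < \<tau>"
  shows "\<bar>\<rho> (y - fst (B.U e (y, 0)))\<bar> \<le> N * \<tau> + (\<epsilon> + N * \<eta>) / \<tau> + (\<epsilon> + N * \<eta>)"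
proof -
  interpret \<rho>: linear \<rho> by (rule \<rho>)
  let ?Y = "(y, 0::real)" and ?X = "(x, 0::real)"
  define f where "f = un - e"
  define \<sigma> where "\<sigma> = \<epsilon> + N * \<eta>"
  have cf: "continuous_on (intv H) (\<lambda>t. 1 - g t)" by (intro continuous_intros g)
  have f: "f = fc H (\<lambda>t. 1 - g t)" unfolding f_def e using fc_sum_one[OF H g(1)] ..
  have eS: "e \<in> SB" unfolding e by (rule fc_SB[OF H g(1)])
  have fS: "f \<in> SB" unfolding f_def by (intro SB_diff eS SB_un)
  have XS: "?X \<in> SB" using x by (simp add: SB_def)
  have YS: "?Y \<in> SB" using y(1) by (rule pos_SB)
  have X1: "pos (un - ?X)" "pos (un + ?X)"
    using pos_un_diff_norm[OF XS x(2)] pos_un_add_norm[OF XS x(2)] by simp_all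
  have Y1: "pos (un - ?Y)" using pos_un_diff_norm[OF YS y(2)] by simp
  have ef: "pos (un - e \<odot> e - f \<odot> f)"
  proof -
    have "un - e \<odot> e - f \<odot> f = fc H (\<lambda>t. (1 - g t * g t) - (1 - g t) * (1 - g t))"
      unfolding f unfolding e fc_mult[OF H g(1) g(1), symmetric] fc_mult[OF H cf cf, symmetric]
        fc_sum_one[OF H continuous_on_mult[OF g(1) g(1)], symmetric]
      by (intro fc_diff[symmetric] H continuous_intros g)
    also have "pos \<dots>"
    proof (rule pos_fcI[OF H])
      fix t
      have "(1 - g t * g t) - (1 - g t) * (1 - g t) = 2 * (g t * (1 - g t))" by (simp add: algebra_simps)
      then show "0 \<le> (1 - g t * g t) - (1 - g t) * (1 - g t)" using g(2,3)[of t] by simp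
    qed (intro continuous_intros g)
    finally show ?thesis .
  qed
  have ff: "pos (f \<odot> f)" and ee: "pos (e \<odot> e)" by (intro pos_square fS eS)+
  have Ue: "pos (e \<odot> e - B.U e ?X)" "pos (e \<odot> e + B.U e ?X)"
    using pos_U[OF eS X1(1)] pos_U[OF eS X1(2)] by (simp_all add: B.U_diff B.U_add U_apply_un)
  have UeY: "pos (e \<odot> e - B.U e ?Y)" and UfY: "pos (f \<odot> f - B.U f ?Y)"
    using pos_U[OF eS Y1] pos_U[OF fS Y1] by (simp_all add: B.U_diff U_apply_un)
  have UfY0: "pos (B.U f ?Y)" by (rule pos_U[OF fS y(1)])
  define x' where "x' = fst (B.U e ?X)"
  have X': "B.U e ?X = (x', 0)" by (simp add: x'_def prod_eq_iff U2_snd)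
  have sx': "star x' = x'" using SB_U2[OF eS eS XS] unfolding X' by (simp add: SB_def)
  have "\<bar>\<rho> (x - x')\<bar> \<le> N * norm (x - x')"
    by (rule N) (use x sx' in \<open>simp add: star.diff\<close>)
  also have "\<dots> \<le> N * \<eta>"
    using xe N(1) unfolding X' by (intro mult_left_mono) simp_all
  finally have rx': "\<rho> x' \<ge> N - \<sigma>" using x(3) unfolding \<sigma>_def \<rho>.diff by linarith
  \<comment> \<open>If \<open>x' + \<mu> z\<close> has norm at most \<open>1 + c\<close>, then
    \<open>\<rho>\<close> there is at most \<open>N * (1 + c)\<close>, of which \<open>x'\<close>
    already uses \<open>N - \<sigma>\<close>. The diagonal part takes \<open>c = 0\<close>, the
    off-diagonal part \<open>c = \<tau>\<^sup>2\<close>.\<close>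
  have key: "\<bar>\<rho> z\<bar> \<le> N * c + \<sigma>"
    if z: "(z, 0) \<in> SB" "0 \<le> c"
      and p: "\<And>\<mu>. \<mu> * \<mu> = 1 \<Longrightarrow> pos ((1 + c) *\<^sub>R un - (x', 0) - \<mu> *\<^sub>R (z, 0))"
        "\<And>\<mu>. \<mu> * \<mu> = 1 \<Longrightarrow> pos ((1 + c) *\<^sub>R un + (x', 0) + \<mu> *\<^sub>R (z, 0))" for z c
  proof -
    have "\<mu> * \<rho> z \<le> N * c + \<sigma>" if \<mu>: "\<mu> * \<mu> = 1" for \<mu>
    proof -
      have s: "star (x' + \<mu> *\<^sub>R z) = x' + \<mu> *\<^sub>R z"
        using sx' z(1) by (simp add: SB_def star.add star.scaleR)
      have "norm (x' + \<mu> *\<^sub>R z, 0::real) \<le> 1 + c"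
      proof (rule norm_le_of_pos)
        show "(x' + \<mu> *\<^sub>R z, 0) \<in> SB" using s by (simp add: SB_def)
        show "pos ((1 + c) *\<^sub>R un - (x' + \<mu> *\<^sub>R z, 0))" "pos ((1 + c) *\<^sub>R un + (x' + \<mu> *\<^sub>R z, 0))"
          using p[OF \<mu>] by (simp_all add: un_def diff_diff_eq add.assoc)
      qed (use z in auto)
      then have "\<bar>\<rho> (x' + \<mu> *\<^sub>R z)\<bar> \<le> N * (1 + c)"
        using N(2)[OF s] N(1) by (simp only: norm_embed) (meson mult_left_mono order_trans)
      then show ?thesis using rx' by (simp add: \<rho>.add \<rho>.scale algebra_simps)
    qed
    from this[of 1] this[of "-1"] show ?thesis by simp
  qed
  define z1 where "z1 = fst (B.U f ?Y)"
  have z1: "B.U f ?Y = (z1, 0)" by (simp add: z1_def prod_eq_iff U2_snd)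
  have b1: "pos (f \<odot> f - \<mu> *\<^sub>R B.U f ?Y)" if "\<mu> * \<mu> = 1" for \<mu>
  proof -
    have "(\<mu> - 1) * (\<mu> + 1) = 0" using that by (simp add: algebra_simps)
    then consider "\<mu> = 1" | "\<mu> = -1" by fastforce
    then show ?thesis using UfY pos_add[OF ff UfY0] by cases simp_all
  qed
  have r1: "\<bar>\<rho> z1\<bar> \<le> N * 0 + \<sigma>"
  proof (rule key)
    show "(z1, 0) \<in> SB" unfolding z1[symmetric] by (intro SB_U2 fS YS)
    fix \<mu> :: real assume \<mu>: "\<mu> * \<mu> = 1"
    have "pos ((un - e \<odot> e - f \<odot> f) + (e \<odot> e - B.U e ?X) + (f \<odot> f - \<mu> *\<^sub>R B.U f ?Y))"
      by (intro pos_add ef Ue b1 \<mu>)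
    also have "(un - e \<odot> e - f \<odot> f) + (e \<odot> e - B.U e ?X) + (f \<odot> f - \<mu> *\<^sub>R B.U f ?Y)
        = (1 + 0) *\<^sub>R un - (x', 0) - \<mu> *\<^sub>R (z1, 0)"
      unfolding X' z1 by (simp add: prod_eq_iff)
    finally show "pos ((1 + 0) *\<^sub>R un - (x', 0) - \<mu> *\<^sub>R (z1, 0))" .
    have "pos ((un - e \<odot> e - f \<odot> f) + (e \<odot> e + B.U e ?X) + (f \<odot> f - (- \<mu>) *\<^sub>R B.U f ?Y))"
      by (intro pos_add ef Ue b1) (simp add: \<mu>)
    also have "(un - e \<odot> e - f \<odot> f) + (e \<odot> e + B.U e ?X) + (f \<odot> f - (- \<mu>) *\<^sub>R B.U f ?Y)
        = (1 + 0) *\<^sub>R un + (x', 0) + \<mu> *\<^sub>R (z1, 0)"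
      unfolding X' z1 by (simp add: prod_eq_iff)
    finally show "pos ((1 + 0) *\<^sub>R un + (x', 0) + \<mu> *\<^sub>R (z1, 0))" .
  qed simp
  let ?W = "(2 * \<tau>) *\<^sub>R B.U2 e f ?Y"
  define z2 where "z2 = fst ?W"
  have z2: "?W = (z2, 0)" by (simp add: z2_def prod_eq_iff U2_snd)
  \<comment> \<open>Expand the positive element \<open>U (\<tau> e - \<mu> f) y\<close> and replace
    its diagonal terms by the majorants \<open>e\<^sup>2\<close> and
    \<open>f\<^sup>2\<close>.\<close>
  have b2: "pos ((\<tau> * \<tau>) *\<^sub>R (e \<odot> e) + f \<odot> f - \<mu> *\<^sub>R ?W)" if \<mu>: "\<mu> * \<mu> = 1" for \<mu>
  proof -
    have "pos (B.U (\<tau> *\<^sub>R e + (- \<mu>) *\<^sub>R f) ?Y + (\<tau> * \<tau>) *\<^sub>R (e \<odot> e - B.U e ?Y) + (f \<odot> f - B.U f ?Y))"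
      by (intro pos_add pos_scale pos_U SB_add SB_scale eS fS y UeY UfY) simp
    then show ?thesis
      unfolding U_combination using \<mu> by (simp add: scaleR_diff_right algebra_simps)
  qed
  have r2: "\<bar>\<rho> z2\<bar> \<le> N * (\<tau> * \<tau>) + \<sigma>"
  proof (rule key)
    show "(z2, 0) \<in> SB" unfolding z2[symmetric] by (intro SB_U2 SB_scale eS fS YS)
    fix \<mu> :: real assume \<mu>: "\<mu> * \<mu> = 1"
    have q: "pos ((\<tau> * \<tau>) *\<^sub>R ((un - e \<odot> e - f \<odot> f) + f \<odot> f))"
      by (intro pos_scale pos_add ef ff) simp
    have "pos ((un - e \<odot> e - f \<odot> f) + (e \<odot> e - B.U e ?X) + ((\<tau> * \<tau>) *\<^sub>R (e \<odot> e) + f \<odot> f - \<mu> *\<^sub>R ?W)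
        + (\<tau> * \<tau>) *\<^sub>R ((un - e \<odot> e - f \<odot> f) + f \<odot> f))"
      by (intro pos_add[OF _ q] pos_add ef Ue b2 \<mu>)
    also have "(un - e \<odot> e - f \<odot> f) + (e \<odot> e - B.U e ?X) + ((\<tau> * \<tau>) *\<^sub>R (e \<odot> e) + f \<odot> f - \<mu> *\<^sub>R ?W)
        + (\<tau> * \<tau>) *\<^sub>R ((un - e \<odot> e - f \<odot> f) + f \<odot> f) = (1 + \<tau> * \<tau>) *\<^sub>R un - (x', 0) - \<mu> *\<^sub>R (z2, 0)"
      unfolding X' z2 scaleR_add_left by (simp add: prod_eq_iff scaleR_diff_right)
    finally show "pos ((1 + \<tau> * \<tau>) *\<^sub>R un - (x', 0) - \<mu> *\<^sub>R (z2, 0))" .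
    have "pos ((un - e \<odot> e - f \<odot> f) + (e \<odot> e + B.U e ?X) + ((\<tau> * \<tau>) *\<^sub>R (e \<odot> e) + f \<odot> f - (- \<mu>) *\<^sub>R ?W)
        + (\<tau> * \<tau>) *\<^sub>R ((un - e \<odot> e - f \<odot> f) + f \<odot> f))"
      by (intro pos_add[OF _ q] pos_add ef Ue b2) (simp add: \<mu>)
    also have "(un - e \<odot> e - f \<odot> f) + (e \<odot> e + B.U e ?X) + ((\<tau> * \<tau>) *\<^sub>R (e \<odot> e) + f \<odot> f - (- \<mu>) *\<^sub>R ?W)
        + (\<tau> * \<tau>) *\<^sub>R ((un - e \<odot> e - f \<odot> f) + f \<odot> f) = (1 + \<tau> * \<tau>) *\<^sub>R un + (x', 0) + \<mu> *\<^sub>R (z2, 0)"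
      unfolding X' z2 scaleR_add_left by (simp add: prod_eq_iff scaleR_diff_right)
    finally show "pos ((1 + \<tau> * \<tau>) *\<^sub>R un + (x', 0) + \<mu> *\<^sub>R (z2, 0))" .
  qed simp
  have "?Y - B.U e ?Y = (1 / \<tau>) *\<^sub>R ?W + B.U f ?Y"
    unfolding U_decompose[of ?Y e] f_def[symmetric] using \<tau> by simp
  then have "y - fst (B.U e ?Y) = (1 / \<tau>) *\<^sub>R z2 + z1"
    unfolding z1 z2 by (metis fst_add fst_conv fst_diff fst_scaleR)
  then have "\<rho> (y - fst (B.U e ?Y)) = (1 / \<tau>) * \<rho> z2 + \<rho> z1"
    by (simp add: \<rho>.add \<rho>.scale)
  then have "\<bar>\<rho> (y - fst (B.U e ?Y))\<bar> \<le> (1 / \<tau>) * \<bar>\<rho> z2\<bar> + \<bar>\<rho> z1\<bar>"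
    using abs_triangle_ineq[of "(1 / \<tau>) * \<rho> z2" "\<rho> z1"] \<tau> by (simp add: abs_mult)
  also have "\<dots> \<le> (1 / \<tau>) * (N * (\<tau> * \<tau>) + \<sigma>) + (N * 0 + \<sigma>)"
    using r1 r2 \<tau> by (intro add_mono mult_left_mono) auto
  also have "\<dots> = N * \<tau> + \<sigma> / \<tau> + \<sigma>" using \<tau> by (simp add: field_simps)
  finally show ?thesis unfolding \<sigma>_def .
qed

lemma pos_sum: "finite S \<Longrightarrow> (\<And>i. i \<in> S \<Longrightarrow> pos (a i)) \<Longrightarrow> pos (sum a S)"
  by (induction S rule: finite_induct) (simp_all add: pos_zero pos_add)

text \<open>\<open>H\<close> is the sum of the \<open>q i\<close> with weights
  \<open>2 ^ (-n)\<close> along an enumeration. Dropping all other positive terms gives the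
  majorization with the reciprocal weight as \<open>C\<close>.\<close>

lemma common_majorant:
  fixes q :: "'c::countable \<Rightarrow> 'a \<times> real"
  assumes q: "\<And>i. pos (q i)" "\<And>i. snd (q i) = 0" "\<And>i. norm (q i) \<le> 1"
  shows "\<exists>H. pos H \<and> snd H = 0 \<and> (\<forall>i. \<exists>C\<ge>0. pos (C *\<^sub>R H - q i))"
proof -
  define a where "a n = (1/2) ^ n *\<^sub>R q (from_nat n)" for n :: nat
  have pa: "pos (a n)" for n unfolding a_def by (intro pos_scale q) simp
  have "summable a"
  proof (rule summable_comparison_test')
    show "summable (\<lambda>n. (1/2::real) ^ n)" by (intro summable_geometric) simp
    show "norm (a n) \<le> (1/2) ^ n" for n
      using q(3)[of "from_nat n"] by (simp add: a_def mult_left_le)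
  qed
  then have L: "(\<lambda>n. sum a {..<n}) \<longlonglongrightarrow> suminf a" by (rule summable_LIMSEQ)
  define H where "H = suminf a"
  have "pos H" unfolding H_def by (rule pos_LIMSEQ[OF _ L]) (intro pos_sum pa, simp)
  moreover have "snd H = 0"
  proof -
    have "snd (sum a {..<n}) = 0" for n by (induction n) (simp_all add: a_def q)
    then show ?thesis using tendsto_snd[OF L] unfolding H_def by (simp add: LIMSEQ_const_iff)
  qed
  moreover have "\<exists>C\<ge>0. pos (C *\<^sub>R H - q i)" for i
  proof (intro exI conjI)
    let ?m = "to_nat i"
    have "pos (H - a ?m)"
    proof (rule pos_LIMSEQ)
      show "(\<lambda>n. sum a {..<n + Suc ?m} - a ?m) \<longlonglongrightarrow> H - a ?m"
        unfolding H_def by (rule tendsto_diff[OF LIMSEQ_ignore_initial_segment[OF L] tendsto_const])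
      show "pos (sum a {..<n + Suc ?m} - a ?m)" for n
      proof -
        have "sum a {..<n + Suc ?m} = a ?m + sum a ({..<n + Suc ?m} - {?m})"
          by (rule sum.remove) auto
        then show ?thesis by (simp add: pos_sum pa)
      qed
    qed
    then have "pos (2 ^ ?m *\<^sub>R (H - a ?m))" by (rule pos_scale) simp
    moreover have "2 ^ ?m *\<^sub>R a ?m = q i" by (simp add: a_def power_one_over)
    ultimately show "pos (2 ^ ?m *\<^sub>R H - q i)"
      by (simp add: scaleR_diff_right)
  qed simp
  ultimately show ?thesis by blast
qed

text \<open>These are the positive and negative parts. The factor 2 arises because the interval of a
  unit vector has radius 2, owing to the summand 1 in \<open>rad\<close>.\<close>

lemma pos_decomposition:
  assumes x: "star x = x"
  obtains p q where "pos (p, 0)" "pos (q, 0)" "norm p \<le> 2 * norm x" "norm q \<le> 2 * norm x" "x = p - q"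
proof -
  have normalized: "\<exists>p q. pos (p, 0) \<and> pos (q, 0) \<and> norm p \<le> 2 \<and> norm q \<le> 2 \<and> x = p - q"
    if x: "star x = x" "norm x \<le> 1" for x
  proof -
    let ?X = "(x, 0::real)"
    have XS: "?X \<in> SB" using x by (simp add: SB_def)
    have 1: "continuous_on (intv ?X) (\<lambda>t. max t 0)" "continuous_on (intv ?X) (\<lambda>t. max (- t) 0)"
      by (intro continuous_intros)+
    let ?p = "fc ?X (\<lambda>t. max t 0)" and ?q = "fc ?X (\<lambda>t. max (- t) 0)"
    have b: "\<bar>t\<bar> \<le> 2" if "t \<in> intv ?X" for t
      using that x(2) by (auto simp: rad_def)
    have "norm ?p \<le> 2" by (rule norm_fc_le_ideal[OF XS 1(1)]) (use b in \<open>force\<close>, simp)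
    moreover have "norm ?q \<le> 2" by (rule norm_fc_le_ideal[OF XS 1(2)]) (use b in \<open>force\<close>, simp)
    moreover have s: "snd ?p = 0" "snd ?q = 0" using snd_fc[OF XS] 1 by simp_all
    moreover have "?X = ?p - ?q"
    proof -
      have "?X = fc ?X (\<lambda>t. t)" using fc_id[OF XS] ..
      also have "\<dots> = fc ?X (\<lambda>t. max t 0 - max (- t) 0)" by (rule fc_cong) auto
      also have "\<dots> = ?p - ?q" by (rule fc_diff[OF XS 1])
      finally show ?thesis .
    qed
    moreover have "pos ?p" "pos ?q" by (rule pos_fcI[OF XS 1(1)] pos_fcI[OF XS 1(2)], simp)+
    moreover have "?p = (fst ?p, 0)" "?q = (fst ?q, 0)" using s by (simp_all add: prod_eq_iff)
    ultimately show ?thesis by (metis fst_conv fst_diff norm_embed)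
  qed
  show ?thesis
  proof (cases "x = 0")
    case True
    then show ?thesis using that[of 0 0] pos_zero by (simp add: zero_prod_def)
  next
    case False
    have "star ((1 / norm x) *\<^sub>R x) = (1 / norm x) *\<^sub>R x" "norm ((1 / norm x) *\<^sub>R x) \<le> 1"
      using x False by (simp_all add: star.scaleR)
    from normalized[OF this] obtain p q where pq: "pos (p, 0)" "pos (q, 0)" "norm p \<le> 2" "norm q \<le> 2"
      "(1 / norm x) *\<^sub>R x = p - q" by blast
    have "x = norm x *\<^sub>R ((1 / norm x) *\<^sub>R x)" using False by simp
    then have "x = norm x *\<^sub>R p - norm x *\<^sub>R q" unfolding pq(5) by (simp add: scaleR_diff_right)
    moreover have "norm (norm x *\<^sub>R p) \<le> 2 * norm x" "norm (norm x *\<^sub>R q) \<le> 2 * norm x"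
      using pq(3,4) by (simp_all add: mult.commute[of 2] mult_left_mono)
    ultimately show ?thesis
      using that[of "norm x *\<^sub>R p" "norm x *\<^sub>R q"] pos_scale[OF pq(1), of "norm x"] pos_scale[OF pq(2), of "norm x"]
      by simp
  qed
qed

end

section \<open>The factorization\<close>

context jb_star_algebra
begin

lemma real_functional_norming:
  fixes \<rho> :: "'a \<Rightarrow> real"
  assumes \<rho>: "bounded_linear \<rho>"
  obtains N x where "0 \<le> N" "\<And>x. star x = x \<Longrightarrow> \<bar>\<rho> x\<bar> \<le> N * norm x"
    "\<And>n. star (x n) = x n" "\<And>n. norm (x n) \<le> 1" "\<And>n. \<rho> (x n) \<ge> N - inverse (real (Suc n))"
proof -
  interpret \<rho>: bounded_linear \<rho> by (rule \<rho>)
  define T where "T = \<rho> ` {x. star x = x \<and> norm x \<le> 1}"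
  obtain K where K: "\<And>x. norm (\<rho> x) \<le> norm x * K" "0 < K" using \<rho>.pos_bounded by blast
  have bdd: "bdd_above T"
  proof (rule bdd_aboveI[of _ K])
    fix r assume "r \<in> T"
    then obtain x where x: "r = \<rho> x" "norm x \<le> 1" by (auto simp: T_def)
    have "\<rho> x \<le> norm x * K" using K(1)[of x] by simp
    also have "\<dots> \<le> 1 * K" using x K(2) by (intro mult_right_mono) auto
    finally show "r \<le> K" using x by simp
  qed
  have T0: "0 \<in> T" unfolding T_def using \<rho>.zero star.zero by (intro image_eqI[of _ _ 0]) auto
  define N where "N = Sup T"
  have N: "r \<le> N" if "r \<in> T" for r unfolding N_def using that bdd by (rule cSup_upper)
  have "\<exists>x. star x = x \<and> norm x \<le> 1 \<and> \<rho> x \<ge> N - inverse (real (Suc n))" for n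
  proof -
    have "N - inverse (real (Suc n)) < Sup T" by (simp add: N_def)
    then obtain r where "r \<in> T" "N - inverse (real (Suc n)) < r"
      using less_cSup_iff[OF _ bdd] T0 by blast
    then show ?thesis unfolding T_def by force
  qed
  then obtain x where x: "\<And>n. star (x n) = x n \<and> norm (x n) \<le> 1 \<and> \<rho> (x n) \<ge> N - inverse (real (Suc n))"
    by metis
  have le: "\<rho> v \<le> N * norm v" if v: "star v = v" for v
  proof (cases "v = 0")
    case False
    have "\<rho> ((1 / norm v) *\<^sub>R v) \<in> T"
      unfolding T_def using v False by (intro imageI) (simp add: star.scaleR)
    from N[OF this] show ?thesis using False by (simp add: \<rho>.scaleR divide_le_eq)
  qed (simp add: \<rho>.zero)
  have "\<bar>\<rho> v\<bar> \<le> N * norm v" if "star v = v" for v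
    using le[OF that] le[of "- v"] that by (simp add: star.neg \<rho>.neg)
  then show ?thesis using that[of N x] N[OF T0] x by blast
qed

lemma functional_approx_unit_pos:
  fixes \<rho> :: "'a \<Rightarrow> real"
  assumes \<rho>: "linear \<rho>" and N: "0 \<le> N" "\<And>x. star x = x \<Longrightarrow> \<bar>\<rho> x\<bar> \<le> N * norm x"
    and x: "\<And>n. star (x n) = x n" "\<And>n. norm (x n) \<le> 1" "\<And>n. \<rho> (x n) \<ge> N - inverse (real (Suc n))"
    and H: "pos H" "snd H = 0"
    and p: "\<And>n. pos (p n, 0)" "\<And>n. norm (p n) \<le> 1" "\<And>n. \<exists>C\<ge>0. pos (C *\<^sub>R H - (p n, 0))"
    and q: "\<And>n. pos (q n, 0)" "\<And>n. norm (q n) \<le> 1" "\<And>n. \<exists>C\<ge>0. pos (C *\<^sub>R H - (q n, 0))"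
    and pq: "\<And>n. x n = 2 *\<^sub>R p n - 2 *\<^sub>R q n"
    and \<delta>: "0 < \<delta>"
  shows "\<exists>k0>0. \<forall>k\<ge>k0. \<forall>y. pos (y, 0) \<and> norm y \<le> 1 \<longrightarrow> \<bar>\<rho> (y - fst (B.U (fc H (ramp k)) (y, 0)))\<bar> \<le> \<delta>"
proof -
  \<comment> \<open>The three errors of \<open>functional_local_unit\<close> are to be at most
    \<open>\<delta> / 3\<close> each: \<open>\<tau>\<close> handles \<open>N * \<tau>\<close>, and
    then \<open>n\<close> and \<open>\<eta>\<close> make the remaining quantity at most
    \<open>\<sigma> = \<tau> * \<delta> / 3\<close>, so that it survives division by
    \<open>\<tau>\<close>.\<close>
  define \<tau> where "\<tau> = min 1 (\<delta> / (3 * (N + 1)))"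
  have \<tau>: "0 < \<tau>" "\<tau> \<le> 1" using N \<delta> by (simp_all add: \<tau>_def add_nonneg_pos)
  have N\<tau>: "N * \<tau> \<le> \<delta> / 3"
  proof -
    have "N * \<tau> \<le> (N + 1) * (\<delta> / (3 * (N + 1)))"
      using N \<delta> by (intro mult_mono) (auto simp: \<tau>_def)
    also have "\<dots> = \<delta> / 3" using N by (simp add: field_simps)
    finally show ?thesis .
  qed
  define \<sigma> where "\<sigma> = \<tau> * \<delta> / 3"
  have \<sigma>: "0 < \<sigma>" using \<tau> \<delta> by (simp add: \<sigma>_def)
  obtain n where n: "inverse (real (Suc n)) < \<sigma> / 2"
    using reals_Archimedean[of "\<sigma> / 2"] \<sigma> by auto
  define \<eta> where "\<eta> = \<sigma> / (2 * (N + 1))"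
  have \<eta>: "0 < \<eta>" using \<sigma> N by (simp add: \<eta>_def)
  have N\<eta>: "N * \<eta> \<le> \<sigma> / 2"
  proof -
    have "N * \<eta> \<le> (N + 1) * \<eta>" using \<eta> by (intro mult_right_mono) auto
    also have "\<dots> = \<sigma> / 2" using N by (simp add: \<eta>_def field_simps)
    finally show ?thesis .
  qed
  have approx: "\<exists>k0>0. \<forall>k\<ge>k0. norm ((v, 0) - B.U (fc H (ramp k)) (v, 0)) \<le> \<eta> / 4"
    if v: "pos (v, 0)" "norm v \<le> 1" "\<exists>C\<ge>0. pos (C *\<^sub>R H - (v, 0))" for v
    using that \<eta> by (elim exE conjE, intro approx_unit[OF H(1)]) simp_all
  obtain kp where kp: "0 < kp" "\<And>k. k \<ge> kp \<Longrightarrow> norm ((p n, 0) - B.U (fc H (ramp k)) (p n, 0)) \<le> \<eta> / 4"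
    using approx[OF p] by blast
  obtain kq where kq: "0 < kq" "\<And>k. k \<ge> kq \<Longrightarrow> norm ((q n, 0) - B.U (fc H (ramp k)) (q n, 0)) \<le> \<eta> / 4"
    using approx[OF q] by blast
  have "\<bar>\<rho> (y - fst (B.U (fc H (ramp k)) (y, 0)))\<bar> \<le> \<delta>"
    if k: "k \<ge> max kp kq" and y: "pos (y, 0)" "norm y \<le> 1" for k y
  proof -
    let ?e = "fc H (ramp k)"
    have xe: "norm ((x n, 0) - B.U ?e (x n, 0)) \<le> \<eta>"
    proof -
      let ?P = "(p n, 0::real)" and ?Q = "(q n, 0::real)"
      have "(x n, 0::real) = 2 *\<^sub>R ?P - 2 *\<^sub>R ?Q" by (simp add: pq)
      then have "(x n, 0) - B.U ?e (x n, 0) = 2 *\<^sub>R (?P - B.U ?e ?P) - 2 *\<^sub>R (?Q - B.U ?e ?Q)"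
        by (simp only: B.U_diff B.U_scale scaleR_diff_right) simp
      then have "norm ((x n, 0) - B.U ?e (x n, 0)) \<le> norm (2 *\<^sub>R (?P - B.U ?e ?P)) + norm (2 *\<^sub>R (?Q - B.U ?e ?Q))"
        by (metis norm_triangle_ineq4)
      also have "\<dots> = 2 * norm (?P - B.U ?e ?P) + 2 * norm (?Q - B.U ?e ?Q)"
        by (simp only: norm_scaleR abs_numeral)
      finally show ?thesis using kp(2)[of k] kq(2)[of k] k by linarith
    qed
    have "\<bar>\<rho> (y - fst (B.U ?e (y, 0)))\<bar> \<le> N * \<tau> + (inverse (real (Suc n)) + N * \<eta>) / \<tau> + (inverse (real (Suc n)) + N * \<eta>)"
      by (rule functional_local_unit[OF \<rho> N x(1-3) pos_SB[OF H(1)] continuous_ramp ramp_range refl xe y \<tau>(1)])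
    moreover have s: "inverse (real (Suc n)) + N * \<eta> \<le> \<sigma>" using n N\<eta> by linarith
    then have "(inverse (real (Suc n)) + N * \<eta>) / \<tau> \<le> \<sigma> / \<tau>" using \<tau> by (intro divide_right_mono) auto
    moreover have "\<sigma> / \<tau> = \<delta> / 3" using \<tau> by (simp add: \<sigma>_def)
    moreover have "\<sigma> \<le> \<delta> / 3" using \<tau> \<delta> by (simp add: \<sigma>_def mult_left_le_one_le)
    ultimately show ?thesis using N\<tau> s by linarith
  qed
  then show ?thesis using kp(1) by (intro exI[of _ "max kp kq"]) auto
qed

lemma U_scaleC: "fst (B.U b (scaleC c x, 0)) = scaleC c (fst (B.U b (x, 0)))"
proof -
  have sR: "scaleC c (r *\<^sub>R x) = r *\<^sub>R scaleC c x" for r x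
    unfolding scaleC_of_real[symmetric] by (simp add: mult.commute)
  show ?thesis
    by (simp add: B.U2_def ujp_def A.bilin jprod_scaleC_right sR scale_right_distrib scale_right_diff_distrib)
qed

text \<open>\<open>H\<close> is chosen before \<open>\<delta>\<close>: it dominates the positive
  parts of both norming sequences at once, countably many elements indexed by sign, by real or
  imaginary part, and by \<open>n\<close>.\<close>

lemma functional_approx_unit:
  assumes \<phi>: "\<phi> \<in> complex_dual scaleC"
  obtains H where "pos H" "snd H = 0"
    "\<And>\<delta>. 0 < \<delta> \<Longrightarrow> \<exists>k0>0. \<forall>k\<ge>k0. \<forall>x. cmod (\<phi> x - \<phi> (fst (B.U (fc H (ramp k)) (x, 0)))) \<le> \<delta> * norm x"
proof -
  have bl: "bounded_linear \<phi>" and sc: "\<And>c x. \<phi> (scaleC c x) = c * \<phi> x"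
    using \<phi> by (auto simp: complex_dual_def)
  interpret \<phi>: bounded_linear \<phi> by (rule bl)
  define \<rho> where "\<rho> j x = (if j then Re (\<phi> x) else Im (\<phi> x))" for j x
  have \<rho>bl: "bounded_linear (\<rho> j)" for j
    unfolding \<rho>_def using bounded_linear_compose[OF bounded_linear_Re bl] bounded_linear_compose[OF bounded_linear_Im bl]
    by (cases j) simp_all
  have \<rho>l: "linear (\<rho> j)" for j using \<rho>bl bounded_linear.linear by blast
  have "\<exists>N x. 0 \<le> N \<and> (\<forall>x. star x = x \<longrightarrow> \<bar>\<rho> j x\<bar> \<le> N * norm x) \<and>
    (\<forall>n. star (x n) = x n \<and> norm (x n) \<le> 1 \<and> \<rho> j (x n) \<ge> N - inverse (real (Suc n)))" for j
    by (rule real_functional_norming[OF \<rho>bl[of j]]) blast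
  then obtain N x where N: "\<And>j. 0 \<le> N j" "\<And>j x. star x = x \<Longrightarrow> \<bar>\<rho> j x\<bar> \<le> N j * norm x"
    and x: "\<And>j n. star (x j n) = x j n" "\<And>j n. norm (x j n) \<le> 1" "\<And>j n. \<rho> j (x j n) \<ge> N j - inverse (real (Suc n))"
    by metis
  have "\<exists>p q. pos (p, 0) \<and> pos (q, 0) \<and> norm p \<le> 1 \<and> norm q \<le> 1 \<and> x j n = 2 *\<^sub>R p - 2 *\<^sub>R q" for j n
  proof -
    obtain p q where pq: "pos (p, 0)" "pos (q, 0)" "norm p \<le> 2 * norm (x j n)" "norm q \<le> 2 * norm (x j n)" "x j n = p - q"
      using pos_decomposition[OF x(1)[of j n]] .
    have "pos ((1/2) *\<^sub>R p, 0)" "pos ((1/2) *\<^sub>R q, 0)"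
      using pos_scale[OF pq(1), of "1/2"] pos_scale[OF pq(2), of "1/2"] by simp_all
    moreover have "norm ((1/2) *\<^sub>R p) \<le> 1" "norm ((1/2) *\<^sub>R q) \<le> 1"
      using pq(3,4) x(2)[of j n] by simp_all
    moreover have "x j n = 2 *\<^sub>R ((1/2) *\<^sub>R p) - 2 *\<^sub>R ((1/2) *\<^sub>R q)" using pq(5) by simp
    ultimately show ?thesis by blast
  qed
  then obtain p q where pq: "\<And>j n. pos (p j n, 0) \<and> pos (q j n, 0) \<and> norm (p j n) \<le> 1 \<and> norm (q j n) \<le> 1
      \<and> x j n = 2 *\<^sub>R p j n - 2 *\<^sub>R q j n"
    by metis
  define Q where "Q = (\<lambda>(s, j, n). (if s then p j n else q j n, 0::real))"
  have "\<exists>H. pos H \<and> snd H = 0 \<and> (\<forall>i::bool \<times> bool \<times> nat. \<exists>C\<ge>0. pos (C *\<^sub>R H - Q i))"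
    by (rule common_majorant) (auto simp: Q_def pq)
  then obtain H where H: "pos H" "snd H = 0" and dom: "\<And>i. \<exists>C\<ge>0. pos (C *\<^sub>R H - Q i)" by blast
  have dp: "\<exists>C\<ge>0. pos (C *\<^sub>R H - (p j n, 0))" and dq: "\<exists>C\<ge>0. pos (C *\<^sub>R H - (q j n, 0))" for j n
    using dom[of "(True, j, n)"] dom[of "(False, j, n)"] by (simp_all add: Q_def)
  show ?thesis
  proof (rule that[OF H])
    fix \<delta> :: real assume \<delta>: "0 < \<delta>"
    \<comment> \<open>Real and imaginary parts of the functional double
      \<open>\<delta> / 32\<close>. Splitting a self-adjoint element into positive parts multiplies
      by 4, and splitting a general element into self-adjoint ones by 4 again.\<close>
    have "\<exists>k0>0. \<forall>k\<ge>k0. \<forall>y. pos (y, 0) \<and> norm y \<le> 1 \<longrightarrow> \<bar>\<rho> j (y - fst (B.U (fc H (ramp k)) (y, 0)))\<bar> \<le> \<delta> / 32" for j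
      by (rule functional_approx_unit_pos[OF \<rho>l N(1) N(2) x(1,2,3) H _ _ dp _ _ dq])
         (use pq \<delta> in auto)
    then obtain kk where kk: "\<And>j. 0 < kk j" "\<And>j k y. k \<ge> kk j \<Longrightarrow> pos (y, 0) \<Longrightarrow> norm y \<le> 1 \<Longrightarrow>
        \<bar>\<rho> j (y - fst (B.U (fc H (ramp k)) (y, 0)))\<bar> \<le> \<delta> / 32"
      by metis
    let ?k0 = "max (kk True) (kk False)"
    have "cmod (\<phi> x - \<phi> (fst (B.U (fc H (ramp k)) (x, 0)))) \<le> \<delta> * norm x" if k: "k \<ge> ?k0" for k x
    proof -
      let ?e = "fc H (ramp k)"
      define V where "V x = fst (B.U ?e (x, 0))" for x
      define D where "D x = \<phi> (x - V x)" for x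
      have Vl: "V (x - y) = V x - V y" "V (r *\<^sub>R x) = r *\<^sub>R V x" "V (x + y) = V x + V y" for x y r
        unfolding V_def using B.U_diff(3)[of ?e ?e "(x, 0)" "(y, 0)"] B.U_scale(3)[of ?e ?e r "(x, 0)"]
          B.U_add(3)[of ?e ?e "(x, 0)" "(y, 0)"] by simp_all
      have Dl: "D (x - y) = D x - D y" "D (r *\<^sub>R x) = r *\<^sub>R D x" "D (x + y) = D x + D y" for x y r
        by (simp_all add: D_def Vl \<phi>.diff \<phi>.add \<phi>.scaleR scaleR_diff_right)
      have DC: "D (scaleC c x) = c * D x" for c x
        unfolding D_def V_def U_scaleC by (simp add: sc \<phi>.diff right_diff_distrib)
      have D1: "cmod (D y) \<le> \<delta> / 16" if y: "pos (y, 0)" "norm y \<le> 1" for y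
      proof -
        have "\<bar>Re (D y)\<bar> \<le> \<delta> / 32" "\<bar>Im (D y)\<bar> \<le> \<delta> / 32"
          using kk(2)[of True k y] kk(2)[of False k y] k y by (simp_all add: \<rho>_def D_def V_def)
        then show ?thesis using cmod_le[of "D y"] by linarith
      qed
      have D2: "cmod (D y) \<le> \<delta> / 16 * norm y" if y: "pos (y, 0)" for y
      proof (cases "y = 0")
        case True
        then show ?thesis using Dl(2)[of 0 0] by simp
      next
        case False
        have "pos ((1 / norm y) *\<^sub>R y, 0)" using pos_scale[OF y, of "1 / norm y"] by simp
        from D1[OF this] have "cmod (D ((1 / norm y) *\<^sub>R y)) \<le> \<delta> / 16" using False by simp
        then show ?thesis using False unfolding Dl by (simp add: divide_le_eq mult.commute)
      qed
      have D3: "cmod (D y) \<le> \<delta> / 4 * norm y" if y: "star y = y" for y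
      proof -
        obtain p q where pq: "pos (p, 0)" "pos (q, 0)" "norm p \<le> 2 * norm y" "norm q \<le> 2 * norm y" "y = p - q"
          using pos_decomposition[OF y] .
        have "cmod (D y) \<le> cmod (D p) + cmod (D q)" unfolding pq(5) Dl by (rule norm_triangle_ineq4)
        also have "\<dots> \<le> \<delta> / 16 * norm p + \<delta> / 16 * norm q" by (intro add_mono D2 pq)
        also have "\<dots> \<le> \<delta> / 16 * (2 * norm y) + \<delta> / 16 * (2 * norm y)"
          using \<delta> by (intro add_mono mult_left_mono pq) auto
        finally show ?thesis by simp
      qed
      define x1 where "x1 = (1/2) *\<^sub>R (x + star x)"
      define x2 where "x2 = (1/2) *\<^sub>R scaleC \<i> (star x - x)"
      have "star x1 = x1" by (simp add: x1_def star.scaleR star.add star_star add.commute)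
      have "star x2 = x2" by (simp add: x2_def star.scaleR star_scaleC star.diff star_star scale_right_diff_distrib)
      have sR: "scaleC c (r *\<^sub>R x) = r *\<^sub>R scaleC c x" for c r x
        unfolding scaleC_of_real[symmetric] by (simp add: mult.commute)
      have "scaleC \<i> x2 = (1/2) *\<^sub>R (x - star x)"
        by (simp add: x2_def sR scaleR_diff_right scale_right_diff_distrib)
      then have "x1 + scaleC \<i> x2 = (1/2) *\<^sub>R ((x + star x) + (x - star x))"
        by (simp only: x1_def scaleR_add_right)
      also have "(x + star x) + (x - star x) = x + x" by simp
      also have "(1/2) *\<^sub>R (x + x) = x" by simp
      finally have xx: "x = x1 + scaleC \<i> x2" ..
      have n1: "norm x1 \<le> 2 * norm x"
        using norm_triangle_ineq[of x "star x"] norm_star_le[of x] by (simp add: x1_def)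
      have n2: "norm x2 \<le> 2 * norm x"
        using norm_triangle_ineq4[of "star x" x] norm_star_le[of x] by (simp add: x2_def norm_scaleC)
      have "cmod (D x) \<le> cmod (D x1) + cmod (\<i> * D x2)"
        by (subst xx) (simp add: Dl DC norm_triangle_ineq)
      also have "\<dots> = cmod (D x1) + cmod (D x2)" by (simp add: norm_mult)
      also have "\<dots> \<le> \<delta> / 4 * norm x1 + \<delta> / 4 * norm x2"
        by (intro add_mono D3 \<open>star x1 = x1\<close> \<open>star x2 = x2\<close>)
      also have "\<dots> \<le> \<delta> / 4 * (2 * norm x) + \<delta> / 4 * (2 * norm x)"
        using \<delta> by (intro add_mono mult_left_mono n1 n2) auto
      also have "\<dots> = \<delta> * norm x" by simp
      finally show ?thesis unfolding D_def V_def \<phi>.diff .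
    qed
    then show "\<exists>k0>0. \<forall>k\<ge>k0. \<forall>x. cmod (\<phi> x - \<phi> (fst (B.U (fc H (ramp k)) (x, 0)))) \<le> \<delta> * norm x"
      using kk(1)[of True] by (intro exI[of _ ?k0]) auto
  qed
qed

text \<open>Choose \<open>\<kappa> j\<close> growing fast, put \<open>u j = ramp (\<kappa> j)\<close> and \<open>a = (\<Sum>j. 2\<^sup>-\<^sup>j u j)\<close>.  Each \<open>u j\<close>
  is divisible by \<open>a\<close>, with a quotient \<open>b j\<close> that grows like \<open>2 ^ j\<close> and satisfies
  \<open>b j = u j * b (j + 2)\<close> and \<open>b (j + 1) = u (j + 1) * b (j + 2)\<close>.\<close>

lemma ramp_quotients:
  fixes \<kappa> :: "nat \<Rightarrow> real"
  assumes \<kappa>: "0 < \<kappa> 0" "\<And>j. 2 * \<kappa> j \<le> \<kappa> (Suc j)"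
  obtains a b where "continuous_on UNIV a" "a 0 = 0" "\<And>j. continuous_on UNIV (b j)"
    "\<And>j t. b j t * a t = ramp (\<kappa> j) t" "\<And>j t. \<bar>b j t\<bar> \<le> 2 ^ Suc j" "\<And>j. b j 0 = 0"
    "\<And>j t. b j t = ramp (\<kappa> j) t * b (Suc (Suc j)) t"
    "\<And>j t. b (Suc j) t = ramp (\<kappa> (Suc j)) t * b (Suc (Suc j)) t"
proof -
  have \<kappa>0: "0 < \<kappa> j" for j
  proof (induction j)
    case (Suc j)
    then show ?case using \<kappa>(2)[of j] by linarith
  qed (rule \<kappa>)
  define c where "c j t = (1/2) ^ j * ramp (\<kappa> j) t" for j t
  have c: "0 \<le> c j t" "c j t \<le> (1/2) ^ j" for j t
    using ramp_range[of "\<kappa> j" t] by (simp_all add: c_def mult_left_le)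
  have geo: "summable (\<lambda>j. (1/2::real) ^ j)" by (intro summable_geometric) simp
  define a where "a t = (\<Sum>j. c j t)" for t
  have sc: "summable (\<lambda>j. c j t)" for t
    by (rule summable_comparison_test'[OF geo]) (use c in simp)
  have ul: "uniform_limit UNIV (\<lambda>n t. \<Sum>j<n. c j t) a sequentially"
    unfolding a_def by (rule Weierstrass_m_test[OF _ geo]) (use c in simp)
  have ca: "continuous_on UNIV a"
  proof (rule uniform_limit_theorem[OF _ ul])
    show "\<forall>\<^sub>F n in sequentially. continuous_on UNIV (\<lambda>t. \<Sum>j<n. c j t)"
      unfolding c_def by (intro always_eventually allI continuous_intros continuous_ramp)
  qed simp
  have a0: "a 0 = 0" by (simp add: a_def c_def)
  have ac: "c j t \<le> a t" for j t
    unfolding a_def using sum_le_suminf[OF sc, of "{j}" t] c by simp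
  have one: "ramp (\<kappa> i) t = 1" if "ramp (\<kappa> j) t \<noteq> 0" "j < i" for i j t
  proof -
    have mono: "2 * \<kappa> j \<le> \<kappa> i" using that(2)
    proof (induction i rule: less_Suc_induct)
      case (1 i)
      then show ?case by (rule \<kappa>(2))
    next
      case (2 i k l)
      then show ?case using \<kappa>0[of k] by linarith
    qed
    have t1: "1 < \<kappa> j * t" using that(1) by (auto simp: ramp_def max_def split: if_splits)
    then have "0 < t" using \<kappa>0[of j] by (smt (verit) mult_nonneg_nonpos)
    then have "2 * \<kappa> j * t \<le> \<kappa> i * t" using mono by (intro mult_right_mono) auto
    then show ?thesis using t1 by (simp add: ramp_def)
  qed
  \<comment> \<open>Where \<open>ramp (\<kappa> j)\<close> is nonzero, the next ramp equals 1 and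
    forces \<open>a t \<ge> (1/2) ^ Suc j\<close>. The cutoff is thus invisible there, but keeps the
    denominator positive elsewhere.\<close>
  define m where "m j t = max (a t) ((1/2) ^ Suc j)" for j t
  have m0: "0 < m j t" for j t by (simp add: m_def less_max_iff_disj)
  have ma: "m i t = a t" if "ramp (\<kappa> j) t \<noteq> 0" "j \<le> i" for i j t
  proof -
    have "c (Suc i) t = (1/2) ^ Suc i" using one[OF that(1), of "Suc i"] that(2) by (simp add: c_def)
    then show ?thesis using ac[of "Suc i" t] by (simp add: m_def)
  qed
  define b where "b j t = ramp (\<kappa> j) t / m j t" for j t
  show ?thesis
  proof (rule that[of a b])
    show "continuous_on UNIV (b j)" for j
      unfolding b_def using m0 unfolding m_def
      by (intro continuous_intros continuous_ramp ca) (metis less_irrefl)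
    show "b j t * a t = ramp (\<kappa> j) t" for j t
      using ma[of j t j] m0[of j t] by (cases "ramp (\<kappa> j) t = 0") (auto simp: b_def)
    show "\<bar>b j t\<bar> \<le> 2 ^ Suc j" for j t
    proof -
      have "ramp (\<kappa> j) t / m j t \<le> 1 / (1/2) ^ Suc j"
        using ramp_range[of "\<kappa> j" t] by (intro frac_le) (auto simp: m_def)
      moreover have "0 \<le> ramp (\<kappa> j) t / m j t" using ramp_range[of "\<kappa> j" t] m0[of j t] by simp
      ultimately show ?thesis by (simp add: b_def power_one_over)
    qed
    show "b j 0 = 0" for j by (simp add: b_def)
    show "b j t = ramp (\<kappa> j) t * b (Suc (Suc j)) t" for j t
      using ma[of j t j] ma[of j t "Suc (Suc j)"] one[of j t "Suc (Suc j)"]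
      by (cases "ramp (\<kappa> j) t = 0") (simp_all add: b_def)
    show "b (Suc j) t = ramp (\<kappa> (Suc j)) t * b (Suc (Suc j)) t" for j t
      using ma[of "Suc j" t "Suc j"] ma[of "Suc j" t "Suc (Suc j)"] one[of "Suc j" t "Suc (Suc j)"]
      by (cases "ramp (\<kappa> (Suc j)) t = 0") (simp_all add: b_def)
  qed (rule ca a0)+
qed

text \<open>Formally \<open>\<psi>\<close> is \<open>\<phi>\<close> composed with the inverse of
  \<open>U a\<close>, which need not be bounded. The quotients \<open>b j\<close> are bounded
  substitutes for \<open>1 / a\<close>, and only the values of \<open>\<phi>\<close> along them have
  to converge.\<close>

theorem factorization:
  assumes \<phi>: "\<phi> \<in> complex_dual scaleC"
  shows "\<exists>\<psi>\<in>complex_dual scaleC. \<exists>a. \<forall>x. \<phi> x = \<psi> (jordan_U jprod a x)"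
proof -
  have bl: "bounded_linear \<phi>" and sc: "\<And>c x. \<phi> (scaleC c x) = c * \<phi> x"
    using \<phi> by (auto simp: complex_dual_def)
  interpret \<phi>: bounded_linear \<phi> by (rule bl)
  obtain H where H: "pos H" "snd H = 0"
    and Ha: "\<And>\<delta>. 0 < \<delta> \<Longrightarrow> \<exists>k0>0. \<forall>k\<ge>k0. \<forall>x. cmod (\<phi> x - \<phi> (fst (B.U (fc H (ramp k)) (x, 0)))) \<le> \<delta> * norm x"
    using functional_approx_unit[OF \<phi>] by metis
  note HS = pos_SB[OF H(1)]
  obtain k0 where k0: "\<And>j. 0 < k0 j"
    "\<And>j k x. k \<ge> k0 j \<Longrightarrow> cmod (\<phi> x - \<phi> (fst (B.U (fc H (ramp k)) (x, 0)))) \<le> (1/16) ^ j * norm x"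
  proof -
    have "\<forall>j. \<exists>k0>0. \<forall>k\<ge>k0. \<forall>x. cmod (\<phi> x - \<phi> (fst (B.U (fc H (ramp k)) (x, 0)))) \<le> (1/16) ^ j * norm x"
      by (intro allI Ha) simp
    then show ?thesis using that by metis
  qed
  \<comment> \<open>Doubling is what \<open>ramp_quotients\<close> asks for, and domination of
    \<open>k0\<close> keeps the \<open>j\<close>-th approximation error below
    \<open>(1/16) ^ j\<close>.\<close>
  define \<kappa> where "\<kappa> = rec_nat (k0 0) (\<lambda>j r. max (2 * r) (k0 (Suc j)))"
  have \<kappa>: "\<kappa> 0 = k0 0" "\<kappa> (Suc j) = max (2 * \<kappa> j) (k0 (Suc j))" for j by (simp_all add: \<kappa>_def)
  have \<kappa>01: "0 < \<kappa> 0" "\<And>j. 2 * \<kappa> j \<le> \<kappa> (Suc j)" using k0(1) by (simp_all add: \<kappa>)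
  have \<kappa>k: "k0 j \<le> \<kappa> j" for j by (cases j) (simp_all add: \<kappa>)
  obtain a b where ab: "continuous_on UNIV a" "a 0 = 0" "\<And>j. continuous_on UNIV (b j)"
    "\<And>j t. b j t * a t = ramp (\<kappa> j) t" "\<And>j t. \<bar>b j t\<bar> \<le> 2 ^ Suc j" "\<And>j. b j 0 = 0"
    "\<And>j t. b j t = ramp (\<kappa> j) t * b (Suc (Suc j)) t"
    "\<And>j t. b (Suc j) t = ramp (\<kappa> (Suc j)) t * b (Suc (Suc j)) t"
    by (rule ramp_quotients[OF \<kappa>01]) blast
  have ca: "continuous_on (intv H) a" and cb: "\<And>j. continuous_on (intv H) (b j)"
    using ab(1,3) continuous_on_subset by blast+
  define E where "E j x = fst (B.U (fc H (ramp (\<kappa> j))) (x, 0))" for j x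
  define V where "V j x = fst (B.U (fc H (b j)) (x, 0))" for j x
  have Uf: "B.U g (x, 0) = (fst (B.U g (x, 0)), 0)" for g x
    by (simp add: prod_eq_iff U2_snd)
  \<comment> \<open>Both \<open>V j x\<close> and \<open>V (Suc j) x\<close> are images of the same
    vector \<open>V (Suc (Suc j)) x\<close> under local units, so their \<open>\<phi>\<close>-values
    can be compared through that vector.\<close>
  have EV: "E j (V (Suc (Suc j)) x) = V j x" "E (Suc j) (V (Suc (Suc j)) x) = V (Suc j) x" for j x
    unfolding E_def V_def Uf[symmetric] U_fc_fc[OF HS continuous_ramp cb] ab(7,8)[symmetric] by simp_all
  have E: "cmod (\<phi> x - \<phi> (E j x)) \<le> (1/16) ^ j * norm x" for j x
    unfolding E_def by (rule k0(2)[OF \<kappa>k])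
  have Vn: "norm (V j x) \<le> 192 * 4 ^ j * norm x" for j x
  proof -
    have "norm (fc H (b j)) \<le> 2 ^ Suc j"
      by (rule norm_fc_le_ideal[OF HS cb]) (use ab(5)[of j] ab(6)[of j] H in \<open>simp_all del: power_Suc\<close>)
    have "norm (V j x) = norm (B.U (fc H (b j)) (x, 0))"
      unfolding V_def by (subst (2) Uf) simp
    also have "\<dots> \<le> 48 * (norm (fc H (b j)) * norm (fc H (b j)) * norm (x, 0::real))" by (rule norm_UB_le)
    also have "\<dots> \<le> 48 * (2 ^ Suc j * 2 ^ Suc j * norm x)"
      using \<open>norm (fc H (b j)) \<le> _\<close> by (intro mult_left_mono mult_mono) auto
    also have "\<dots> = 192 * 4 ^ j * norm x"
      using power_mult_distrib[of "2::real" 2 j] by simp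
    finally show ?thesis .
  qed
  \<comment> \<open>The error \<open>(1/16) ^ j\<close> meets a vector of norm at most
    \<open>192 * 4 ^ (j + 2) * norm x\<close>; two such errors give the constant
    \<open>2 * 192 * 16 = 6144\<close> and the summable rate \<open>(1/4) ^ j\<close>.\<close>
  have step: "cmod (\<phi> (V (Suc j) x) - \<phi> (V j x)) \<le> (1/4) ^ j * (6144 * norm x)" for j x
  proof -
    let ?v = "V (Suc (Suc j)) x"
    have "cmod (\<phi> (V (Suc j) x) - \<phi> (V j x)) \<le> cmod (\<phi> ?v - \<phi> (E j ?v)) + cmod (\<phi> ?v - \<phi> (E (Suc j) ?v))"
      unfolding EV using norm_triangle_ineq4[of "\<phi> ?v - \<phi> (V j x)" "\<phi> ?v - \<phi> (V (Suc j) x)"] by simp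
    also have "\<dots> \<le> (1/16) ^ j * norm ?v + (1/16) ^ Suc j * norm ?v" by (intro add_mono E)
    also have "\<dots> \<le> 2 * ((1/16) ^ j * norm ?v)" by simp
    also have "\<dots> \<le> 2 * ((1/16) ^ j * (192 * 4 ^ Suc (Suc j) * norm x))"
      by (intro mult_left_mono Vn) auto
    also have "\<dots> = ((1/16) ^ j * 4 ^ j) * (6144 * norm x)" by simp
    also have "(1/16) ^ j * 4 ^ j = (1/4::real) ^ j" by (simp flip: power_mult_distrib)
    finally show ?thesis .
  qed
  have geo: "summable (\<lambda>j. (1/4::real) ^ j)" by (intro summable_geometric) simp
  have sum: "summable (\<lambda>j. norm (\<phi> (V (Suc j) x) - \<phi> (V j x)))" for x
    by (rule summable_comparison_test'[OF summable_mult2[OF geo, of "6144 * norm x"]]) (use step in simp)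
  have tel: "(\<Sum>j<n. \<phi> (V (Suc j) x) - \<phi> (V j x)) = \<phi> (V n x) - \<phi> (V 0 x)" for n x
    by (rule sum_lessThan_telescope)
  define \<psi> where "\<psi> x = lim (\<lambda>j. \<phi> (V j x))" for x
  have lim: "(\<lambda>j. \<phi> (V j x)) \<longlonglongrightarrow> \<psi> x" for x
  proof -
    from summable_LIMSEQ[OF summable_norm_cancel[OF sum[of x]]]
    have "(\<lambda>n. \<phi> (V n x) - \<phi> (V 0 x)) \<longlonglongrightarrow> (\<Sum>j. \<phi> (V (Suc j) x) - \<phi> (V j x))"
      unfolding tel .
    from tendsto_add[OF this tendsto_const, of "\<phi> (V 0 x)"]
    show ?thesis unfolding \<psi>_def by (simp add: convergent_LIMSEQ_iff[symmetric] convergentI)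
  qed
  have Vl: "V j (x + y) = V j x + V j y" "V j (r *\<^sub>R x) = r *\<^sub>R V j x" "V j (scaleC c x) = scaleC c (V j x)" for j x y r c
    unfolding V_def U_scaleC using B.U_scale(3)[of _ _ r "(x, 0)"] B.U_add(3)[of _ _ "(x, 0)" "(y, 0)"] by simp_all
  have bound: "cmod (\<psi> x) \<le> norm x * (192 * onorm \<phi> + 6144 * (\<Sum>j. (1/4) ^ j))" for x
  proof -
    have le: "cmod (\<phi> (V n x) - \<phi> (V 0 x)) \<le> (\<Sum>j. (1/4) ^ j) * (6144 * norm x)" for n
    proof -
      have "cmod (\<phi> (V n x) - \<phi> (V 0 x)) = cmod (\<Sum>j<n. \<phi> (V (Suc j) x) - \<phi> (V j x))"
        unfolding tel ..
      also have "\<dots> \<le> (\<Sum>j<n. (1/4) ^ j * (6144 * norm x))"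
        by (rule sum_norm_le) (rule step)
      also have "\<dots> = (\<Sum>j<n. (1/4) ^ j) * (6144 * norm x)" by (rule sum_distrib_right[symmetric])
      also have "\<dots> \<le> (\<Sum>j. (1/4) ^ j) * (6144 * norm x)"
        by (intro mult_right_mono sum_le_suminf geo) auto
      finally show ?thesis .
    qed
    have "cmod (\<phi> (V n x)) \<le> norm x * (192 * onorm \<phi> + 6144 * (\<Sum>j. (1/4) ^ j))" for n
    proof -
      have "cmod (\<phi> (V 0 x)) \<le> onorm \<phi> * norm (V 0 x)" by (rule onorm[OF bl])
      also have "\<dots> \<le> onorm \<phi> * (192 * 4 ^ 0 * norm x)" by (intro mult_left_mono Vn onorm_pos_le[OF bl])
      finally have "cmod (\<phi> (V 0 x)) \<le> onorm \<phi> * (192 * norm x)" by simp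
      then have "cmod (\<phi> (V n x)) \<le> onorm \<phi> * (192 * norm x) + (\<Sum>j. (1/4) ^ j) * (6144 * norm x)"
        using le[of n] norm_triangle_sub[of "\<phi> (V n x)" "\<phi> (V 0 x)"] by linarith
      then show ?thesis by (simp only: distrib_left mult_ac)
    qed
    then show ?thesis using LIMSEQ_le_const2[OF tendsto_norm[OF lim[of x]]] by blast
  qed
  have \<psi>: "\<psi> \<in> complex_dual scaleC"
    unfolding complex_dual_def
  proof (intro CollectI conjI allI)
    show "bounded_linear \<psi>"
    proof (rule bounded_linear_intro[OF _ _ bound])
      show "\<psi> (x + y) = \<psi> x + \<psi> y" for x y
        using tendsto_add[OF lim[of x] lim[of y]] lim[of "x + y"] unfolding Vl \<phi>.add by (rule LIMSEQ_unique[rotated])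
      show "\<psi> (r *\<^sub>R x) = r *\<^sub>R \<psi> x" for r x
        using tendsto_scaleR[OF tendsto_const lim[of x], of r] lim[of "r *\<^sub>R x"] unfolding Vl \<phi>.scaleR by (rule LIMSEQ_unique[rotated])
    qed
    show "\<psi> (scaleC c x) = c * \<psi> x" for c x
      using tendsto_mult[OF tendsto_const lim[of x], of c] lim[of "scaleC c x"] unfolding Vl sc by (rule LIMSEQ_unique[rotated])
  qed
  define a0 where "a0 = fst (fc H a)"
  have a0: "fc H a = (a0, 0)" using snd_fc[OF HS ca] ab(2) H(2) by (simp add: a0_def prod_eq_iff)
  have "\<phi> x = \<psi> (jordan_U jprod a0 x)" for x
  proof -
    let ?y = "jordan_U jprod a0 x"
    have y: "(?y, 0) = B.U (fc H a) (x, 0)" by (simp add: a0 U2_A jordan_U_eq)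
    \<comment> \<open>Multiplicativity of \<open>U\<close> on functions of \<open>H\<close> and
      \<open>b j * a = ramp (\<kappa> j)\<close> turn the quotient applied to \<open>U a x\<close>
      into the local unit applied to \<open>x\<close>.\<close>
    have "V j ?y = E j x" for j
      unfolding V_def E_def y U_fc_fc[OF HS cb ca] ab(4) by simp
    then have "(\<lambda>j. \<phi> (E j x)) \<longlonglongrightarrow> \<psi> ?y" using lim[of ?y] by simp
    moreover have "(\<lambda>j. \<phi> (E j x)) \<longlonglongrightarrow> \<phi> x"
    proof -
      have "(\<lambda>j. \<phi> x - \<phi> (E j x)) \<longlonglongrightarrow> 0"
      proof (rule Lim_null_comparison)
        show "\<forall>\<^sub>F j in sequentially. cmod (\<phi> x - \<phi> (E j x)) \<le> (1/16) ^ j * norm x"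
          by (intro always_eventually allI E)
        show "(\<lambda>j. (1/16) ^ j * norm x) \<longlonglongrightarrow> 0"
          by (intro tendsto_mult_left_zero LIMSEQ_realpow_zero) auto
      qed
      from tendsto_diff[OF tendsto_const this, of "\<phi> x"] show ?thesis by simp
    qed
    ultimately show ?thesis using LIMSEQ_unique by blast
  qed
  then show ?thesis using \<psi> by blast
qed

end

theorem corollary3p2:
  fixes scaleC :: "complex \<Rightarrow> 'a::banach \<Rightarrow> 'a"
    and jprod :: "'a \<Rightarrow> 'a \<Rightarrow> 'a"
    and star :: "'a \<Rightarrow> 'a"
    and \<phi> :: "'a \<Rightarrow> complex"
  assumes "jb_star_algebra scaleC jprod star"
    and "\<phi> \<in> complex_dual scaleC"
  shows "\<exists>\<psi>\<in>complex_dual scaleC. \<exists>a.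
    \<phi> = \<psi> \<circ> jordan_U jprod a \<and>
    \<psi> \<circ> jordan_U jprod a =
      (\<lambda>b. 2 * dual_jprod jprod (dual_jprod jprod \<psi> a) a b - dual_jprod jprod \<psi> (jprod a a) b)"
proof -
  interpret jb_star_algebra scaleC jprod star by (rule assms(1))
  obtain \<psi> a where \<psi>: "\<psi> \<in> complex_dual scaleC" "\<And>x. \<phi> x = \<psi> (jordan_U jprod a x)"
    using factorization[OF assms(2)] by blast
  interpret \<psi>: bounded_linear \<psi> using \<psi>(1) by (simp add: complex_dual_def)
  have "\<psi> (jordan_U jprod a b)
      = 2 * dual_jprod jprod (dual_jprod jprod \<psi> a) a b - dual_jprod jprod \<psi> (jprod a a) b" for b
    unfolding jordan_U_def dual_jprod_def jprod_commute[of "jprod a b" a]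
    by (simp add: \<psi>.diff \<psi>.scaleR scaleR_conv_of_real)
  then show ?thesis using \<psi> by (intro bexI[of _ \<psi>] exI[of _ a]) (auto simp: fun_eq_iff)
qed

end
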